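(* Let $\alpha>0$, let $s$ be the largest integer strictly less than $\alpha$, and let $0<p\le2$. There exist constants $C_{p,\alpha},c_{p,\alpha}>0$ depending only on $\alpha$ and $p$ such that the following holds for all $n\in\mathbb N$. (i) For every $d\in\mathbb N$, with $n_1=n/\big[2\binom{d+s}{s}\big]$, $$g^{\mathrm{lin}}_{n,d}(\mathcal R_d^{\alpha,p},L_\infty)\le C_{p,\alpha}\begin{cases}1&: n\le 2d\binom{d+s}{s},\\ \Big[\frac{\log(1+d/\log n_1)}{\log n_1}\Big]^{\alpha(1/\max\{1,p\}-1/2)}&: 2d\binom{d+s}{s}<n\le 2^{d+1}\binom{d+s}{s},\\ n^{-\alpha/d}\,d^{-\alpha(1/\max\{p,1\}-1/2)}&: n>2^{d+1}\binom{d+s}{s}.\end{cases}$$ (ii) For every $d\in\mathbb N$ with $d\ge2$, $$g^{\mathrm{ada}}_{n,d}(\mathcal R_d^{\alpha,p},L_\infty)\ge c_{p,\alpha}\begin{cases}1&: n<d,\\ \Big[\frac{\log(1+d/(2+\log n))}{2+\log n}\Big]^{\alpha(1/p-1/2)}&: d\le n<2^{d-1},\\ n^{-2\alpha/(d-1)}\,d^{-\alpha(1/p-1/2)}&: n\ge2^{d-1}.\end{cases}$$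
   Context: $\mathbb N=\{1,2,\dots\}$; $\log$ is the logarithm to base 2. $\Omega=\bar B_2^d=\{x\in\mathbb R^d:\|x\|_2\le1\}$. Lipschitz spaces: for a domain $D$ (here $D=[-1,1]$), $C^s(D)$ consists of the functions $f:D\to\mathbb R$ with bounded continuous partial derivatives up to order $s$, normed by $\|f\|_{C^s}=\max_{|\gamma|\le s}\|D^\gamma f\|_\infty$. For $0<\beta\le1$ the Hölder constant is $|f|_\beta=\sup_{x\ne y}\frac{|f(x)-f(y)|}{2\min\{1,\|x-y\|_1\}^\beta}$. With $s$ the largest integer strictly less than $\alpha$ and $\beta=\alpha-s\in(0,1]$, $\mathrm{Lip}_\alpha(D)$ is the space of $f\in C^s(D)$ with $\|f\|_{\mathrm{Lip}_\alpha(D)}=\max\{\|f\|_{C^s},\max_{|\gamma|=s}|D^\gamma f|_\beta\}<\infty$. Ridge function class: $\mathcal R_d^{\alpha,p}=\{f:\Omega\to\mathbb R:\ f(x)=g(a\cdot x),\ \|g\|_{\mathrm{Lip}_\alpha[-1,1]}\le1,\ \|a\|_p\le1\}$. Sampling numbers: let $\mathcal F$ be a class of functions on $\Omega$. An adaptive sampling algorithm using at most $n$ points is a map $S=\varphi\circ N:\mathcal F\to L_\infty(\Omega)$, where for some $m\le n$ the information map is $N(f)=(f(x_1),\dots,f(x_m))$ with $x_1\in\Omega$ fixed and each $x_i\in\Omega$ allowed to depend on $f(x_1),\dots,f(x_{i-1})$, and $\varphi:\mathbb R^m\to L_\infty(\Omega)$ is an arbitrary map with $\varphi(0)=0$. The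 algorithm is non-adaptive if $x_1,\dots,x_m$ are fixed independently of $f$, and linear if it is non-adaptive and $\varphi$ is linear. Define $g^{\mathrm{ada}}_{n,d}(\mathcal F,L_\infty)$ (respectively $g^{\mathrm{lin}}_{n,d}(\mathcal F,L_\infty)$) as the infimum of $\sup_{f\in\mathcal F}\|f-S(f)\|_\infty$ over all adaptive (respectively linear) algorithms $S$ using at most $n$ points. *)

theory Defs
  imports "HOL-Analysis.Analysis" "HOL-Probability.Essential_Supremum"
begin

section \<open>The Euclidean ball and \<open>L\<^sub>\<infinity>\<close> of it\<close>

text \<open>The dimension has to be quantified inside the theorem, below the constants, so it cannot be
  a type.  A vector of length \<open>d\<close> is an extensional function on \<open>{..<d}\<close>.\<close>

definition vecs :: "nat \<Rightarrow> (nat \<Rightarrow> real) set" where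
  "vecs d = {..<d} \<rightarrow>\<^sub>E UNIV"

definition dotp :: "nat \<Rightarrow> (nat \<Rightarrow> real) \<Rightarrow> (nat \<Rightarrow> real) \<Rightarrow> real" where
  "dotp d a x = (\<Sum>i<d. a i * x i)"

definition lp_norm :: "real \<Rightarrow> nat \<Rightarrow> (nat \<Rightarrow> real) \<Rightarrow> real" where
  "lp_norm p d a = (\<Sum>i<d. \<bar>a i\<bar> powr p) powr (1 / p)"

definition unit_ball2 :: "nat \<Rightarrow> (nat \<Rightarrow> real) set" where
  "unit_ball2 d = {x \<in> vecs d. L2_set x {..<d} \<le> 1}"

definition ball_measure :: "nat \<Rightarrow> (nat \<Rightarrow> real) measure" where
  "ball_measure d = restrict_space (\<Pi>\<^sub>M i\<in>{..<d}. lborel) (unit_ball2 d)"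

definition Linf_norm :: "nat \<Rightarrow> ((nat \<Rightarrow> real) \<Rightarrow> real) \<Rightarrow> ereal" where
  "Linf_norm d h = esssup (ball_measure d) (\<lambda>x. ereal \<bar>h x\<bar>)"

text \<open>Elements of \<open>L\<^sub>\<infinity>\<close> are given by representatives; equality in \<open>L\<^sub>\<infinity>\<close> is equality almost
  everywhere.  Every class of Lebesgue measurable functions has a Borel measurable member.\<close>

definition Linf :: "nat \<Rightarrow> ((nat \<Rightarrow> real) \<Rightarrow> real) set" where
  "Linf d = {h \<in> borel_measurable (ball_measure d). Linf_norm d h < \<infinity>}"

section \<open>Lipschitz spaces on a set of reals\<close>

text \<open>Derivatives are taken relative to \<open>D\<close>, that is, one-sided at the endpoints of an interval.\<close>

primrec deriv_within :: "real set \<Rightarrow> nat \<Rightarrow> (real \<Rightarrow> real) \<Rightarrow> real \<Rightarrow> real" where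
  "deriv_within D 0 g = g"
| "deriv_within D (Suc k) g = (\<lambda>x. vector_derivative (deriv_within D k g) (at x within D))"

definition C_space :: "real set \<Rightarrow> nat \<Rightarrow> (real \<Rightarrow> real) set" where
  "C_space D s = {g. (\<forall>k<s. deriv_within D k g differentiable_on D) \<and>
     (\<forall>k\<le>s. continuous_on D (deriv_within D k g) \<and> bounded (deriv_within D k g ` D))}"

definition sup_norm :: "real set \<Rightarrow> (real \<Rightarrow> real) \<Rightarrow> ereal" where
  "sup_norm D g = (SUP x\<in>D. ereal \<bar>g x\<bar>)"

definition C_norm :: "real set \<Rightarrow> nat \<Rightarrow> (real \<Rightarrow> real) \<Rightarrow> ereal" where
  "C_norm D s g = (MAX k\<in>{..s}. sup_norm D (deriv_within D k g))"

definition hoelder_const :: "real set \<Rightarrow> real \<Rightarrow> (real \<Rightarrow> real) \<Rightarrow> ereal" where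
  "hoelder_const D \<beta> g =
     (SUP (x, y)\<in>{(x, y). x \<in> D \<and> y \<in> D \<and> x \<noteq> y}.
        ereal (\<bar>g x - g y\<bar> / (2 * (min 1 \<bar>x - y\<bar>) powr \<beta>)))"

text \<open>The largest integer strictly less than \<open>\<alpha>\<close>; used for \<open>\<alpha> > 0\<close> only, where it is a natural
  number.\<close>

definition lip_order :: "real \<Rightarrow> nat" where
  "lip_order \<alpha> = (GREATEST s. real s < \<alpha>)"

definition Lip_norm :: "real set \<Rightarrow> real \<Rightarrow> (real \<Rightarrow> real) \<Rightarrow> ereal" where
  "Lip_norm D \<alpha> g =
     (let s = lip_order \<alpha>
      in max (C_norm D s g) (hoelder_const D (\<alpha> - real s) (deriv_within D s g)))"

definition Lip_space :: "real set \<Rightarrow> real \<Rightarrow> (real \<Rightarrow> real) set" where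
  "Lip_space D \<alpha> = {g \<in> C_space D (lip_order \<alpha>). Lip_norm D \<alpha> g < \<infinity>}"

section \<open>Ridge functions\<close>

definition ridge_class :: "nat \<Rightarrow> real \<Rightarrow> real \<Rightarrow> ((nat \<Rightarrow> real) \<Rightarrow> real) set" where
  "ridge_class d \<alpha> p =
     {restrict (\<lambda>x. g (dotp d a x)) (unit_ball2 d) | g a.
        g \<in> Lip_space {-1..1} \<alpha> \<and> Lip_norm {-1..1} \<alpha> g \<le> 1 \<and>
        a \<in> vecs d \<and> lp_norm p d a \<le> 1}"

section \<open>Sampling algorithms\<close>

text \<open>\<open>X i\<close> maps the first \<open>i\<close> values of the function (a vector of length \<open>i\<close>) to the next sampling
  point; in particular \<open>X 0\<close> only has the empty vector as argument.  The values of \<open>f\<close> at the first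
  \<open>m\<close> points form a vector of length \<open>m\<close>.\<close>

primrec info ::
  "(nat \<Rightarrow> (nat \<Rightarrow> real) \<Rightarrow> nat \<Rightarrow> real) \<Rightarrow> nat \<Rightarrow> ((nat \<Rightarrow> real) \<Rightarrow> real) \<Rightarrow> nat \<Rightarrow> real" where
  "info X 0 f = (\<lambda>_. undefined)"
| "info X (Suc m) f = (info X m f)(m := f (X m (info X m f)))"

definition sampling_scheme ::
  "nat \<Rightarrow> nat \<Rightarrow> (nat \<Rightarrow> (nat \<Rightarrow> real) \<Rightarrow> nat \<Rightarrow> real)
    \<Rightarrow> ((nat \<Rightarrow> real) \<Rightarrow> (nat \<Rightarrow> real) \<Rightarrow> real) \<Rightarrow> bool" where
  "sampling_scheme d m X \<phi> \<longleftrightarrow>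
     (\<forall>i<m. \<forall>y\<in>vecs i. X i y \<in> unit_ball2 d) \<and>
     (\<forall>y\<in>vecs m. \<phi> y \<in> Linf d) \<and>
     (AE x in ball_measure d. \<phi> (\<lambda>i\<in>{..<m}. 0) x = 0)"

definition non_adaptive :: "nat \<Rightarrow> (nat \<Rightarrow> (nat \<Rightarrow> real) \<Rightarrow> nat \<Rightarrow> real) \<Rightarrow> bool" where
  "non_adaptive m X \<longleftrightarrow> (\<forall>i<m. X i constant_on vecs i)"

definition linear_recovery ::
  "nat \<Rightarrow> nat \<Rightarrow> ((nat \<Rightarrow> real) \<Rightarrow> (nat \<Rightarrow> real) \<Rightarrow> real) \<Rightarrow> bool" where
  "linear_recovery d m \<phi> \<longleftrightarrow>
     (\<forall>y\<in>vecs m. \<forall>z\<in>vecs m. \<forall>b c. AE x in ball_measure d.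
        \<phi> (\<lambda>i\<in>{..<m}. b * y i + c * z i) x = b * \<phi> y x + c * \<phi> z x)"

definition adaptive_algorithms ::
  "nat \<Rightarrow> nat \<Rightarrow> (((nat \<Rightarrow> real) \<Rightarrow> real) \<Rightarrow> (nat \<Rightarrow> real) \<Rightarrow> real) set" where
  "adaptive_algorithms n d =
     {\<phi> \<circ> info X m | m X \<phi>. 1 \<le> m \<and> m \<le> n \<and> sampling_scheme d m X \<phi>}"

definition linear_algorithms ::
  "nat \<Rightarrow> nat \<Rightarrow> (((nat \<Rightarrow> real) \<Rightarrow> real) \<Rightarrow> (nat \<Rightarrow> real) \<Rightarrow> real) set" where
  "linear_algorithms n d =
     {\<phi> \<circ> info X m | m X \<phi>. 1 \<le> m \<and> m \<le> n \<and> sampling_scheme d m X \<phi> \<and>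
        non_adaptive m X \<and> linear_recovery d m \<phi>}"

definition worst_case_error ::
  "nat \<Rightarrow> ((nat \<Rightarrow> real) \<Rightarrow> real) set \<Rightarrow> (((nat \<Rightarrow> real) \<Rightarrow> real) \<Rightarrow> (nat \<Rightarrow> real) \<Rightarrow> real) \<Rightarrow> ereal" where
  "worst_case_error d F S = (SUP f\<in>F. Linf_norm d (\<lambda>x. f x - S f x))"

definition g_ada :: "nat \<Rightarrow> nat \<Rightarrow> ((nat \<Rightarrow> real) \<Rightarrow> real) set \<Rightarrow> ereal" where
  "g_ada n d F = (INF S\<in>adaptive_algorithms n d. worst_case_error d F S)"

definition g_lin :: "nat \<Rightarrow> nat \<Rightarrow> ((nat \<Rightarrow> real) \<Rightarrow> real) set \<Rightarrow> ereal" where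
  "g_lin n d F = (INF S\<in>linear_algorithms n d. worst_case_error d F S)"

end

theory Submission
  imports Defs
begin

text \<open>
  Both bounds compare the problem with covering and packing numbers. Write \<open>P = max 1 p\<close>.

  Upper bound. Along each direction a ridge function \<open>g (a \<cdot> x)\<close> has the smoothness of \<open>g\<close>, and
  its Taylor polynomial of order \<open>s\<close> at a centre \<open>c\<close> has an error of order
  \<open>\<bar>a \<cdot> (x - c)\<bar> powr \<alpha>\<close>, with a constant that does not see the dimension. The polynomial has
  \<open>(d + s) choose s\<close> coefficients. They are linear combinations, up to an error that vanishes with
  the step size, of as many function values at the nodes \<open>c + h * \<beta>\<close> with \<open>\<bar>\<beta>\<bar> \<le> s\<close>, because iterated
  forward differences approximate the derivatives (\<open>vdiff_ridge_approximates\<close>). So the error is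
  governed by the number of centres that are needed to make \<open>\<bar>a \<cdot> (x - c)\<bar>\<close> small for all \<open>x\<close> in the
  Euclidean ball and all \<open>a\<close> in the unit ball of \<open>\<ell>\<^sub>p\<close>. As centres serve the points of a cubic grid
  of mesh \<open>\<epsilon>\<close>: rounding every coordinate towards zero is a measurable map, stays in the ball, and
  leaves a remainder that is bounded by \<open>\<epsilon>\<close> in the maximum norm and by \<open>1\<close> in the Euclidean norm.
  The first bound controls the remainder for a fine grid (\<open>abs_dotp_le_cube\<close>), interpolation between
  the two for a coarse one (\<open>abs_dotp_le_interpolated\<close>). Grid points in the ball are counted with the
  generating function of the \<open>\<ell>\<^sub>1\<close> norm (\<open>card_int_vecs_le\<close>), and choosing \<open>\<epsilon>\<close> such that there are at
  most \<open>n1\<close> of them gives the two rates (\<open>g_lin_ridge_le_middle\<close>, \<open>g_lin_ridge_le_large\<close>).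

  Lower bound. A function whose sampled values all vanish is mapped to zero, and the adaptive points
  that produce this information are then fixed points of the ball. Let \<open>U\<close> be a set of more than \<open>n\<close>
  unit vectors with pairwise inner products at most \<open>1 - 2 * \<kappa>\<close> and let the vectors \<open>r * u\<close> lie in
  the unit ball of \<open>\<ell>\<^sub>p\<close>. The caps of height \<open>\<kappa> / 2\<close> around the points of \<open>U\<close> are disjoint, so one of
  them contains no sampling point. A truncated power \<open>max 0 (t - T) powr \<alpha>\<close> in the direction \<open>r * u\<close> of
  that cap vanishes at all sampling points and is as large as \<open>(r * \<kappa>) powr \<alpha>\<close> up to a constant
  (\<open>adaptive_error_ge_spherical_code\<close>). The three cases use the standard basis, normalised indicator
  vectors of sparse sets (\<open>sparse_code_exists\<close>), and a dense code on the whole sphere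
  (\<open>spherical_code_exists\<close>). The last two come from greedy packings, where the balls that are packed
  are again counted by generating functions.
\<close>

section \<open>Counting integer vectors and greedy packing\<close>

lemma sum_geometric_abs_le:
  fixes t :: real
  assumes "0 < t" "t < 1"
  shows "(\<Sum>j\<in>{- int J..int J}. t ^ nat \<bar>j\<bar>) \<le> (1 + t) / (1 - t)"
proof -
  have eq: "(\<Sum>j\<in>{- int J..int J}. t ^ nat \<bar>j\<bar>) * (1 - t) = 1 + t - 2 * t ^ Suc J"
  proof (induction J)
    case 0
    then show ?case by simp
  next
    case (Suc J)
    have "{- int (Suc J)..int (Suc J)} = {- int J..int J} \<union> {- int (Suc J), int (Suc J)}"
      by auto
    then have "(\<Sum>j\<in>{- int (Suc J)..int (Suc J)}. t ^ nat \<bar>j\<bar>)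
        = (\<Sum>j\<in>{- int J..int J}. t ^ nat \<bar>j\<bar>) + (\<Sum>j\<in>{- int (Suc J), int (Suc J)}. t ^ nat \<bar>j\<bar>)"
      by (simp only:) (rule sum.union_disjoint, auto)
    also have "(\<Sum>j\<in>{- int (Suc J), int (Suc J)}. t ^ nat \<bar>j\<bar>) = 2 * t ^ Suc J"
      by (simp add: nat_add_distrib)
    finally have "(\<Sum>j\<in>{- int (Suc J)..int (Suc J)}. t ^ nat \<bar>j\<bar>)
        = (\<Sum>j\<in>{- int J..int J}. t ^ nat \<bar>j\<bar>) + 2 * t ^ Suc J" .
    then have "(\<Sum>j\<in>{- int (Suc J)..int (Suc J)}. t ^ nat \<bar>j\<bar>) * (1 - t)
        = (\<Sum>j\<in>{- int J..int J}. t ^ nat \<bar>j\<bar>) * (1 - t) + 2 * t ^ Suc J * (1 - t)"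
      by (simp only: distrib_right)
    also have "\<dots> = 1 + t - 2 * t ^ Suc (Suc J)"
      unfolding Suc by (simp add: algebra_simps)
    finally show ?case .
  qed
  have "0 \<le> t ^ Suc J" using assms by simp
  then have "(\<Sum>j\<in>{- int J..int J}. t ^ nat \<bar>j\<bar>) * (1 - t) \<le> 1 + t"
    using eq by linarith
  then show ?thesis using assms by (simp add: pos_le_divide_eq)
qed

definition int_vecs :: "nat \<Rightarrow> real \<Rightarrow> (nat \<Rightarrow> int) set" where
  "int_vecs d M = {z \<in> {..<d} \<rightarrow>\<^sub>E UNIV. (\<Sum>i<d. \<bar>real_of_int (z i)\<bar>) \<le> M}"

lemma int_vecs_subset: "int_vecs d M \<subseteq> {..<d} \<rightarrow>\<^sub>E {- int (nat \<lceil>M\<rceil>)..int (nat \<lceil>M\<rceil>)}"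
proof
  fix z assume z: "z \<in> int_vecs d M"
  have "z i \<in> {- int (nat \<lceil>M\<rceil>)..int (nat \<lceil>M\<rceil>)}" if "i < d" for i
  proof -
    have "\<bar>real_of_int (z i)\<bar> \<le> (\<Sum>i<d. \<bar>real_of_int (z i)\<bar>)"
      using that by (intro member_le_sum[where A="{..<d}"]) auto
    also have "\<dots> \<le> M" using z by (simp add: int_vecs_def)
    finally have "real_of_int \<bar>z i\<bar> \<le> M" by simp
    then have "\<bar>z i\<bar> \<le> \<lceil>M\<rceil>" by linarith
    then have "\<bar>z i\<bar> \<le> int (nat \<lceil>M\<rceil>)" by linarith
    then show ?thesis by auto
  qed
  then show "z \<in> {..<d} \<rightarrow>\<^sub>E {- int (nat \<lceil>M\<rceil>)..int (nat \<lceil>M\<rceil>)}"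
    using z by (auto simp: int_vecs_def PiE_iff)
qed

lemma finite_int_vecs: "finite (int_vecs d M)"
  by (rule finite_subset[OF int_vecs_subset]) (auto intro: finite_PiE)

text \<open>Every counted vector contributes at least \<open>t powr M\<close> to the sum of \<open>\<Prod>i<d. t ^ \<bar>z i\<bar>\<close> over a large
  cube, and that sum is a product of \<open>d\<close> geometric series.\<close>

lemma card_int_vecs_le_generating:
  fixes t :: real
  assumes t: "0 < t" "t < 1"
  shows "real (card (int_vecs d M)) \<le> t powr (- M) * ((1 + t) / (1 - t)) ^ d"
proof -
  define J where "J = nat \<lceil>M\<rceil>"
  have nn: "0 \<le> (\<Prod>i<d. t ^ nat \<bar>z i\<bar>)" for z :: "nat \<Rightarrow> int"
    using t by (intro prod_nonneg) auto
  have "1 \<le> t powr (- M) * (\<Prod>i<d. t ^ nat \<bar>z i\<bar>)" if z: "z \<in> int_vecs d M" for z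
  proof -
    have "t ^ nat \<bar>z i\<bar> = t powr \<bar>real_of_int (z i)\<bar>" for i
      using t by (simp add: powr_realpow[symmetric])
    then have "(\<Prod>i<d. t ^ nat \<bar>z i\<bar>) = t powr (\<Sum>i<d. \<bar>real_of_int (z i)\<bar>)"
      using t by (simp add: powr_sum)
    also have "\<dots> \<ge> t powr M"
      using z t by (intro powr_mono') (auto simp: int_vecs_def)
    finally have "t powr (- M) * t powr M \<le> t powr (- M) * (\<Prod>i<d. t ^ nat \<bar>z i\<bar>)"
      by (intro mult_left_mono) auto
    then show ?thesis using t by (simp add: powr_add[symmetric])
  qed
  then have "(\<Sum>z\<in>int_vecs d M. 1) \<le> (\<Sum>z\<in>int_vecs d M. t powr (- M) * (\<Prod>i<d. t ^ nat \<bar>z i\<bar>))"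
    by (intro sum_mono) auto
  also have "\<dots> \<le> (\<Sum>z\<in>{..<d} \<rightarrow>\<^sub>E {- int J..int J}. t powr (- M) * (\<Prod>i<d. t ^ nat \<bar>z i\<bar>))"
    using int_vecs_subset[of d M] nn unfolding J_def by (intro sum_mono2) (auto intro: finite_PiE)
  also have "\<dots> = t powr (- M) * (\<Prod>i<d. \<Sum>j\<in>{- int J..int J}. t ^ nat \<bar>j\<bar>)"
    by (subst prod_sum_PiE) (auto simp: sum_distrib_left)
  also have "\<dots> \<le> t powr (- M) * (\<Prod>i<d. (1 + t) / (1 - t))"
    using t by (intro mult_left_mono prod_mono conjI sum_geometric_abs_le sum_nonneg) auto
  finally show ?thesis by simp
qed

text \<open>Close to the optimal choice of \<open>t\<close>. The first factor dominates for sparse vectors (\<open>M\<close> much smaller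
  than \<open>d\<close>), the second one reflects the volume of the \<open>\<ell>\<^sub>1\<close> ball (\<open>M\<close> much larger than
  \<open>d\<close>), so that one estimate serves both ranges of \<open>n\<close>.\<close>

lemma card_int_vecs_le:
  assumes M: "0 < M" and d: "0 < d"
  shows "real (card (int_vecs d M)) \<le> (1 + d / M) powr M * (1 + 2 * M / d) ^ d"
proof -
  \<comment> \<open>the critical point of the simpler function \<open>t powr (- M) * (1 / (1 - t)) ^ d\<close>\<close>
  define t where "t = M / (M + d)"
  have t: "0 < t" "t < 1" using M d by (auto simp: t_def)
  have "t powr (- M) = (1 / t) powr M"
    using t by (simp add: powr_minus powr_divide divide_simps)
  also have "1 / t = 1 + d / M" using M by (simp add: t_def field_simps)
  finally have 1: "t powr (- M) = (1 + d / M) powr M" .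
  have 2: "1 - t = d / (M + d)" "1 + t = (2 * M + d) / (M + d)"
    using M d by (auto simp: t_def field_simps)
  have "(1 + t) / (1 - t) = (2 * M + d) / d"
    unfolding 2 using M d by simp
  also have "\<dots> = 1 + 2 * M / d" using d by (simp add: field_simps)
  finally have "(1 + t) / (1 - t) = 1 + 2 * M / d" .
  then show ?thesis using card_int_vecs_le_generating[OF t, of d M] 1 by simp
qed

lemma abs_of_int_le_square: "\<bar>real_of_int y\<bar> \<le> (real_of_int y)\<^sup>2"
proof -
  have "\<bar>y\<bar> \<le> y\<^sup>2"
    using mult_left_mono[of 1 "\<bar>y\<bar>" "\<bar>y\<bar>"] by (cases "y = 0") (auto simp: power2_eq_square)
  then have "real_of_int \<bar>y\<bar> \<le> real_of_int (y\<^sup>2)" by (simp only: of_int_le_iff)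
  then show ?thesis by simp
qed

text \<open>The Gilbert--Varshamov argument: the neighbourhoods of a separated set of maximal size cover \<open>A\<close>.\<close>

lemma exists_large_separated_subset:
  assumes "finite A" and refl: "\<And>a. a \<in> A \<Longrightarrow> close a a"
    and sym: "\<And>a b. a \<in> A \<Longrightarrow> b \<in> A \<Longrightarrow> close a b \<Longrightarrow> close b a"
    and V: "\<And>a. a \<in> A \<Longrightarrow> real (card {b \<in> A. close a b}) \<le> V"
  shows "\<exists>U\<subseteq>A. (\<forall>u\<in>U. \<forall>v\<in>U. u \<noteq> v \<longrightarrow> \<not> close u v) \<and> real (card A) \<le> real (card U) * V"
proof -
  define F where "F = {U. U \<subseteq> A \<and> (\<forall>u\<in>U. \<forall>v\<in>U. u \<noteq> v \<longrightarrow> \<not> close u v)}"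
  have "finite F" using \<open>finite A\<close> by (auto simp: F_def)
  moreover have "F \<noteq> {}" by (auto simp: F_def)
  ultimately obtain U where U: "U \<in> F" and max: "\<And>W. W \<in> F \<Longrightarrow> card W \<le> card U"
  proof -
    have "Max (card ` F) \<in> card ` F" using \<open>finite F\<close> \<open>F \<noteq> {}\<close> by (intro Max_in) auto
    then obtain U where "U \<in> F" "card U = Max (card ` F)" by auto
    then show ?thesis using that \<open>finite F\<close> by simp
  qed
  have UA: "U \<subseteq> A" and finU: "finite U"
    using U \<open>finite A\<close> by (auto simp: F_def intro: finite_subset)
  have cover: "A \<subseteq> (\<Union>u\<in>U. {b \<in> A. close u b})"
  proof
    fix b assume b: "b \<in> A"
    show "b \<in> (\<Union>u\<in>U. {b \<in> A. close u b})"
    proof (rule ccontr)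
      assume no: "b \<notin> (\<Union>u\<in>U. {b \<in> A. close u b})"
      then have "b \<notin> U" using refl b by auto
      have "insert b U \<in> F" using U no b sym UA by (auto simp: F_def) blast+
      then have "card (insert b U) \<le> card U" by (rule max)
      then show False using \<open>b \<notin> U\<close> finU by simp
    qed
  qed
  have "card A \<le> card (\<Union>u\<in>U. {b \<in> A. close u b})"
    using cover \<open>finite A\<close> finU by (intro card_mono) auto
  also have "\<dots> \<le> (\<Sum>u\<in>U. card {b \<in> A. close u b})" by (rule card_UN_le[OF finU])
  finally have "real (card A) \<le> (\<Sum>u\<in>U. real (card {b \<in> A. close u b}))"
    by (metis of_nat_mono of_nat_sum)
  also have "\<dots> \<le> (\<Sum>u\<in>U. V)" using V UA by (intro sum_mono) auto
  finally show ?thesis using U by (auto simp: F_def)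
qed

section \<open>Inequalities between \<open>\<ell>\<^sub>p\<close> norms\<close>

lemma lp_norm_le_one_iff:
  assumes "0 < p"
  shows "lp_norm p d a \<le> 1 \<longleftrightarrow> (\<Sum>i<d. \<bar>a i\<bar> powr p) \<le> 1"
proof -
  have nn: "0 \<le> (\<Sum>i<d. \<bar>a i\<bar> powr p)" by (intro sum_nonneg) auto
  show ?thesis unfolding lp_norm_def
  proof
    assume "(\<Sum>i<d. \<bar>a i\<bar> powr p) powr (1 / p) \<le> 1"
    then show "(\<Sum>i<d. \<bar>a i\<bar> powr p) \<le> 1"
      using gr_one_powr[of "\<Sum>i<d. \<bar>a i\<bar> powr p" "1 / p"] assms
      by (meson linorder_not_less zero_less_divide_1_iff)
  qed (use assms nn in \<open>auto intro!: powr_le1\<close>)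
qed

lemma lp_ball_mono:
  fixes d :: nat
  assumes "0 < p" "p \<le> q" and a: "(\<Sum>i<d. \<bar>a i\<bar> powr p) \<le> (1::real)"
  shows "(\<Sum>i<d. \<bar>a i\<bar> powr q) \<le> 1"
proof -
  have "\<bar>a i\<bar> powr q \<le> \<bar>a i\<bar> powr p" if "i < d" for i
  proof -
    have "\<bar>a i\<bar> powr p \<le> (\<Sum>i<d. \<bar>a i\<bar> powr p)"
      using that by (intro member_le_sum[where A="{..<d}"]) auto
    then have "\<bar>a i\<bar> powr p \<le> 1" using a by simp
    then have "\<bar>a i\<bar> \<le> 1"
      using gr_one_powr[of "\<bar>a i\<bar>" p] assms(1) by fastforce
    then show ?thesis using assms by (intro powr_mono') auto
  qed
  then have "(\<Sum>i<d. \<bar>a i\<bar> powr q) \<le> (\<Sum>i<d. \<bar>a i\<bar> powr p)" by (intro sum_mono) auto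
  then show ?thesis using a by linarith
qed

lemma lp_ball_L2:
  assumes "0 < p" "p \<le> 2" "lp_norm p d a \<le> 1"
  shows "L2_set a {..<d} \<le> 1"
proof -
  have "(\<Sum>i<d. \<bar>a i\<bar> powr 2) \<le> 1"
  proof (rule lp_ball_mono[of p])
    show "(\<Sum>i<d. \<bar>a i\<bar> powr p) \<le> 1" using assms lp_norm_le_one_iff by blast
  qed (use assms in auto)
  then show ?thesis by (simp add: L2_set_def)
qed

lemma abs_dotp_le: "\<bar>dotp d a x\<bar> \<le> L2_set a {..<d} * L2_set x {..<d}"
proof -
  have "\<bar>dotp d a x\<bar> \<le> (\<Sum>i<d. \<bar>a i\<bar> * \<bar>x i\<bar>)"
    unfolding dotp_def by (rule order_trans[OF sum_abs]) (simp add: abs_mult)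
  then show ?thesis using L2_set_mult_ineq[of a x "{..<d}"] by linarith
qed

text \<open>With \<open>q\<close> the exponent conjugate to \<open>P\<close>, the two assumptions on \<open>v\<close> give
  \<open>(\<Sum>i<d. \<bar>v i\<bar> powr q) \<le> e powr (q - 2)\<close>, and \<open>(q - 2) / q = 2 / P - 1\<close>. It remains to use the
  duality of \<open>\<ell>\<^sub>P\<close> and \<open>\<ell>\<^sub>q\<close>, here in the form of Young's inequality for the rescaled coordinates.\<close>

lemma abs_dotp_le_interpolated:
  assumes P: "1 \<le> P" "P \<le> 2" and a: "(\<Sum>i<d. \<bar>a i\<bar> powr P) \<le> 1"
    and e: "0 < e" and v: "\<And>i. i < d \<Longrightarrow> \<bar>v i\<bar> \<le> e" and v2: "(\<Sum>i<d. (v i)\<^sup>2) \<le> 1"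
  shows "\<bar>dotp d a v\<bar> \<le> e powr (2 / P - 1)"
proof (cases "P = 1")
  case True
  have "\<bar>dotp d a v\<bar> \<le> (\<Sum>i<d. \<bar>a i\<bar> * \<bar>v i\<bar>)"
    unfolding dotp_def by (rule order_trans[OF sum_abs]) (simp add: abs_mult)
  also have "\<dots> \<le> (\<Sum>i<d. \<bar>a i\<bar> * e)" using v by (intro sum_mono mult_left_mono) auto
  also have "\<dots> = (\<Sum>i<d. \<bar>a i\<bar> powr P) * e" using True by (simp add: sum_distrib_right)
  also have "\<dots> \<le> 1 * e" using a e by (intro mult_right_mono) auto
  finally show ?thesis using True e by simp
next
  case False
  define q where "q = P / (P - 1)"
  have q: "1 < q" "2 \<le> q" "1 / P + 1 / q = 1" using P False by (auto simp: q_def field_simps)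
  define \<theta> where "\<theta> = 2 / P - 1"
  have \<theta>: "\<theta> * q = q - 2" using P False by (simp add: \<theta>_def q_def field_simps)
  have et: "0 < e powr \<theta>" using e by simp
  have w: "(\<bar>v i\<bar> / e powr \<theta>) powr q \<le> (v i)\<^sup>2" if i: "i < d" for i
  proof (cases "v i = 0")
    case False
    have "\<bar>v i\<bar> powr q = \<bar>v i\<bar> powr 2 * \<bar>v i\<bar> powr (q - 2)"
      unfolding powr_add[symmetric] by simp
    also have "\<dots> \<le> \<bar>v i\<bar> powr 2 * e powr (q - 2)"
      using v[OF i] q by (intro mult_left_mono powr_mono2) auto
    also have "\<dots> = (v i)\<^sup>2 * (e powr \<theta>) powr q"
      using False by (simp add: powr_powr \<theta>)
    finally have "\<bar>v i\<bar> powr q / (e powr \<theta>) powr q \<le> (v i)\<^sup>2"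
      using et by (subst pos_divide_le_eq) auto
    then show ?thesis using et by (simp only: powr_divide abs_ge_zero less_imp_le)
  qed (use q in simp)
  have "\<bar>dotp d a v\<bar> \<le> (\<Sum>i<d. \<bar>a i\<bar> * \<bar>v i\<bar>)"
    unfolding dotp_def by (rule order_trans[OF sum_abs]) (simp add: abs_mult)
  also have "\<dots> = e powr \<theta> * (\<Sum>i<d. \<bar>a i\<bar> * (\<bar>v i\<bar> / e powr \<theta>))"
    using et by (simp add: sum_distrib_left)
  also have "(\<Sum>i<d. \<bar>a i\<bar> * (\<bar>v i\<bar> / e powr \<theta>))
      \<le> (\<Sum>i<d. \<bar>a i\<bar> powr P / P + (\<bar>v i\<bar> / e powr \<theta>) powr q / q)"
    using P False q et by (intro sum_mono Youngs_inequality) auto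
  also have "\<dots> = (\<Sum>i<d. \<bar>a i\<bar> powr P) / P + (\<Sum>i<d. (\<bar>v i\<bar> / e powr \<theta>) powr q) / q"
    by (simp add: sum.distrib sum_divide_distrib)
  also have "\<dots> \<le> 1 / P + 1 / q"
  proof (intro add_mono divide_right_mono)
    show "(\<Sum>i<d. (\<bar>v i\<bar> / e powr \<theta>) powr q) \<le> 1"
      by (rule order_trans[OF sum_mono v2]) (use w in auto)
  qed (use a P q in auto)
  finally show ?thesis using q et by (simp add: \<theta>_def)
qed

text \<open>A concave function lies below its tangent, here at \<open>1\<close>.\<close>

lemma powr_le_tangent:
  fixes b \<theta> :: real
  assumes "0 \<le> b" "0 < \<theta>" "\<theta> \<le> 1"
  shows "b powr \<theta> \<le> 1 + \<theta> * (b - 1)"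
proof (cases "b = 0")
  case False
  then show ?thesis
    using Youngs_inequality_0[of \<theta> "1 - \<theta>" b 1] assms by (simp add: algebra_simps)
qed (use assms in auto)

text \<open>The sum is largest when all \<open>b i\<close> equal \<open>1 / d\<close>; the tangent bound is applied to \<open>d * b i\<close>.\<close>

lemma sum_powr_le_concave:
  fixes b :: "nat \<Rightarrow> real"
  assumes d: "0 < d" and \<theta>: "0 < \<theta>" "\<theta> \<le> 1" and b: "\<And>i. i < d \<Longrightarrow> 0 \<le> b i"
    and s: "(\<Sum>i<d. b i) \<le> 1"
  shows "(\<Sum>i<d. b i powr \<theta>) \<le> real d powr (1 - \<theta>)"
proof -
  have "(\<Sum>i<d. b i powr \<theta>) * real d powr \<theta> = (\<Sum>i<d. (d * b i) powr \<theta>)"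
    unfolding sum_distrib_right using b by (intro sum.cong) (auto simp: powr_mult)
  also have "\<dots> \<le> (\<Sum>i<d. 1 + \<theta> * (d * b i - 1))"
    using b \<theta> by (intro sum_mono powr_le_tangent) auto
  also have "\<dots> = d + \<theta> * d * ((\<Sum>i<d. b i) - 1)"
    by (simp add: sum.distrib sum_distrib_left sum_subtractf algebra_simps)
  also have "\<dots> \<le> d"
    using s \<theta> by (simp add: mult_nonneg_nonpos)
  finally have "(\<Sum>i<d. b i powr \<theta>) \<le> d / real d powr \<theta>"
    using d by (simp add: pos_le_divide_eq)
  also have "\<dots> = real d powr (1 - \<theta>)" using d by (simp add: powr_diff)
  finally show ?thesis .
qed

text \<open>For fine grids only the maximum norm of the remainder is used; the \<open>\<ell>\<^sub>1\<close> norm of \<open>a\<close> is compared with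
  its \<open>\<ell>\<^sub>P\<close> norm.\<close>

lemma abs_dotp_le_cube:
  assumes P: "1 \<le> P" and d: "0 < d" and a: "(\<Sum>i<d. \<bar>a i\<bar> powr P) \<le> 1"
    and v: "\<And>i. i < d \<Longrightarrow> \<bar>v i\<bar> \<le> e" and e: "0 < e"
  shows "\<bar>dotp d a v\<bar> \<le> e * real d powr (1 - 1 / P)"
proof -
  have "\<bar>dotp d a v\<bar> \<le> (\<Sum>i<d. \<bar>a i\<bar> * \<bar>v i\<bar>)"
    unfolding dotp_def by (rule order_trans[OF sum_abs]) (simp add: abs_mult)
  also have "\<dots> \<le> (\<Sum>i<d. \<bar>a i\<bar> * e)" using v by (intro sum_mono mult_left_mono) auto
  also have "\<dots> = e * (\<Sum>i<d. (\<bar>a i\<bar> powr P) powr (1 / P))"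
    using P by (simp add: powr_powr sum_distrib_left mult.commute)
  also have "\<dots> \<le> e * real d powr (1 - 1 / P)"
    using assms by (intro mult_left_mono sum_powr_le_concave) auto
  finally show ?thesis .
qed

text \<open>After scaling by this factor the whole Euclidean sphere lies in the unit ball of \<open>\<ell>\<^sub>p\<close>. For flat vectors
  the factor cannot be improved, which is why codes on the whole sphere lose nothing when \<open>n\<close> is at
  least exponential in \<open>d\<close>.\<close>

lemma lp_norm_scaled_unit_le:
  assumes p: "0 < p" "p \<le> 2" and d: "0 < d" and u: "L2_set u {..<d} \<le> 1"
  shows "lp_norm p d (\<lambda>i. real d powr (1 / 2 - 1 / p) * u i) \<le> 1"
proof -
  have "(\<Sum>i<d. (u i)\<^sup>2) \<le> 1" using u by (simp add: L2_set_def)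
  then have "(\<Sum>i<d. ((u i)\<^sup>2) powr (p / 2)) \<le> real d powr (1 - p / 2)"
    using p d by (intro sum_powr_le_concave) auto
  also have "(\<lambda>i. ((u i)\<^sup>2) powr (p / 2)) = (\<lambda>i. \<bar>u i\<bar> powr p)"
  proof
    fix i
    have "((u i)\<^sup>2) powr (p / 2) = (\<bar>u i\<bar> powr 2) powr (p / 2)" by simp
    then show "((u i)\<^sup>2) powr (p / 2) = \<bar>u i\<bar> powr p" by (simp only: powr_powr) simp
  qed
  finally have *: "(\<Sum>i<d. \<bar>u i\<bar> powr p) \<le> real d powr (1 - p / 2)" .
  have "(\<Sum>i<d. \<bar>real d powr (1 / 2 - 1 / p) * u i\<bar> powr p)
      = real d powr (p / 2 - 1) * (\<Sum>i<d. \<bar>u i\<bar> powr p)"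
    using p by (simp add: abs_mult powr_mult powr_powr sum_distrib_left left_diff_distrib)
  also have "\<dots> \<le> real d powr (p / 2 - 1) * real d powr (1 - p / 2)"
    using * by (intro mult_left_mono) auto
  also have "\<dots> = 1" using d by (simp flip: powr_add)
  finally show ?thesis using p by (simp add: lp_norm_le_one_iff)
qed

section \<open>Truncated powers in the Lipschitz ball\<close>

text \<open>At the kink the difference quotient is of order \<open>\<bar>h\<bar> powr (\<gamma> - 1)\<close>; this is where \<open>1 < \<gamma>\<close> enters.\<close>

lemma has_real_derivative_truncated_powr:
  fixes T \<gamma> t :: real
  assumes "1 < \<gamma>"
  shows "((\<lambda>t. max 0 (t - T) powr \<gamma>) has_real_derivative \<gamma> * max 0 (t - T) powr (\<gamma> - 1)) (at t)"
proof -
  consider "t < T" | "t = T" | "T < t" by linarith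
  then show ?thesis
  proof cases
    case 1
    have "((\<lambda>t. 0) has_real_derivative 0) (at t)" by simp
    then have "((\<lambda>t. max 0 (t - T) powr \<gamma>) has_real_derivative 0) (at t)"
    proof (rule has_field_derivative_transform_within_open)
      show "open {..<T}" "t \<in> {..<T}" using 1 by auto
    qed auto
    then show ?thesis using 1 by simp
  next
    case 2
    have "((\<lambda>h. (max 0 (t + h - T) powr \<gamma> - max 0 (t - T) powr \<gamma>) / h) \<longlongrightarrow> 0) (at 0)"
    proof (rule Lim_null_comparison)
      show "\<forall>\<^sub>F h in at 0. norm ((max 0 (t + h - T) powr \<gamma> - max 0 (t - T) powr \<gamma>) / h)
          \<le> \<bar>h\<bar> powr (\<gamma> - 1)"
      proof (rule always_eventually, rule allI)
        fix h :: real
        show "norm ((max 0 (t + h - T) powr \<gamma> - max 0 (t - T) powr \<gamma>) / h) \<le> \<bar>h\<bar> powr (\<gamma> - 1)"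
          using 2 by (cases "0 < h") (auto simp: powr_diff max_def divide_nonneg_neg)
      qed
      have "((\<lambda>h::real. \<bar>h\<bar> powr (\<gamma> - 1)) \<longlongrightarrow> \<bar>0\<bar> powr (\<gamma> - 1)) (at 0)"
        using assms by (intro tendsto_intros) auto
      then show "((\<lambda>h::real. \<bar>h\<bar> powr (\<gamma> - 1)) \<longlongrightarrow> 0) (at 0)" by simp
    qed
    then show ?thesis using 2 by (simp add: DERIV_def)
  next
    case 3
    have "((\<lambda>t. (t - T) powr \<gamma>) has_real_derivative \<gamma> * (t - T) powr (\<gamma> - 1)) (at t)"
      using 3 by (auto intro!: derivative_eq_intros)
    then have "((\<lambda>t. max 0 (t - T) powr \<gamma>) has_real_derivative \<gamma> * (t - T) powr (\<gamma> - 1)) (at t)"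
    proof (rule has_field_derivative_transform_within_open)
      show "open {T<..}" "t \<in> {T<..}" using 3 by auto
    qed auto
    then show ?thesis using 3 by simp
  qed
qed

lemma deriv_within_eqI:
  assumes eq: "\<And>y. y \<in> {-1..1} \<Longrightarrow> deriv_within {-1..1} k g y = G y"
    and der: "(G has_real_derivative G') (at x)" and x: "x \<in> {-1..1}"
  shows "deriv_within {-1..1} (Suc k) g x = G'"
    and "deriv_within {-1..1} k g differentiable (at x within {-1..1})"
proof -
  have "(G has_vector_derivative G') (at x within {-1..1})"
    using der has_field_derivative_at_within has_real_derivative_iff_has_vector_derivative by blast
  then have *: "(deriv_within {-1..1} k g has_vector_derivative G') (at x within {-1..1})"
    by (rule has_vector_derivative_transform[rotated 2]) (use x eq in auto)
  then show "deriv_within {-1..1} (Suc k) g x = G'"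
    using x vector_derivative_within_closed_interval[of "-1" 1 x] by simp
  show "deriv_within {-1..1} k g differentiable (at x within {-1..1})"
    using * by (auto simp: has_vector_derivative_def differentiable_def)
qed

lemma lip_order_bounds:
  assumes "0 < \<alpha>"
  shows "real (lip_order \<alpha>) < \<alpha>" "\<alpha> \<le> real (lip_order \<alpha>) + 1"
proof -
  have b: "y \<le> nat \<lceil>\<alpha>\<rceil>" if "real y < \<alpha>" for y using that by linarith
  show "real (lip_order \<alpha>) < \<alpha>"
    unfolding lip_order_def by (rule GreatestI_nat[where k = 0, OF _ b]) (use assms in auto)
  show "\<alpha> \<le> real (lip_order \<alpha>) + 1"
  proof (rule ccontr)
    assume "\<not> ?thesis"
    then have "real (Suc (lip_order \<alpha>)) < \<alpha>" by simp
    then have "Suc (lip_order \<alpha>) \<le> lip_order \<alpha>"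
      unfolding lip_order_def by (rule Greatest_le_nat) (rule b)
    then show False by simp
  qed
qed

text \<open>Subadditivity of \<open>x powr \<beta>\<close>, from \<open>z \<le> z powr \<beta>\<close> on the unit interval.\<close>

lemma abs_powr_diff_le:
  fixes x y \<beta> :: real
  assumes "0 < \<beta>" "\<beta> \<le> 1" "0 \<le> x" "0 \<le> y"
  shows "\<bar>x powr \<beta> - y powr \<beta>\<bar> \<le> \<bar>x - y\<bar> powr \<beta>"
proof -
  have *: "u powr \<beta> \<le> v powr \<beta> + (u - v) powr \<beta>" if "0 \<le> v" "v < u" for u v :: real
  proof -
    have u: "0 < u" using that by simp
    have le: "z \<le> z powr \<beta>" if "0 \<le> z" "z \<le> 1" for z :: real
      using that assms powr_mono'[of \<beta> 1 z] by (cases "z = 0") auto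
    have "1 = v / u + (u - v) / u" using u by (simp add: field_simps)
    also have "\<dots> \<le> (v / u) powr \<beta> + ((u - v) / u) powr \<beta>"
      using that u by (intro add_mono le) auto
    also have "\<dots> = (v powr \<beta> + (u - v) powr \<beta>) / u powr \<beta>"
      using that u by (simp add: powr_divide add_divide_distrib)
    finally show ?thesis using u by (simp add: pos_le_divide_eq)
  qed
  show ?thesis
  proof (cases x y rule: linorder_cases)
    case less
    then show ?thesis using *[of x y] assms powr_mono2[of \<beta> x y] by simp
  next
    case greater
    then show ?thesis using *[of y x] assms powr_mono2[of \<beta> y x] by simp
  qed simp
qed

text \<open>The factor normalises the function: it compensates the falling factorials
  \<open>\<Prod>j<k. \<alpha> - real j\<close>, which are at most \<open>(1 + \<alpha>) powr \<alpha>\<close>.\<close>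

definition bump :: "real \<Rightarrow> real \<Rightarrow> real \<Rightarrow> real" where
  "bump \<alpha> T t = (1 + \<alpha>) powr (- \<alpha>) * max 0 (t - T) powr \<alpha>"

lemma deriv_within_bump:
  assumes "real k < \<alpha>" and "x \<in> {-1..1}"
  shows "deriv_within {-1..1} k (bump \<alpha> T) x
    = (1 + \<alpha>) powr (- \<alpha>) * (\<Prod>j<k. \<alpha> - real j) * max 0 (x - T) powr (\<alpha> - real k)"
  using assms
proof (induction k arbitrary: x)
  case 0
  then show ?case by (simp add: bump_def)
next
  case (Suc k)
  have "((\<lambda>t. (1 + \<alpha>) powr (- \<alpha>) * (\<Prod>j<k. \<alpha> - real j) * max 0 (t - T) powr (\<alpha> - real k))
      has_real_derivative (1 + \<alpha>) powr (- \<alpha>) * (\<Prod>j<k. \<alpha> - real j) *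
        ((\<alpha> - real k) * max 0 (x - T) powr (\<alpha> - real k - 1))) (at x)"
    using Suc.prems by (intro DERIV_cmult has_real_derivative_truncated_powr) auto
  from deriv_within_eqI(1)[OF _ this] Suc show ?case
    by (simp add: algebra_simps diff_diff_eq)
qed

text \<open>On \<open>{-1..1}\<close> the argument \<open>max 0 (x - T)\<close> stays in the unit interval because \<open>T\<close> is nonnegative. So
  all derivatives up to order \<open>lip_order \<alpha>\<close>, which are positive powers of it, are bounded by their
  leading coefficients, and the last one is Hoelder continuous because its exponent is at most \<open>1\<close>.\<close>

lemma bump_Lip:
  assumes \<alpha>: "0 < \<alpha>" and T: "0 \<le> T"
  shows "bump \<alpha> T \<in> Lip_space {-1..1} \<alpha>" "Lip_norm {-1..1} \<alpha> (bump \<alpha> T) \<le> 1"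
proof -
  define D :: "real set" where "D = {-1..1}"
  define s where "s = lip_order \<alpha>"
  have s: "real s < \<alpha>" "\<alpha> \<le> real s + 1" using lip_order_bounds[OF \<alpha>] by (auto simp: s_def)
  define K where "K k = (1 + \<alpha>) powr (- \<alpha>) * (\<Prod>j<k. \<alpha> - real j)" for k
  have dw: "deriv_within D k (bump \<alpha> T) x = K k * max 0 (x - T) powr (\<alpha> - real k)"
    if "k \<le> s" "x \<in> D" for k x
    using deriv_within_bump[of k \<alpha> x T] that s unfolding D_def K_def by simp
  have K: "0 \<le> K k" "K k \<le> 1" if k: "k \<le> s" for k
  proof -
    show "0 \<le> K k" using s k unfolding K_def by (intro mult_nonneg_nonneg prod_nonneg) auto
    have "(\<Prod>j<k. \<alpha> - real j) \<le> (\<Prod>j<k. 1 + \<alpha>)" using s k by (intro prod_mono) auto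
    also have "\<dots> = (1 + \<alpha>) powr real k" using \<alpha> by (simp add: powr_realpow)
    also have "\<dots> \<le> (1 + \<alpha>) powr \<alpha>" using \<alpha> s k by (intro powr_mono) auto
    finally have "K k \<le> (1 + \<alpha>) powr (- \<alpha>) * (1 + \<alpha>) powr \<alpha>"
      unfolding K_def by (intro mult_left_mono) auto
    then show "K k \<le> 1" using \<alpha> by (simp flip: powr_add)
  qed
  have m: "0 \<le> max 0 (x - T)" "max 0 (x - T) \<le> 1" if "x \<in> D" for x
    using that T by (auto simp: D_def)
  have bd: "\<bar>deriv_within D k (bump \<alpha> T) x\<bar> \<le> 1" if "k \<le> s" "x \<in> D" for k x
  proof -
    have "max 0 (x - T) powr (\<alpha> - real k) \<le> 1"
      using m[OF that(2)] s that by (intro powr_le1) auto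
    then have "K k * max 0 (x - T) powr (\<alpha> - real k) \<le> 1 * 1"
      using K[OF that(1)] by (intro mult_mono) auto
    then show ?thesis using dw[OF that] K[OF that(1)] by simp
  qed
  have C: "bump \<alpha> T \<in> C_space D s"
    unfolding C_space_def
  proof (intro CollectI conjI allI impI)
    fix k assume k: "k < s"
    show "deriv_within D k (bump \<alpha> T) differentiable_on D"
      unfolding differentiable_on_def
    proof
      fix x assume x: "x \<in> D"
      have "((\<lambda>t. K k * max 0 (t - T) powr (\<alpha> - real k)) has_real_derivative
          K k * ((\<alpha> - real k) * max 0 (x - T) powr (\<alpha> - real k - 1))) (at x)"
        using s k by (intro DERIV_cmult has_real_derivative_truncated_powr) auto
      then show "deriv_within D k (bump \<alpha> T) differentiable (at x within D)"
        using deriv_within_eqI(2) dw k x unfolding D_def by (metis less_imp_le)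
    qed
  next
    fix k assume k: "k \<le> s"
    have "continuous_on D (\<lambda>t. K k * max 0 (t - T) powr (\<alpha> - real k))"
      using s k by (intro continuous_intros continuous_on_powr') auto
    then show "continuous_on D (deriv_within D k (bump \<alpha> T))"
      using dw[OF k] by (subst continuous_on_cong) auto
    show "bounded (deriv_within D k (bump \<alpha> T) ` D)"
      using bd[OF k] by (auto simp: bounded_iff)
  qed
  have "C_norm D s (bump \<alpha> T) \<le> 1"
    unfolding C_norm_def sup_norm_def using bd by (auto simp: SUP_le_iff)
  moreover have "hoelder_const D (\<alpha> - real s) (deriv_within D s (bump \<alpha> T)) \<le> 1"
    unfolding hoelder_const_def
  proof (rule SUP_least, clarify)
    fix x y assume x: "x \<in> D" and y: "y \<in> D" and ne: "x \<noteq> y"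
    have "\<bar>deriv_within D s (bump \<alpha> T) x - deriv_within D s (bump \<alpha> T) y\<bar>
        = K s * \<bar>max 0 (x - T) powr (\<alpha> - real s) - max 0 (y - T) powr (\<alpha> - real s)\<bar>"
      using dw[of s] x y K[of s] by (simp flip: right_diff_distrib add: abs_mult)
    also have "\<dots> \<le> 1 * \<bar>max 0 (x - T) - max 0 (y - T)\<bar> powr (\<alpha> - real s)"
      using K[of s] s m x y by (intro mult_mono abs_powr_diff_le) auto
    also have "\<dots> \<le> min 1 \<bar>x - y\<bar> powr (\<alpha> - real s)"
      using m[OF x] m[OF y] s by (simp, intro powr_mono2) (auto simp: max_def)
    also have "\<dots> \<le> 2 * min 1 \<bar>x - y\<bar> powr (\<alpha> - real s)" by simp
    finally show "ereal (\<bar>deriv_within D s (bump \<alpha> T) x - deriv_within D s (bump \<alpha> T) y\<bar> /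
        (2 * min 1 \<bar>x - y\<bar> powr (\<alpha> - real s))) \<le> 1"
      using ne by (simp add: divide_le_eq min_def)
  qed
  ultimately have L: "Lip_norm D \<alpha> (bump \<alpha> T) \<le> 1"
    by (simp add: Lip_norm_def s_def[symmetric] Let_def)
  then have "Lip_norm D \<alpha> (bump \<alpha> T) < \<infinity>" by (rule order_le_less_trans) simp
  with C show "bump \<alpha> T \<in> Lip_space {-1..1} \<alpha>"
    by (simp add: Lip_space_def D_def s_def)
  show "Lip_norm {-1..1} \<alpha> (bump \<alpha> T) \<le> 1" using L by (simp add: D_def)
qed

section \<open>Lower bounds from separated directions\<close>

lemma space_PiM_lborel: "space (\<Pi>\<^sub>M i\<in>{..<d}. lborel :: real measure) = vecs d"
  by (simp add: space_PiM vecs_def)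

lemma unit_ball2_sets: "unit_ball2 d \<in> sets (\<Pi>\<^sub>M i\<in>{..<d}. lborel)"
proof -
  have "unit_ball2 d = {x \<in> space (\<Pi>\<^sub>M i\<in>{..<d}. lborel). sqrt (\<Sum>i<d. (x i)\<^sup>2) \<le> 1}"
    by (simp add: space_PiM_lborel unit_ball2_def L2_set_def)
  also have "\<dots> \<in> sets (\<Pi>\<^sub>M i\<in>{..<d}. lborel)" by measurable
  finally show ?thesis .
qed

lemma space_ball_measure: "space (ball_measure d) = unit_ball2 d"
  by (auto simp: ball_measure_def space_restrict_space space_PiM_lborel unit_ball2_def)

lemma AE_ball_measure_iff:
  "(AE x in ball_measure d. Q x) \<longleftrightarrow> (AE x in (\<Pi>\<^sub>M i\<in>{..<d}. lborel). x \<in> unit_ball2 d \<longrightarrow> Q x)"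
  unfolding ball_measure_def using unit_ball2_sets by (intro AE_restrict_space_iff) auto

text \<open>Boxes of positive volume are the only source of sets of positive measure that is needed.\<close>

lemma box_not_null:
  assumes "0 < \<delta>" and box: "(\<Pi>\<^sub>E i\<in>{..<d}. {y i - \<delta>..y i + \<delta>}) \<subseteq> unit_ball2 d"
  shows "\<not> (AE x in ball_measure d. x \<notin> (\<Pi>\<^sub>E i\<in>{..<d}. {y i - \<delta>..y i + \<delta>}))"
    (is "\<not> (AE x in _. x \<notin> ?B)")
proof
  interpret product_sigma_finite "\<lambda>_::nat. lborel :: real measure" ..
  assume "AE x in ball_measure d. x \<notin> ?B"
  then have "AE x in (\<Pi>\<^sub>M i\<in>{..<d}. lborel). x \<notin> ?B"
    unfolding AE_ball_measure_iff by eventually_elim (use box in blast)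
  moreover have B: "?B \<in> sets (\<Pi>\<^sub>M i\<in>{..<d}. lborel)" by (intro sets_PiM_I_finite) auto
  ultimately have "emeasure (\<Pi>\<^sub>M i\<in>{..<d}. lborel) ?B = 0"
    using AE_iff_measurable[OF B, of "\<lambda>x. x \<notin> ?B"] sets.sets_into_space[OF B]
    by (auto simp: Collect_conj_eq Int_absorb1)
  moreover have "emeasure (\<Pi>\<^sub>M i\<in>{..<d}. lborel) ?B = (\<Prod>i<d. ennreal (2 * \<delta>))"
    using assms(1) by (subst emeasure_PiM) auto
  ultimately show False using assms(1) by simp
qed

lemma dotp_eq_square: "dotp d a a = (L2_set a {..<d})\<^sup>2"
  by (simp add: dotp_def L2_set_def sum_nonneg power2_eq_square)

lemma dotp_add_right: "dotp d a (\<lambda>i. x i + y i) = dotp d a x + dotp d a y"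
  by (simp add: dotp_def sum.distrib distrib_left)

lemma dotp_scale_right: "dotp d a (\<lambda>i. c * x i) = c * dotp d a x"
  by (simp add: dotp_def sum_distrib_left mult.left_commute)

text \<open>The essential supremum is bounded below by a value on a cap because every cap contains a box. The box
  is centred at a point slightly inside the ball, in the direction of \<open>a\<close>.\<close>

lemma Linf_norm_ge_on_cap:
  assumes d: "0 < d" and a: "L2_set a {..<d} = r" and r: "0 < r" "r \<le> 1" and w: "0 < w" "w \<le> 1"
    and h: "\<And>x. x \<in> unit_ball2 d \<Longrightarrow> r - w / 2 \<le> dotp d a x \<Longrightarrow> v \<le> \<bar>h x\<bar>"
    and k: "AE x in ball_measure d. k x = 0"
  shows "ereal v \<le> Linf_norm d (\<lambda>x. h x - k x)"
proof (rule ccontr)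
  assume "\<not> ?thesis"
  then have lt: "Linf_norm d (\<lambda>x. h x - k x) < ereal v" by simp
  have "AE x in ball_measure d. ereal \<bar>h x - k x\<bar> \<le> Linf_norm d (\<lambda>x. h x - k x)"
    unfolding Linf_norm_def by (rule esssup_AE)
  with k have ae: "AE x in ball_measure d. ereal \<bar>h x\<bar> < ereal v"
  proof eventually_elim
    case (elim x)
    then show ?case using order_le_less_trans[OF elim(2) lt] by simp
  qed
  define \<delta> where "\<delta> = w / (4 * d)"
  \<comment> \<open>the box leaves half of the room \<open>w / 2\<close> of the cap, and fits into the ball\<close>
  define y where "y i = (1 - w / 4) / r * a i" for i
  define B where "B = (\<Pi>\<^sub>E i\<in>{..<d}. {y i - \<delta>..y i + \<delta>})"
  have \<delta>: "0 < \<delta>" "d * \<delta> = w / 4" using d w by (auto simp: \<delta>_def)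
  have Ly: "L2_set y {..<d} = 1 - w / 4"
    unfolding y_def using L2_set_right_distrib[of "(1 - w / 4) / r" a "{..<d}"] r w a by simp
  have near: "(\<Sum>i<d. \<bar>x i - y i\<bar>) \<le> w / 4" if "x \<in> B" for x
  proof -
    have "(\<Sum>i<d. \<bar>x i - y i\<bar>) \<le> (\<Sum>i<d. \<delta>)"
      using that by (intro sum_mono) (auto simp: B_def PiE_iff abs_le_iff algebra_simps)
    then show ?thesis using \<delta> by simp
  qed
  have sub: "x \<in> unit_ball2 d" if x: "x \<in> B" for x
  proof -
    have "L2_set (\<lambda>i. y i + (x i - y i)) {..<d} \<le> L2_set y {..<d} + L2_set (\<lambda>i. x i - y i) {..<d}"
      by (rule L2_set_triangle_ineq)
    moreover have "L2_set (\<lambda>i. x i - y i) {..<d} \<le> w / 4"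
      using L2_set_le_sum_abs near[OF x] by (rule order_trans)
    ultimately have "L2_set x {..<d} \<le> 1" using Ly by simp
    then show ?thesis using x by (auto simp: unit_ball2_def vecs_def B_def PiE_iff)
  qed
  have cap: "r - w / 2 \<le> dotp d a x" if x: "x \<in> B" for x
  proof -
    have "dotp d a y = (1 - w / 4) / r * r\<^sup>2"
      unfolding y_def dotp_scale_right by (simp add: dotp_eq_square a)
    then have 1: "dotp d a y = (1 - w / 4) * r" using r by (simp add: power2_eq_square)
    have "\<bar>dotp d a (\<lambda>i. x i - y i)\<bar> \<le> L2_set a {..<d} * L2_set (\<lambda>i. x i - y i) {..<d}"
      by (rule abs_dotp_le)
    also have "\<dots> \<le> 1 * (w / 4)"
    proof (intro mult_mono)
      show "L2_set (\<lambda>i. x i - y i) {..<d} \<le> w / 4"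
        using L2_set_le_sum_abs near[OF x] by (rule order_trans)
    qed (use a r w in auto)
    finally have 2: "- (w / 4) \<le> dotp d a (\<lambda>i. x i - y i)" by simp
    have "dotp d a x = dotp d a y + dotp d a (\<lambda>i. x i - y i)"
      unfolding dotp_add_right[symmetric] by simp
    moreover have "w * r \<le> w" using r w by simp
    ultimately show ?thesis using 1 2 by (simp add: algebra_simps)
  qed
  have "AE x in ball_measure d. x \<notin> B"
    using ae
  proof eventually_elim
    case (elim x)
    then show ?case using h sub cap by force
  qed
  moreover have "\<not> (AE x in ball_measure d. x \<notin> B)"
    unfolding B_def by (rule box_not_null) (use \<delta> sub in \<open>auto simp: B_def\<close>)
  ultimately show False by simp
qed

text \<open>Only the points that the algorithm chooses after seeing zeros matter.\<close>

lemma info_eq_zero: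
  assumes "\<And>i. i < m \<Longrightarrow> f (X i (\<lambda>i\<in>{..<i}. 0)) = 0"
  shows "info X m f = (\<lambda>i\<in>{..<m}. 0)"
  using assms
proof (induction m)
  case (Suc m)
  have "info X m f = (\<lambda>i\<in>{..<m}. 0)" by (rule Suc.IH, rule Suc.prems) simp
  moreover have "f (X m (\<lambda>i\<in>{..<m}. 0)) = 0" using Suc.prems by blast
  ultimately have "info X (Suc m) f = (\<lambda>i\<in>{..<m}. 0)(m := 0)" by (simp only: info.simps)
  also have "\<dots> = (\<lambda>i\<in>{..<Suc m}. 0)" by (simp add: fun_eq_iff)
  finally show ?case .
qed (simp add: fun_eq_iff)

text \<open>Each sampling point lies in at most one of the caps \<open>T < dotp d a x\<close>, so a cap is left over, and the
  truncated power that lives on it cannot be distinguished from zero.\<close>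

lemma adaptive_error_ge:
  assumes \<alpha>: "0 < \<alpha>" and d: "0 < d" and r: "0 < r" "r \<le> 1" and T: "0 \<le> T" "T < r"
    and fin: "finite A" and card: "n < card A"
    and A: "\<And>a. a \<in> A \<Longrightarrow> a \<in> vecs d \<and> lp_norm p d a \<le> 1 \<and> L2_set a {..<d} = r"
    and disj: "\<And>a b x. a \<in> A \<Longrightarrow> b \<in> A \<Longrightarrow> x \<in> unit_ball2 d \<Longrightarrow> T < dotp d a x \<Longrightarrow> T < dotp d b x \<Longrightarrow> a = b"
  shows "ereal ((1 + \<alpha>) powr (- \<alpha>) * ((r - T) / 2) powr \<alpha>) \<le> g_ada n d (ridge_class d \<alpha> p)"
  unfolding g_ada_def
proof (rule INF_greatest)
  fix S assume "S \<in> adaptive_algorithms n d"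
  then obtain m X \<phi> where S: "S = \<phi> \<circ> info X m" and m: "m \<le> n" and sch: "sampling_scheme d m X \<phi>"
    by (auto simp: adaptive_algorithms_def)
  define pt where "pt i = X i (\<lambda>i\<in>{..<i}. 0)" for i
  have pt: "pt i \<in> unit_ball2 d" if "i < m" for i
    using sch that by (auto simp: sampling_scheme_def pt_def vecs_def)
  define hit where "hit i = {a \<in> A. T < dotp d a (pt i)}" for i
  have c1: "card (hit i) \<le> 1" if "i < m" for i
  proof -
    have "a = b" if "a \<in> hit i" "b \<in> hit i" for a b
      using disj[of a b "pt i"] pt[OF \<open>i < m\<close>] that by (auto simp: hit_def)
    then show ?thesis using fin by (simp add: card_le_Suc0_iff_eq hit_def)
  qed
  have "card (\<Union>i<m. hit i) \<le> (\<Sum>i<m. card (hit i))" by (rule card_UN_le) simp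
  also have "\<dots> \<le> (\<Sum>i<m. 1)" using c1 by (intro sum_mono) auto
  also have "\<dots> < card A" using m card by simp
  finally have lt: "card (\<Union>i<m. hit i) < card A" .
  have "\<not> A \<subseteq> (\<Union>i<m. hit i)"
  proof
    assume "A \<subseteq> (\<Union>i<m. hit i)"
    then have "card A \<le> card (\<Union>i<m. hit i)"
      using fin by (intro card_mono) (auto simp: hit_def)
    then show False using lt by simp
  qed
  then obtain a where a: "a \<in> A" and miss: "\<And>i. i < m \<Longrightarrow> dotp d a (pt i) \<le> T"
    by (force simp: hit_def not_less)
  define f where "f = restrict (\<lambda>x. bump \<alpha> T (dotp d a x)) (unit_ball2 d)"
  have f: "f \<in> ridge_class d \<alpha> p"
    unfolding ridge_class_def f_def using bump_Lip[OF \<alpha> T(1)] A[OF a] by blast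
  have "f (X i (\<lambda>i\<in>{..<i}. 0)) = 0" if "i < m" for i
    using miss[OF that] pt[OF that] \<alpha> by (simp add: f_def bump_def pt_def)
  then have Sf: "S f = \<phi> (\<lambda>i\<in>{..<m}. 0)" by (simp add: S info_eq_zero)
  have "ereal ((1 + \<alpha>) powr (- \<alpha>) * ((r - T) / 2) powr \<alpha>) \<le> Linf_norm d (\<lambda>x. f x - S f x)"
  proof (rule Linf_norm_ge_on_cap[where r = r and w = "r - T" and a = a])
    show "AE x in ball_measure d. S f x = 0" using sch by (simp add: Sf sampling_scheme_def)
    fix x assume x: "x \<in> unit_ball2 d" and "r - (r - T) / 2 \<le> dotp d a x"
    then have le: "(r - T) / 2 \<le> max 0 (dotp d a x - T)" using T by (simp add: field_simps)
    have "((r - T) / 2) powr \<alpha> \<le> max 0 (dotp d a x - T) powr \<alpha>"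
      using T \<alpha> by (intro powr_mono2 le) auto
    then show "(1 + \<alpha>) powr (- \<alpha>) * ((r - T) / 2) powr \<alpha> \<le> \<bar>f x\<bar>"
      using x by (simp add: f_def bump_def abs_mult mult_left_mono)
  qed (use d r T A[OF a] in auto)
  also have "\<dots> \<le> worst_case_error d (ridge_class d \<alpha> p) S"
    unfolding worst_case_error_def using f by (rule SUP_upper)
  finally show "ereal ((1 + \<alpha>) powr (- \<alpha>) * ((r - T) / 2) powr \<alpha>)
      \<le> worst_case_error d (ridge_class d \<alpha> p) S" .
qed

text \<open>A point \<open>x\<close> of the ball in the caps of both \<open>u\<close> and \<open>v\<close> satisfies \<open>2 - \<kappa> < dotp d (u + v) x\<close>, hence
  \<open>(2 - \<kappa>)\<^sup>2 < 2 + 2 * dotp d u v\<close>, which contradicts the separation.\<close>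

lemma adaptive_error_ge_spherical_code:
  assumes \<alpha>: "0 < \<alpha>" and p: "0 < p" "p \<le> 2" and d: "0 < d" and r: "0 < r" and \<kappa>: "0 < \<kappa>" "\<kappa> \<le> 1"
    and fin: "finite U" and card: "n < card U"
    and U: "\<And>u. u \<in> U \<Longrightarrow> u \<in> vecs d \<and> L2_set u {..<d} = 1 \<and> lp_norm p d (\<lambda>i. r * u i) \<le> 1"
    and sep: "\<And>u v. u \<in> U \<Longrightarrow> v \<in> U \<Longrightarrow> u \<noteq> v \<Longrightarrow> dotp d u v \<le> 1 - 2 * \<kappa>"
  shows "ereal ((1 + \<alpha>) powr (- \<alpha>) * (r * \<kappa> / 4) powr \<alpha>) \<le> g_ada n d (ridge_class d \<alpha> p)"
proof -
  define sc where "sc u = (\<lambda>i\<in>{..<d}. r * u i)" for u :: "nat \<Rightarrow> real"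
  have inj: "inj_on sc U"
  proof (rule inj_onI)
    fix u v assume u: "u \<in> U" and v: "v \<in> U" and eq: "sc u = sc v"
    have "u i = v i" if "i < d" for i
      using fun_cong[OF eq, of i] that r by (simp add: sc_def)
    then show "u = v" using U[OF u] U[OF v] by (auto simp: vecs_def intro: PiE_ext)
  qed
  have dotsc: "dotp d (sc u) x = r * dotp d u x" for u x
    by (simp add: dotp_def sc_def sum_distrib_left mult.assoc)
  have L2sc: "L2_set (sc u) {..<d} = r * L2_set u {..<d}" for u
    using L2_set_right_distrib[of r u "{..<d}"] r by (simp add: sc_def cong: L2_set_cong_simp)
  have lpsc: "lp_norm p d (sc u) = lp_norm p d (\<lambda>i. r * u i)" for u
    by (simp add: lp_norm_def sc_def)
  have "U \<noteq> {}" using card by auto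
  then obtain u0 where "u0 \<in> U" by auto
  then have r1: "r \<le> 1"
    using U[of u0] lp_ball_L2[OF p, of d "sc u0"] by (simp add: L2sc lpsc)
  have "ereal ((1 + \<alpha>) powr (- \<alpha>) * ((r - r * (1 - \<kappa> / 2)) / 2) powr \<alpha>)
      \<le> g_ada n d (ridge_class d \<alpha> p)"
  proof (rule adaptive_error_ge[where A = "sc ` U"])
    show "n < card (sc ` U)" using card inj by (simp add: card_image)
    show "a \<in> vecs d \<and> lp_norm p d a \<le> 1 \<and> L2_set a {..<d} = r" if "a \<in> sc ` U" for a
      using that U by (auto simp: L2sc lpsc) (simp add: sc_def vecs_def)
    show "a = b" if ab: "a \<in> sc ` U" "b \<in> sc ` U" and x: "x \<in> unit_ball2 d"
      and big: "r * (1 - \<kappa> / 2) < dotp d a x" "r * (1 - \<kappa> / 2) < dotp d b x" for a b x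
    proof (rule ccontr)
      assume "a \<noteq> b"
      obtain u v where u: "u \<in> U" "a = sc u" and v: "v \<in> U" "b = sc v" using ab by auto
      have uv: "dotp d u v \<le> 1 - 2 * \<kappa>" using sep u v \<open>a \<noteq> b\<close> by auto
      have "1 - \<kappa> / 2 < dotp d u x" "1 - \<kappa> / 2 < dotp d v x"
        using big r by (auto simp: u v dotsc)
      then have "2 - \<kappa> < dotp d (\<lambda>i. u i + v i) x"
        by (simp add: dotp_def distrib_right sum.distrib)
      also have "\<dots> \<le> L2_set (\<lambda>i. u i + v i) {..<d} * L2_set x {..<d}"
        using abs_dotp_le abs_le_iff by blast
      also have "\<dots> \<le> L2_set (\<lambda>i. u i + v i) {..<d} * 1"
        using x by (intro mult_left_mono) (auto simp: unit_ball2_def)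
      finally have "(2 - \<kappa>)\<^sup>2 < (L2_set (\<lambda>i. u i + v i) {..<d})\<^sup>2"
        using \<kappa> by (intro power_strict_mono) auto
      also have "\<dots> = dotp d u u + dotp d v v + 2 * dotp d u v"
        unfolding dotp_eq_square[symmetric]
        by (simp add: dotp_def sum.distrib sum_distrib_left algebra_simps)
      also have "\<dots> = 2 + 2 * dotp d u v" using U u v by (simp add: dotp_eq_square)
      finally have "(2 - \<kappa>)\<^sup>2 < 4 - 4 * \<kappa>" using uv by simp
      then have "\<kappa>\<^sup>2 < 0" by (simp add: power2_eq_square algebra_simps)
      then show False by simp
    qed
    show "0 \<le> r * (1 - \<kappa> / 2)" "r * (1 - \<kappa> / 2) < r" using r \<kappa> by auto
  qed (use assms r1 in auto)
  then show ?thesis by (simp add: algebra_simps)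
qed

section \<open>Codes on the sphere\<close>

text \<open>This is \<open>card_int_vecs_le\<close> at \<open>M = m\<close>, where the two factors are \<open>2 ^ m\<close> and \<open>3 ^ m\<close>.\<close>

lemma card_close_grid_points_le:
  fixes a :: "nat \<Rightarrow> int" and m :: nat
  assumes m: "0 < m"
  shows "real (card {b \<in> {..<m} \<rightarrow>\<^sub>E {- K..K}. (\<Sum>i<m. \<bar>real_of_int (b i - a i)\<bar>) \<le> m}) \<le> 6 ^ m"
    (is "real (card ?S) \<le> _")
proof -
  define \<tau> where "\<tau> b = (\<lambda>i\<in>{..<m}. b i - a i)" for b :: "nat \<Rightarrow> int"
  have "inj_on \<tau> ?S"
  proof (rule inj_onI)
    fix b c assume b: "b \<in> ?S" and c: "c \<in> ?S" and eq: "\<tau> b = \<tau> c"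
    have "b i = c i" if "i < m" for i
      using fun_cong[OF eq, of i] that by (simp add: \<tau>_def)
    then show "b = c" using b c by (auto intro: PiE_ext)
  qed
  moreover have "\<tau> b \<in> int_vecs m m" if "b \<in> ?S" for b
  proof -
    have "(\<Sum>i<m. \<bar>real_of_int (\<tau> b i)\<bar>) = (\<Sum>i<m. \<bar>real_of_int (b i - a i)\<bar>)"
      by (intro sum.cong) (simp_all add: \<tau>_def)
    moreover have "(\<Sum>i<m. \<bar>real_of_int (b i - a i)\<bar>) \<le> m" using that by blast
    moreover have "\<tau> b \<in> {..<m} \<rightarrow>\<^sub>E UNIV" unfolding \<tau>_def by (rule restrict_PiE_iff[THEN iffD2]) simp
    ultimately show ?thesis unfolding int_vecs_def by simp
  qed
  then have "\<tau> ` ?S \<subseteq> int_vecs m m" by blast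
  ultimately have "card ?S \<le> card (int_vecs m m)"
    using card_inj_on_le finite_int_vecs by blast
  then have "real (card ?S) \<le> real (card (int_vecs m m))" by simp
  also have "\<dots> \<le> (1 + real m / real m) powr real m * (1 + 2 * real m / real m) ^ m"
    using m by (intro card_int_vecs_le) auto
  also have "\<dots> = 2 ^ m * 3 ^ m" using m by (simp add: powr_realpow)
  also have "\<dots> = 6 ^ m" by (subst power_mult_distrib[symmetric]) simp
  finally show ?thesis .
qed

text \<open>Separation at \<open>\<ell>\<^sub>1\<close> distance \<open>m\<close> implies separation at Euclidean distance \<open>sqrt m\<close>, because the
  differences are integers. The grid itself is too dense, since neighbouring points have
  distance \<open>1\<close>; passing to a separated subset divides the number of points by \<open>6 ^ m\<close> at most.\<close>

lemma separated_grid_points_exist: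
  assumes m: "0 < m"
  shows "\<exists>Z\<subseteq>{..<m} \<rightarrow>\<^sub>E {- int K..int K}. ((2 * real K + 1) / 6) ^ m \<le> card Z \<and>
    (\<forall>z\<in>Z. \<forall>z'\<in>Z. z \<noteq> z' \<longrightarrow> real m \<le> (\<Sum>i<m. (real_of_int (z i) - real_of_int (z' i))\<^sup>2))"
proof -
  let ?A = "{..<m} \<rightarrow>\<^sub>E {- int K..int K}"
  define close where "close a b \<longleftrightarrow> (\<Sum>i<m. \<bar>real_of_int (b i - a i)\<bar>) \<le> m" for a b :: "nat \<Rightarrow> int"
  have "\<exists>Z\<subseteq>?A. (\<forall>u\<in>Z. \<forall>v\<in>Z. u \<noteq> v \<longrightarrow> \<not> close u v) \<and> real (card ?A) \<le> real (card Z) * 6 ^ m"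
  proof (rule exists_large_separated_subset)
    show "finite ?A" by (intro finite_PiE) auto
    show "close a a" for a by (simp add: close_def)
    show "close b a" if "close a b" for a b
      using that by (simp add: close_def abs_minus_commute)
    show "real (card {b \<in> ?A. close a b}) \<le> 6 ^ m" for a
      unfolding close_def using card_close_grid_points_le[OF m] .
  qed
  then obtain Z where Z: "Z \<subseteq> ?A \<and> (\<forall>u\<in>Z. \<forall>v\<in>Z. u \<noteq> v \<longrightarrow> \<not> close u v) \<and>
      real (card ?A) \<le> real (card Z) * 6 ^ m" by (rule exE)
  then have card: "real (card ?A) \<le> real (card Z) * 6 ^ m" by (elim conjE)
  have "card ?A = nat (2 * int K + 1) ^ m" by (simp add: card_PiE)
  also have "nat (2 * int K + 1) = 2 * K + 1" by simp
  finally have "card ?A = (2 * K + 1) ^ m" .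
  with card have "((2 * real K + 1) / 6) ^ m \<le> card Z"
    by (simp add: power_divide pos_divide_le_eq add.commute)
  moreover have "real m \<le> (\<Sum>i<m. (real_of_int (z i) - real_of_int (z' i))\<^sup>2)"
    if "z \<in> Z" "z' \<in> Z" "z \<noteq> z'" for z z'
  proof -
    have "real m \<le> (\<Sum>i<m. \<bar>real_of_int (z' i - z i)\<bar>)"
    proof -
      have "\<not> close z z'" using Z that by blast
      then show ?thesis by (simp add: close_def)
    qed
    also have "\<dots> \<le> (\<Sum>i<m. (real_of_int (z i) - real_of_int (z' i))\<^sup>2)"
    proof (rule sum_mono)
      fix i
      show "\<bar>real_of_int (z' i - z i)\<bar> \<le> (real_of_int (z i) - real_of_int (z' i))\<^sup>2"
        using abs_of_int_le_square[of "z' i - z i"] by (simp add: power2_commute)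
    qed
    finally show ?thesis .
  qed
  ultimately show ?thesis using Z by (intro exI[of _ Z]) simp
qed

text \<open>The grid points are scaled into the ball of radius \<open>1 / 2\<close> and lifted to the sphere by a last
  coordinate. Lifting does not decrease distances, and distances of unit vectors determine their
  inner products.\<close>

lemma spherical_code_of_grid_points:
  assumes m: "0 < m" and K: "0 < K"
  shows "\<exists>U. finite U \<and> ((2 * real K + 1) / 6) ^ m \<le> card U \<and>
    (\<forall>u\<in>U. u \<in> vecs (Suc m) \<and> L2_set u {..<Suc m} = 1) \<and>
    (\<forall>u\<in>U. \<forall>v\<in>U. u \<noteq> v \<longrightarrow> dotp (Suc m) u v \<le> 1 - 2 * (1 / (16 * (real K)\<^sup>2)))"
proof -
  let ?k = "1 / (16 * (real K)\<^sup>2)"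
  obtain Z where Z: "Z \<subseteq> {..<m} \<rightarrow>\<^sub>E {- int K..int K}" and card: "((2 * real K + 1) / 6) ^ m \<le> card Z"
    and sep: "\<And>z z'. z \<in> Z \<Longrightarrow> z' \<in> Z \<Longrightarrow> z \<noteq> z' \<Longrightarrow>
      real m \<le> (\<Sum>i<m. (real_of_int (z i) - real_of_int (z' i))\<^sup>2)"
    using separated_grid_points_exist[OF m, of K] by blast
  have finZ: "finite Z" by (rule finite_subset[OF Z]) (intro finite_PiE, auto)
  define N where "N = 2 * real K * sqrt m"
  have N: "0 < N" "N\<^sup>2 = 4 * (real K)\<^sup>2 * m" using m K by (auto simp: N_def power_mult_distrib)
  define h where "h z = (\<Sum>i<m. (real_of_int (z i) / N)\<^sup>2)" for z :: "nat \<Rightarrow> int"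
  define emb where "emb z = (\<lambda>i\<in>{..<Suc m}. if i < m then real_of_int (z i) / N else sqrt (1 - h z))"
    for z :: "nat \<Rightarrow> int"
  have h1: "h z \<le> 1" if "z \<in> Z" for z
  proof -
    have "h z \<le> (\<Sum>i<m. (real K)\<^sup>2 / N\<^sup>2)"
      unfolding h_def power_divide
    proof (intro sum_mono divide_right_mono)
      fix i assume "i \<in> {..<m}"
      then have "z i \<in> {- int K..int K}" using Z that by blast
      then have "\<bar>real_of_int (z i)\<bar> \<le> real K" by auto
      then show "(real_of_int (z i))\<^sup>2 \<le> (real K)\<^sup>2" using abs_le_square_iff by force
    qed simp
    also have "\<dots> = 1 / 4" using m K by (simp add: N)
    finally show ?thesis by simp
  qed
  have L2: "L2_set (emb z) {..<Suc m} = 1" if "z \<in> Z" for z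
    using h1[OF that] by (simp add: L2_set_def emb_def h_def)
  have dot: "dotp (Suc m) (emb z) (emb z') \<le> 1 - 2 * (?k)"
    if z: "z \<in> Z" "z' \<in> Z" "z \<noteq> z'" for z z'
  proof -
    have "1 / (4 * (real K)\<^sup>2) = m / N\<^sup>2" using m by (simp add: N)
    also have "\<dots> \<le> (\<Sum>i<m. (real_of_int (z i) - real_of_int (z' i))\<^sup>2) / N\<^sup>2"
      using sep[OF z] by (intro divide_right_mono) auto
    also have "\<dots> = (\<Sum>i<m. (emb z i - emb z' i)\<^sup>2)"
      by (simp add: emb_def sum_divide_distrib power_divide flip: diff_divide_distrib)
    also have "\<dots> \<le> (\<Sum>i<Suc m. (emb z i - emb z' i)\<^sup>2)" by simp
    also have "\<dots> = dotp (Suc m) (emb z) (emb z) + dotp (Suc m) (emb z') (emb z')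
        - 2 * dotp (Suc m) (emb z) (emb z')"
      unfolding dotp_def sum_distrib_left sum.distrib[symmetric] sum_subtractf[symmetric]
      by (intro sum.cong) (auto simp: power2_eq_square algebra_simps)
    also have "\<dots> = 2 - 2 * dotp (Suc m) (emb z) (emb z')"
      using L2 z by (simp add: dotp_eq_square)
    finally show ?thesis by simp
  qed
  have inj: "inj_on emb Z"
  proof (rule inj_onI, rule ccontr)
    fix z z' assume z: "z \<in> Z" "z' \<in> Z" and eq: "emb z = emb z'" and "z \<noteq> z'"
    then have "dotp (Suc m) (emb z) (emb z) \<le> 1 - 2 * (?k)"
      using dot[OF z] by simp
    then show False using L2[OF z(1)] K by (simp add: dotp_eq_square)
  qed
  show ?thesis
  proof (intro exI[of _ "emb ` Z"] conjI ballI impI)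
    show "((2 * real K + 1) / 6) ^ m \<le> card (emb ` Z)" using card inj by (simp add: card_image)
    show "u \<in> vecs (Suc m)" if "u \<in> emb ` Z" for u
    proof -
      from that obtain z where "u = emb z" by blast
      then show ?thesis unfolding emb_def vecs_def by (simp only: restrict_PiE_iff) simp
    qed
    show "dotp (Suc m) u v \<le> 1 - 2 * (?k)"
      if "u \<in> emb ` Z" "v \<in> emb ` Z" "u \<noteq> v" for u v
      using that dot by auto
  qed (use finZ L2 in auto)
qed

text \<open>A code of more than \<open>n\<close> points whose separation has the order \<open>n powr (- 1 / m)\<close> of the volume
  bound; \<open>\<kappa>\<close> is comparable to the square of the separation.\<close>

lemma spherical_code_exists:
  assumes m: "0 < m" and n: "2 ^ m \<le> n"
  shows "\<exists>U \<kappa>. finite U \<and> n < card U \<and> 0 < \<kappa> \<and> \<kappa> \<le> 1 \<and> real n powr (- 2 / m) / 784 \<le> \<kappa> \<and>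
    (\<forall>u\<in>U. u \<in> vecs (Suc m) \<and> L2_set u {..<Suc m} = 1) \<and>
    (\<forall>u\<in>U. \<forall>v\<in>U. u \<noteq> v \<longrightarrow> dotp (Suc m) u v \<le> 1 - 2 * \<kappa>)"
proof -
  have n1: "1 \<le> real n" using order_trans[OF one_le_power[of "2::nat" m] n] by simp
  define \<nu> where "\<nu> = real (n + 1) powr (1 / m)"
  \<comment> \<open>then \<open>(2 * K + 1) / 6\<close> exceeds \<open>\<nu>\<close>, and \<open>K \<le> 7 * N\<close>, whence the constant \<open>784 = 16 * 7\<^sup>2\<close>\<close>
  define K where "K = nat \<lceil>3 * \<nu>\<rceil>"
  define N where "N = real n powr (1 / m)"
  have N1: "1 \<le> N" using n1 by (simp add: N_def ge_one_powr_ge_zero)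
  have \<nu>1: "1 \<le> \<nu>" by (simp add: \<nu>_def ge_one_powr_ge_zero)
  have K: "3 * \<nu> \<le> K" "K \<le> 3 * \<nu> + 1" using \<nu>1 unfolding K_def by linarith+
  have "\<nu> \<le> (2 * real n) powr (1 / m)"
    unfolding \<nu>_def using n1 by (intro powr_mono2) auto
  also have "\<dots> = 2 powr (1 / m) * N" by (simp add: powr_mult N_def)
  also have "\<dots> \<le> 2 powr 1 * N" using N1 m by (intro mult_right_mono powr_mono) auto
  finally have "real K \<le> 7 * N" using K N1 by simp
  then have K2: "(real K)\<^sup>2 \<le> 49 * N\<^sup>2"
    using power_mono[of "real K" "7 * N" 2] by (simp add: power_mult_distrib)
  let ?k = "1 / (16 * (real K)\<^sup>2)"
  have K0: "1 \<le> real K" using K \<nu>1 by linarith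
  have card: "real n < ((2 * real K + 1) / 6) ^ m"
  proof -
    have "real n < \<nu> powr m" using m by (simp add: \<nu>_def powr_powr)
    also have "\<nu> powr m = \<nu> ^ m" using \<nu>1 by (simp add: powr_realpow)
    also have "\<dots> \<le> ((2 * real K + 1) / 6) ^ m" using K \<nu>1 by (intro power_mono) auto
    finally show ?thesis .
  qed
  have "N\<^sup>2 = N powr 2" using N1 by simp
  also have "\<dots> = real n powr (2 / m)" by (simp add: N_def powr_powr)
  finally have N2: "real n powr (- 2 / m) = 1 / N\<^sup>2" by (simp add: powr_minus divide_inverse)
  have "real n powr (- 2 / m) / 784 = 1 / (16 * (49 * N\<^sup>2))" unfolding N2 by simp
  also have "\<dots> \<le> ?k"
    using K2 K0 N1 by (intro divide_left_mono mult_pos_pos mult_left_mono) auto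
  finally have lower: "real n powr (- 2 / m) / 784 \<le> ?k" .
  have up: "?k \<le> 1"
    using one_le_power[OF K0, of 2] by (simp add: divide_le_eq)
  have "0 < K" using K0 by simp
  from spherical_code_of_grid_points[OF m this] obtain U where U: "finite U"
    "((2 * real K + 1) / 6) ^ m \<le> card U"
    "\<forall>u\<in>U. u \<in> vecs (Suc m) \<and> L2_set u {..<Suc m} = 1"
    "\<forall>u\<in>U. \<forall>v\<in>U. u \<noteq> v \<longrightarrow> dotp (Suc m) u v \<le> 1 - 2 * (?k)"
    by (elim exE conjE)
  have "n < card U" using card U(2) by linarith
  moreover have "0 < ?k" using K0 by simp
  ultimately show ?thesis using U(1,3,4) lower up
    by (intro exI[of _ U] exI[of _ "?k"] conjI)
qed

text \<open>Another generating function: a word that agrees with \<open>a\<close> in more than \<open>M / 2\<close> places contributes at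
  least \<open>sqrt q ^ M\<close> to the sum of \<open>q ^ (number of agreements)\<close> over all words, which is a product of
  sums of size at most \<open>2 * q\<close>.\<close>

lemma card_agreeing_words_le:
  fixes a :: "nat \<Rightarrow> nat" and q M :: nat
  assumes q: "0 < q"
  shows "real (card {b \<in> {..<M} \<rightarrow>\<^sub>E {..<q}. real M / 2 < card {j. j < M \<and> a j = b j}}) \<le> (2 * sqrt q) ^ M"
    (is "real (card ?S) \<le> _")
proof -
  let ?A = "{..<M} \<rightarrow>\<^sub>E {..<q}"
  let ?P = "\<lambda>b. \<Prod>j<M. (if a j = b j then real q else 1)"
  have finA: "finite ?A" by (intro finite_PiE) auto
  have pos: "0 \<le> ?P b" for b by (intro prod_nonneg) auto
  have s: "0 < sqrt q ^ M" using q by simp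
  have "sqrt q ^ M \<le> ?P b" if "b \<in> ?S" for b
  proof -
    have "sqrt q ^ M = real q powr (M / 2)"
      using q by (simp add: powr_half_sqrt[symmetric] powr_powr flip: powr_realpow)
    also have "\<dots> \<le> real q powr card {j. j < M \<and> a j = b j}"
      using q that by (intro powr_mono) auto
    also have "\<dots> = real q ^ card {j. j < M \<and> a j = b j}" using q by (simp add: powr_realpow)
    also have "\<dots> = ?P b"
      by (simp add: prod.If_cases Collect_conj_eq lessThan_def)
    finally show ?thesis .
  qed
  then have "(\<Sum>b\<in>?S. sqrt q ^ M) \<le> (\<Sum>b\<in>?S. ?P b)" by (intro sum_mono) auto
  also have "\<dots> \<le> (\<Sum>b\<in>?A. ?P b)" using finA pos by (intro sum_mono2) auto
  also have "\<dots> = (\<Prod>j<M. \<Sum>y<q. (if a j = y then real q else 1))"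
    by (subst prod_sum_PiE) auto
  also have "\<dots> \<le> (\<Prod>j<M. 2 * real q)"
  proof (intro prod_mono conjI sum_nonneg)
    fix j
    have "(\<Sum>y<q. (if a j = y then real q else 1)) \<le> (\<Sum>y<q. (if a j = y then real q else 0) + 1)"
      by (intro sum_mono) auto
    also have "\<dots> \<le> 2 * real q" by (simp add: sum.distrib)
    finally show "(\<Sum>y<q. (if a j = y then real q else 1)) \<le> 2 * real q" .
  qed auto
  also have "\<dots> = (2 * sqrt q) ^ M * sqrt q ^ M"
    by (simp only: prod_constant card_lessThan power_mult_distrib[symmetric] mult.assoc) simp
  finally show ?thesis using s by simp
qed

text \<open>A word of length \<open>M\<close> over \<open>q\<close> letters is read as an \<open>M\<close>-element subset of \<open>{..<q * M}\<close> with one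
  element in each block of length \<open>q\<close>. The inner product of the normalised indicator vectors is the
  proportion of agreements. Sparse vectors have a much larger Euclidean norm than flat ones relative
  to their \<open>\<ell>\<^sub>p\<close> norm, namely \<open>M powr (1 / 2 - 1 / p)\<close>.\<close>

lemma sparse_code_exists:
  fixes q M d :: nat
  assumes p: "0 < p" and M: "0 < M" and q: "0 < q" and d: "q * M \<le> d"
  shows "\<exists>U. finite U \<and> (sqrt q / 2) ^ M \<le> card U \<and>
    (\<forall>u\<in>U. u \<in> vecs d \<and> L2_set u {..<d} = 1 \<and> lp_norm p d (\<lambda>i. real M powr (1 / 2 - 1 / p) * u i) \<le> 1) \<and>
    (\<forall>u\<in>U. \<forall>v\<in>U. u \<noteq> v \<longrightarrow> dotp d u v \<le> 1 - 2 * (1 / 4))"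
proof -
  let ?A = "{..<M} \<rightarrow>\<^sub>E {..<q}"
  define close where "close a b \<longleftrightarrow> real M / 2 < card {j. j < M \<and> a j = b j}" for a b :: "nat \<Rightarrow> nat"
  have "\<exists>W\<subseteq>?A. (\<forall>u\<in>W. \<forall>v\<in>W. u \<noteq> v \<longrightarrow> \<not> close u v) \<and>
      real (card ?A) \<le> real (card W) * (2 * sqrt q) ^ M"
  proof (rule exists_large_separated_subset[where close = close and V = "(2 * sqrt q) ^ M"])
    show "finite ?A" by (intro finite_PiE) auto
    show "close a a" for a using M by (simp add: close_def)
    show "close b a" if "close a b" for a b
      using that by (simp add: close_def eq_commute)
    show "real (card {b \<in> ?A. close a b}) \<le> (2 * sqrt q) ^ M" for a
      unfolding close_def using card_agreeing_words_le[OF q] .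
  qed
  then obtain W where "W \<subseteq> ?A \<and> (\<forall>u\<in>W. \<forall>v\<in>W. u \<noteq> v \<longrightarrow> \<not> close u v) \<and>
      real (card ?A) \<le> real (card W) * (2 * sqrt q) ^ M" by (rule exE)
  note W' = this
  from W' have W: "W \<subseteq> ?A" by (rule conjunct1)
  from W' have Wsep: "\<forall>u\<in>W. \<forall>v\<in>W. u \<noteq> v \<longrightarrow> \<not> close u v" by (elim conjE)
  from W' have card: "real (card ?A) \<le> real (card W) * (2 * sqrt q) ^ M" by (elim conjE)
  have finW: "finite W" by (rule finite_subset[OF W]) (intro finite_PiE, auto)
  have "card ?A = q ^ M" by (simp add: card_PiE)
  with card have "(sqrt q * sqrt q) ^ M \<le> real (card W) * (2 * sqrt q) ^ M" by simp
  then have "sqrt q ^ M * sqrt q ^ M \<le> (real (card W) * 2 ^ M) * sqrt q ^ M"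
    by (simp only: power_mult_distrib mult.assoc)
  then have "sqrt q ^ M \<le> real (card W) * 2 ^ M"
    by (rule mult_right_le_imp_le) (use q in simp)
  then have cardW: "(sqrt q / 2) ^ M \<le> card W"
    by (simp add: power_divide pos_divide_le_eq)
  define pos where "pos w = (\<lambda>j. j * q + w j) ` {..<M}" for w :: "nat \<Rightarrow> nat"
  have wq: "w j < q" if "w \<in> W" "j < M" for w j using PiE_mem[of w "{..<M}"] W that by blast
  have code_eq: "i = j" "x = y" if "i * q + x = j * q + y" "x < q" "y < q" for i j x y
  proof -
    have "(i * q + x) div q = i" "(j * q + y) div q = j" using that(2,3) by auto
    then show "i = j" using that(1) by simp
    then show "x = y" using that(1) by simp
  qed
  have inter: "card (pos w \<inter> pos w') = card {j. j < M \<and> w j = w' j}" if w: "w \<in> W" "w' \<in> W" for w w'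
  proof -
    have "pos w \<inter> pos w' = (\<lambda>j. j * q + w j) ` {j. j < M \<and> w j = w' j}"
    proof (intro equalityI subsetI)
      fix x assume "x \<in> pos w \<inter> pos w'"
      then obtain i j where i: "i < M" "x = i * q + w i" and j: "j < M" "x = j * q + w' j"
        unfolding pos_def by blast
      have "i = j" "w i = w' j"
        using code_eq[of i "w i" j "w' j"] i j wq[OF w(1) i(1)] wq[OF w(2) j(1)] by auto
      then show "x \<in> (\<lambda>j. j * q + w j) ` {j. j < M \<and> w j = w' j}" using i by blast
    next
      fix x assume "x \<in> (\<lambda>j. j * q + w j) ` {j. j < M \<and> w j = w' j}"
      then obtain j where j: "j < M" "w j = w' j" "x = j * q + w j" by blast
      then have "x = j * q + w' j" by simp
      then show "x \<in> pos w \<inter> pos w'" using j(1,3) unfolding pos_def by blast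
    qed
    moreover have "inj_on (\<lambda>j. j * q + w j) {j. j < M \<and> w j = w' j}"
    proof (rule inj_onI)
      fix i j assume "i \<in> {j. j < M \<and> w j = w' j}" "j \<in> {j. j < M \<and> w j = w' j}"
        and eq: "i * q + w i = j * q + w j"
      then have "w i < q" "w j < q" using wq[OF w(1)] by blast+
      then show "i = j" by (rule code_eq(1)[OF eq])
    qed
    ultimately show ?thesis by (simp only: card_image)
  qed
  have cardpos: "card (pos w) = M" if "w \<in> W" for w
    using inter[OF that that] by simp
  have subd: "pos w \<subseteq> {..<d}" if "w \<in> W" for w
  proof -
    have "j * q + w j < d" if "j < M" for j
    proof -
      have "j * q + w j < Suc j * q" using wq \<open>w \<in> W\<close> that by simp
      also have "\<dots> \<le> M * q" using that by (intro mult_right_mono) auto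
      finally show ?thesis using d by (simp add: mult.commute)
    qed
    then show ?thesis by (auto simp: pos_def)
  qed
  define vec where "vec w = (\<lambda>i\<in>{..<d}. if i \<in> pos w then 1 / sqrt M else 0)" for w
  have dot: "dotp d (vec w) (vec w') = card (pos w \<inter> pos w') / M" if "w \<in> W" for w w'
  proof -
    have "dotp d (vec w) (vec w') = (\<Sum>i<d. if i \<in> pos w \<inter> pos w' then 1 / real M else 0)"
      unfolding dotp_def by (intro sum.cong) (auto simp: vec_def)
    also have "\<dots> = card (pos w \<inter> pos w') / M"
      using subd[OF that] by (subst sum.If_cases) (auto simp: Int_absorb1 intro!: arg_cong[where f = card])
    finally show ?thesis .
  qed
  have L2: "L2_set (vec w) {..<d} = 1" if "w \<in> W" for w
  proof -
    have "(L2_set (vec w) {..<d})\<^sup>2 = 1"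
      using dot[OF that, of w] cardpos[OF that] M by (simp add: dotp_eq_square)
    then show ?thesis using L2_set_nonneg[of "vec w" "{..<d}"] by (auto simp: power2_eq_1_iff)
  qed
  have lp: "lp_norm p d (\<lambda>i. real M powr (1 / 2 - 1 / p) * vec w i) \<le> 1" if "w \<in> W" for w
  proof -
    have "1 / sqrt M = real M powr (- (1 / 2))"
      by (subst powr_minus, subst powr_half_sqrt) (simp_all add: divide_inverse)
    then have "real M powr (1 / 2 - 1 / p) * (1 / sqrt M) = real M powr (- 1 / p)"
      by (simp only: powr_add[symmetric]) simp
    moreover have "\<bar>real M powr (- 1 / p)\<bar> powr p = 1 / M"
      using p M by (simp only: abs_of_nonneg powr_ge_zero powr_powr) (simp add: powr_minus_divide)
    ultimately have 1: "\<bar>real M powr (1 / 2 - 1 / p) * (1 / sqrt M)\<bar> powr p = 1 / M"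
      by (simp only:)
    have "(\<Sum>i<d. \<bar>real M powr (1 / 2 - 1 / p) * vec w i\<bar> powr p)
        = (\<Sum>i<d. if i \<in> pos w then 1 / M else 0)"
    proof (intro sum.cong refl)
      fix i assume "i \<in> {..<d}"
      then have "vec w i = (if i \<in> pos w then 1 / sqrt M else 0)" by (simp add: vec_def)
      then show "\<bar>real M powr (1 / 2 - 1 / p) * vec w i\<bar> powr p = (if i \<in> pos w then 1 / M else 0)"
        using 1 by (cases "i \<in> pos w") (simp_all only: if_True if_False mult_zero_right abs_zero powr_zero_eq_one powr_0)
    qed
    also have "\<dots> = card (pos w) / M"
      using subd[OF that] by (subst sum.If_cases) (auto simp: Int_absorb1 intro!: arg_cong[where f = card])
    finally show ?thesis using cardpos[OF that] M p by (simp add: lp_norm_le_one_iff)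
  qed
  have sep: "dotp d (vec w) (vec w') \<le> 1 - 2 * (1 / 4)" if "w \<in> W" "w' \<in> W" "w \<noteq> w'" for w w'
  proof -
    have "\<not> close w w'" using Wsep that by blast
    then have "real (card {j. j < M \<and> w j = w' j}) / real M \<le> 1 / 2"
      using M by (simp add: close_def not_less pos_divide_le_eq)
    then show ?thesis using dot[OF that(1), of w'] inter[OF that(1,2)] by simp
  qed
  have inj: "inj_on vec W"
  proof (rule inj_onI, rule ccontr)
    fix w w' assume w: "w \<in> W" "w' \<in> W" "vec w = vec w'" "w \<noteq> w'"
    then have "dotp d (vec w) (vec w) \<le> 1 / 2" using sep[of w w'] by simp
    then show False using L2[OF w(1)] by (simp add: dotp_eq_square)
  qed
  show ?thesis
  proof (intro exI[of _ "vec ` W"] conjI ballI impI)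
    show "(sqrt q / 2) ^ M \<le> card (vec ` W)" using cardW inj by (simp add: card_image)
    show "u \<in> vecs d" if "u \<in> vec ` W" for u
    proof -
      from that obtain w where "u = vec w" by blast
      then show ?thesis unfolding vec_def vecs_def by (simp only: restrict_PiE_iff) simp
    qed
    show "dotp d u v \<le> 1 - 2 * (1 / 4)" if "u \<in> vec ` W" "v \<in> vec ` W" "u \<noteq> v" for u v
      using that sep by auto
  qed (use finW L2 lp in auto)
qed

section \<open>The rates of the adaptive lower bound\<close>

text \<open>With the standard basis the separation is constant and no normalisation is lost.\<close>

lemma g_ada_ge_small_n:
  assumes \<alpha>: "0 < \<alpha>" and p: "0 < p" "p \<le> 2" and nd: "n < d"
  shows "ereal ((1 + \<alpha>) powr (- \<alpha>) * (1 / 8) powr \<alpha>) \<le> g_ada n d (ridge_class d \<alpha> p)"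
proof -
  define e where "e j = (\<lambda>i\<in>{..<d}. if i = j then 1 else 0 :: real)" for j :: nat
  have dot: "dotp d (e j) x = x j" if "j < d" for j x
    using that by (simp add: dotp_def e_def if_distrib[of "\<lambda>y. y * _"] cong: if_cong)
  have inj: "inj_on e {..<d}"
  proof (rule inj_onI)
    fix j k assume "j \<in> {..<d}" "k \<in> {..<d}" and eq: "e j = e k"
    have "e j j = e k j" by (simp only: eq)
    then show "j = k" using \<open>j \<in> {..<d}\<close> by (simp add: e_def split: if_splits)
  qed
  have "ereal ((1 + \<alpha>) powr (- \<alpha>) * (1 * (1 / 2) / 4) powr \<alpha>) \<le> g_ada n d (ridge_class d \<alpha> p)"
  proof (rule adaptive_error_ge_spherical_code[where U = "e ` {..<d}"])
    show "n < card (e ` {..<d})" using nd inj by (simp add: card_image)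
    fix u assume "u \<in> e ` {..<d}"
    then obtain j where j: "j < d" "u = e j" by auto
    have "(L2_set u {..<d})\<^sup>2 = 1"
      using dot[of j u] j by (simp add: dotp_eq_square[symmetric]) (simp add: e_def)
    then have "L2_set u {..<d} = 1"
      using L2_set_nonneg[of u "{..<d}"] by (auto simp: power2_eq_1_iff)
    moreover have "(\<Sum>i<d. \<bar>1 * u i\<bar> powr p) = (\<Sum>i<d. if i = j then 1 else 0)"
      using j p by (intro sum.cong) (auto simp: e_def)
    then have "lp_norm p d (\<lambda>i. 1 * u i) \<le> 1" using j p by (simp add: lp_norm_le_one_iff)
    moreover have "u \<in> vecs d" using j by (simp add: e_def vecs_def)
    ultimately show "u \<in> vecs d \<and> L2_set u {..<d} = 1 \<and> lp_norm p d (\<lambda>i. 1 * u i) \<le> 1" by blast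
    fix v assume "v \<in> e ` {..<d}" "u \<noteq> v"
    then obtain k where k: "k < d" "v = e k" by auto
    with \<open>u \<noteq> v\<close> j show "dotp d u v \<le> 1 - 2 * (1 / 2)" by (simp add: dot) (auto simp: e_def)
  qed (use assms in auto)
  then show ?thesis by simp
qed

text \<open>The lemma is stated for \<open>n \<le> N\<close>, since it also serves, with \<open>N = 2 ^ (d - 1)\<close>, those smaller \<open>n\<close> whose
  logarithm is comparable to \<open>d\<close>.\<close>

lemma g_ada_ge_sphere:
  assumes \<alpha>: "0 < \<alpha>" and p: "0 < p" "p \<le> 2" and d: "2 \<le> d" and N: "2 ^ (d - 1) \<le> N" and n: "n \<le> N"
  shows "ereal ((1 + \<alpha>) powr (- \<alpha>) *
    (real d powr (1 / 2 - 1 / p) * real N powr (- 2 / (real d - 1)) / 3136) powr \<alpha>)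
    \<le> g_ada n d (ridge_class d \<alpha> p)"
proof -
  have m: "0 < d - 1" "Suc (d - 1) = d" "real (d - 1) = real d - 1" using d by auto
  obtain U \<kappa> where U: "finite U" "N < card U" "0 < \<kappa>" "\<kappa> \<le> 1" "real N powr (- 2 / (real d - 1)) / 784 \<le> \<kappa>"
    "\<forall>u\<in>U. u \<in> vecs d \<and> L2_set u {..<d} = 1"
    "\<forall>u\<in>U. \<forall>v\<in>U. u \<noteq> v \<longrightarrow> dotp d u v \<le> 1 - 2 * \<kappa>"
    using spherical_code_exists[OF m(1) N] unfolding m(2,3) by (elim exE conjE)
  let ?N = "real N powr (- 2 / (real d - 1))"
  let ?r = "real d powr (1 / 2 - 1 / p)"
  have "?r * (?N / 784) / 4 \<le> ?r * \<kappa> / 4"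
    using U(5) by (intro divide_right_mono mult_left_mono) auto
  then have "(1 + \<alpha>) powr (- \<alpha>) * (?r * ?N / 3136) powr \<alpha>
      \<le> (1 + \<alpha>) powr (- \<alpha>) * (?r * \<kappa> / 4) powr \<alpha>"
    using \<alpha> by (intro mult_left_mono powr_mono2) auto
  then have "ereal ((1 + \<alpha>) powr (- \<alpha>) * (?r * ?N / 3136) powr \<alpha>)
      \<le> ereal ((1 + \<alpha>) powr (- \<alpha>) * (?r * \<kappa> / 4) powr \<alpha>)" by simp
  also have "\<dots> \<le> g_ada n d (ridge_class d \<alpha> p)"
  proof (rule adaptive_error_ge_spherical_code[where U = U])
    show "n < card U" using U(2) n by linarith
    show "u \<in> vecs d \<and> L2_set u {..<d} = 1 \<and> lp_norm p d (\<lambda>i. ?r * u i) \<le> 1" if "u \<in> U" for u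
      using U(6) that lp_norm_scaled_unit_le[OF p, of d u] d by auto
    show "dotp d u v \<le> 1 - 2 * \<kappa>" if "u \<in> U" "v \<in> U" "u \<noteq> v" for u v
      using U(7) that by blast
  qed (use assms U(1,3,4) in auto)
  finally show ?thesis .
qed

lemma g_ada_ge_sparse:
  fixes q M d :: nat
  assumes \<alpha>: "0 < \<alpha>" and p: "0 < p" "p \<le> 2" and M: "0 < M" and q: "0 < q" and d: "q * M \<le> d"
    and n: "real n < (sqrt q / 2) ^ M"
  shows "ereal ((1 + \<alpha>) powr (- \<alpha>) * (real M powr (1 / 2 - 1 / p) / 16) powr \<alpha>)
    \<le> g_ada n d (ridge_class d \<alpha> p)"
proof -
  obtain U where U: "finite U" "(sqrt q / 2) ^ M \<le> card U"
    "\<forall>u\<in>U. u \<in> vecs d \<and> L2_set u {..<d} = 1 \<and> lp_norm p d (\<lambda>i. real M powr (1 / 2 - 1 / p) * u i) \<le> 1"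
    "\<forall>u\<in>U. \<forall>v\<in>U. u \<noteq> v \<longrightarrow> dotp d u v \<le> 1 - 2 * (1 / 4)"
    using sparse_code_exists[OF p(1) M q d] by (elim exE conjE)
  have dpos: "0 < d" using M q d by (cases d) auto
  have "ereal ((1 + \<alpha>) powr (- \<alpha>) * (real M powr (1 / 2 - 1 / p) * (1 / 4) / 4) powr \<alpha>)
    \<le> g_ada n d (ridge_class d \<alpha> p)"
  proof (rule adaptive_error_ge_spherical_code[where U = U])
    show "n < card U" using U(2) n by linarith
    show "u \<in> vecs d \<and> L2_set u {..<d} = 1 \<and> lp_norm p d (\<lambda>i. real M powr (1 / 2 - 1 / p) * u i) \<le> 1"
      if "u \<in> U" for u using U(3) that by blast
    show "dotp d u v \<le> 1 - 2 * (1 / 4)" if "u \<in> U" "v \<in> U" "u \<noteq> v" for u v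
      using U(4) that by blast
  qed (use assms U(1) dpos in auto)
  then show ?thesis by simp
qed

lemma log2_one_plus_le:
  fixes y :: real
  assumes "0 \<le> y"
  shows "log 2 (1 + y) \<le> 2 * y"
proof -
  have "(1::real) / 2 \<le> ln 2" using ln_le_minus_one[of "1/2::real"] by (simp add: ln_div)
  then have "y * 1 \<le> y * (2 * ln 2)" using assms by (intro mult_left_mono) auto
  then have "ln (1 + y) \<le> 2 * y * ln 2" using ln_add_one_self_le_self[OF assms] by linarith
  then show ?thesis by (simp add: log_def pos_divide_le_eq)
qed

text \<open>The sparsity \<open>M\<close> has the order \<open>L / log 2 (1 + d / L)\<close>, which is just enough for \<open>2 powr L = 4 * n\<close>
  separated words over \<open>d div M\<close> letters. As \<open>d / L\<close> is large, the number of letters is at least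
  \<open>4 * sqrt (1 + d / L)\<close>, and taking the logarithm of the number of words brings out
  \<open>M * log 2 (1 + d / L)\<close>.\<close>

lemma sparse_parameters_exist:
  fixes n d :: nat and L :: real
  assumes n: "1 \<le> n" "n \<ge> d" and d: "256 * L \<le> d" and L: "L = 2 + log 2 (real n)"
  shows "\<exists>M q. 0 < M \<and> 0 < q \<and> q * M \<le> d \<and> real n < (sqrt q / 2) ^ M \<and>
    log 2 (1 + d / L) / L \<le> 8 / real M"
proof -
  have "0 \<le> log 2 (real n)" using n by (subst zero_le_log_cancel_iff) auto
  then have L2: "2 \<le> L" using L by linarith
  define y where "y = d / L"
  have y: "256 \<le> y" using d L2 unfolding y_def by (simp add: pos_le_divide_eq)
  have dL: "d = y * L" using L2 by (simp add: y_def)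
  have d1: "512 \<le> real d" using d L2 by simp
  define lg where "lg = log 2 (1 + y)"
  have "log 2 (2 powr 8) \<le> lg" unfolding lg_def using y by (intro log_mono) auto
  then have l8: "8 \<le> lg" by (simp only: log_powr_cancel)
  have "1 + y \<le> d"
  proof -
    have "2 * y \<le> y * L" using mult_left_mono[OF L2, of y] y by simp
    then show ?thesis using dL y by linarith
  qed
  then have "lg \<le> log 2 (real d)" unfolding lg_def using y by (intro log_mono) auto
  also have "\<dots> \<le> log 2 (real n)" using n d1 by (intro log_mono) auto
  finally have lL: "lg \<le> L" using L by simp
  define M where "M = nat \<lceil>4 * L / lg\<rceil>"
  have LL: "1 \<le> L / lg" using lL l8 by (simp add: pos_le_divide_eq)
  have M: "4 * (L / lg) \<le> M" "M \<le> 5 * (L / lg)"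
    using LL unfolding M_def by (simp_all, linarith+)
  have M1: "1 \<le> real M" using M LL by linarith
  define q where "q = d div M"
  have "d < M + q * M" unfolding q_def using M1 by (intro dividend_less_div_times) simp
  then have "real d < real (M + q * M)" by (simp only: of_nat_less_iff)
  then have "real d < (real q + 1) * M" by (simp add: algebra_simps)
  also have "\<dots> \<le> (real q + 1) * (5 * (L / lg))" using M by (intro mult_left_mono) auto
  finally have "y * lg * L < (real q + 1) * 5 * L"
    using l8 unfolding dL by (simp add: field_simps)
  then have "y * lg < (real q + 1) * 5" using L2 by simp
  moreover have "y * 8 \<le> y * lg" using l8 y by (intro mult_left_mono) auto
  ultimately have "y * 8 < (real q + 1) * 5" by (rule order_le_less_trans[rotated])
  then have qy: "y / 2 \<le> real q" using y by (simp add: algebra_simps)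
  have s16: "16 \<le> sqrt (1 + y)" using y by (intro real_le_rsqrt) auto
  have "16 * sqrt (1 + y) \<le> sqrt (1 + y) * sqrt (1 + y)" using s16 y by (intro mult_right_mono) auto
  also have "\<dots> = 1 + y" using y by simp
  finally have "4 * sqrt (1 + y) \<le> q" using qy y by linarith
  then have "sqrt (4 * sqrt (1 + y)) \<le> sqrt q" by simp
  then have sq: "sqrt (sqrt (1 + y)) \<le> sqrt q / 2" by (simp add: real_sqrt_mult)
  have fourth: "sqrt (sqrt (1 + y)) = (1 + y) powr (1 / 4)"
    using y by (simp add: powr_half_sqrt[symmetric] powr_powr)
  have "real n < 2 powr L" unfolding L using n by (simp add: powr_add)
  also have "\<dots> \<le> 2 powr (lg * (M / 4))"
    using M l8 by (intro powr_mono) (auto simp: field_simps)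
  also have "\<dots> = (2 powr lg) powr (M / 4)" by (simp add: powr_powr)
  also have "2 powr lg = 1 + y" using y by (simp add: lg_def)
  also have "(1 + y) powr (M / 4) = sqrt (sqrt (1 + y)) ^ M"
    unfolding fourth using y by (simp add: powr_powr flip: powr_realpow)
  also have "\<dots> \<le> (sqrt q / 2) ^ M" using sq y by (intro power_mono) auto
  finally have big: "real n < (sqrt q / 2) ^ M" .
  have "lg / L * real M \<le> lg / L * (5 * (L / lg))" using M l8 L2 by (intro mult_left_mono) auto
  also have "\<dots> \<le> 8" using l8 L2 by simp
  finally have "lg / L \<le> 8 / M" using M1 by (simp add: pos_le_divide_eq)
  moreover have "0 < q" using qy y by (intro gr0I) auto
  moreover have "q * M \<le> d" unfolding q_def by simp
  moreover have "0 < M" using M1 by simp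
  ultimately show ?thesis using big unfolding lg_def y_def by blast
qed

text \<open>In the middle range sparse codes are used as long as \<open>256 * (2 + log 2 n) \<le> d\<close>. Beyond that point the
  rate is of the order \<open>d powr (- \<alpha> * (1 / p - 1 / 2))\<close>, which the code on the sphere provides.\<close>

lemma g_ada_lower_bound:
  assumes \<alpha>: "0 < \<alpha>" and p: "0 < p" "p \<le> 2"
  shows "\<exists>c>0. \<forall>n\<ge>1. \<forall>d\<ge>2. ereal (c *
        (if n < d then 1
         else if n < 2 ^ (d - 1) then
           (log 2 (1 + real d / (2 + log 2 (real n))) / (2 + log 2 (real n)))
             powr (\<alpha> * (1 / p - 1 / 2))
         else
           real n powr (- 2 * \<alpha> / (real d - 1))
             * real d powr (- \<alpha> * (1 / p - 1 / 2)))) \<le> g_ada n d (ridge_class d \<alpha> p)"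
    (is "\<exists>c>0. \<forall>n\<ge>1. \<forall>d\<ge>2. ereal (c * ?R n d) \<le> ?g n d")
proof -
  define e where "e = 1 / p - 1 / 2"
  have e: "0 \<le> e" using p by (simp add: e_def field_simps)
  define A where "A = (1 + \<alpha>) powr (- \<alpha>)"
  have A: "0 < A" using \<alpha> by (simp add: A_def)
  \<comment> \<open>\<open>K = 2 * 256\<^sup>2\<close> comes from the change of codes at \<open>256 * L = d\<close>, and \<open>12544 = 4 * 3136\<close> from the code on the sphere for \<open>N = 2 ^ (d - 1)\<close>\<close>
  define K :: real where "K = 131072"
  define c where "c = A * (1 / 12544) powr \<alpha> * K powr (- (\<alpha> * e))"
  have K1: "K powr (- (\<alpha> * e)) \<le> 1"
    using \<alpha> e by (simp add: K_def powr_minus divide_simps ge_one_powr_ge_zero)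
  have Kpos: "0 < K" by (simp add: K_def)
  have cA: "c \<le> A * x powr \<alpha>" if "1 / 12544 \<le> x" for x
  proof -
    have "(1 / 12544) powr \<alpha> \<le> x powr \<alpha>" using that \<alpha> by (intro powr_mono2) auto
    then have "(1 / 12544) powr \<alpha> * K powr (- (\<alpha> * e)) \<le> x powr \<alpha> * 1"
      using K1 by (intro mult_mono) auto
    then show ?thesis using A by (simp add: c_def mult.assoc)
  qed
  show ?thesis
  proof (intro exI[of _ c] conjI allI impI)
    show "0 < c" using A by (simp add: c_def K_def)
    fix n d :: nat assume n: "1 \<le> n" and d: "2 \<le> d"
    consider (small) "n < d" | (mid) "d \<le> n" "n < 2 ^ (d - 1)" | (large) "d \<le> n" "2 ^ (d - 1) \<le> n"
      by linarith
    then show "ereal (c * ?R n d) \<le> ?g n d"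
    proof cases
      case small
      have "ereal c \<le> ereal (A * (1 / 8) powr \<alpha>)" using cA[of "1 / 8"] by simp
      also have "\<dots> \<le> g_ada n d (ridge_class d \<alpha> p)"
        unfolding A_def by (rule g_ada_ge_small_n[OF \<alpha> p small])
      finally show ?thesis using small by simp
    next
      case large
      let ?x = "real n powr (- 2 * \<alpha> / (real d - 1)) * real d powr (- \<alpha> * (1 / p - 1 / 2))"
      let ?y = "real d powr (1 / 2 - 1 / p) * real n powr (- 2 / (real d - 1))"
      have "?x
          = (?y) powr \<alpha>"
        by (simp add: powr_mult powr_powr algebra_simps)
      then have "c * ?x
          \<le> A * (1 / 3136) powr \<alpha> * (?y) powr \<alpha>"
        using cA[of "1 / 3136"] by (simp add: mult_right_mono)
      also have "\<dots> = A * (?y / 3136) powr \<alpha>"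
        by (simp add: powr_divide)
      finally have "ereal (c * ?x)
          \<le> ereal (A * (?y / 3136) powr \<alpha>)"
        by simp
      also have "\<dots> \<le> g_ada n d (ridge_class d \<alpha> p)"
        unfolding A_def by (rule g_ada_ge_sphere[OF \<alpha> p d large(2) order_refl])
      finally show ?thesis using large by simp
    next
      case mid
      define L where "L = 2 + log 2 (real n)"
      have L2: "2 \<le> L" using n unfolding L_def by simp
      define \<rho> where "\<rho> = log 2 (1 + d / L) / L"
      have "0 \<le> log 2 (1 + d / L)" using L2 by (subst zero_le_log_cancel_iff) (auto intro: add_pos_nonneg)
      then have \<rho>0: "0 \<le> \<rho>" using L2 by (simp add: \<rho>_def)
      have key: "c * \<rho> powr (\<alpha> * e) \<le> A * (x powr (- e) * t) powr \<alpha>"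
        if "\<rho> \<le> K / x" "0 < x" "1 / 12544 \<le> t" for x t
      proof -
        have "\<rho> powr (\<alpha> * e) \<le> (K / x) powr (\<alpha> * e)"
          using that \<rho>0 \<alpha> e by (intro powr_mono2) auto
        also have "\<dots> = K powr (\<alpha> * e) * (x powr (- e)) powr \<alpha>"
          using that Kpos by (simp add: powr_divide powr_powr powr_minus_divide mult.commute)
        finally have "c * \<rho> powr (\<alpha> * e) \<le> c * (K powr (\<alpha> * e) * (x powr (- e)) powr \<alpha>)"
          using A by (intro mult_left_mono) (auto simp: c_def)
        also have "\<dots> = A * (1 / 12544) powr \<alpha> * (x powr (- e)) powr \<alpha>"
          using Kpos by (simp add: c_def powr_minus)
        also have "\<dots> \<le> A * t powr \<alpha> * (x powr (- e)) powr \<alpha>"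
          using that A \<alpha> by (intro mult_right_mono mult_left_mono powr_mono2) auto
        also have "\<dots> = A * (x powr (- e) * t) powr \<alpha>" using that by (simp add: powr_mult)
        finally show ?thesis .
      qed
      have "ereal (c * \<rho> powr (\<alpha> * e)) \<le> g_ada n d (ridge_class d \<alpha> p)"
      proof (cases "256 * L \<le> d")
        case True
        obtain M q where M: "0 < M" "0 < q" "q * M \<le> d" "real n < (sqrt q / 2) ^ M" "\<rho> \<le> 8 / real M"
          using sparse_parameters_exist[OF n mid(1) True L_def] unfolding \<rho>_def by (elim exE conjE)
        have "8 / real M \<le> K / real M" by (simp add: K_def divide_right_mono)
        then have "c * \<rho> powr (\<alpha> * e) \<le> A * (real M powr (- e) * (1 / 16)) powr \<alpha>"
          using M by (intro key) auto
        then have "ereal (c * \<rho> powr (\<alpha> * e)) \<le> ereal (A * (real M powr (1 / 2 - 1 / p) / 16) powr \<alpha>)"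
          by (simp add: e_def)
        also have "\<dots> \<le> g_ada n d (ridge_class d \<alpha> p)"
          unfolding A_def by (rule g_ada_ge_sparse[OF \<alpha> p M(1-4)])
        finally show ?thesis .
      next
        case False
        then have dl: "real d / L \<le> 256" using L2 by (simp add: pos_divide_le_eq)
        have "log 2 (1 + d / L) \<le> 2 * (d / L)" using L2 by (intro log2_one_plus_le) auto
        then have "\<rho> \<le> 2 * (d / L) / L"
          unfolding \<rho>_def using L2 by (intro divide_right_mono) auto
        also have "\<dots> = 2 * (d / L)\<^sup>2 / d" using d L2 by (simp add: power2_eq_square)
        also have "\<dots> \<le> 2 * 256\<^sup>2 / d"
          using dl L2 by (intro divide_right_mono mult_left_mono power_mono) auto
        also have "\<dots> = K / d" by (simp add: K_def)
        finally have "c * \<rho> powr (\<alpha> * e) \<le> A * (real d powr (- e) * (1 / 12544)) powr \<alpha>"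
          using d by (intro key) auto
        then have "ereal (c * \<rho> powr (\<alpha> * e)) \<le> ereal (A * (real d powr (- e) * (1 / 12544)) powr \<alpha>)" by simp
        also have "real d powr (- e) * (1 / 12544)
            = real d powr (1 / 2 - 1 / p) * real (2 ^ (d - 1)) powr (- 2 / (real d - 1)) / 3136"
        proof -
          have "real (2 ^ (d - 1)) = 2 powr (real d - 1)"
            using d powr_realpow[of 2 "d - 1"] by simp
          then have "real (2 ^ (d - 1)) powr (- 2 / (real d - 1)) = 2 powr (- 2)"
          proof (simp only: powr_powr)
            have "x * (- 2 / x) = - 2" if "x \<noteq> 0" for x :: real using that by simp
            from this[of "real d - 1"] have "(real d - 1) * (- 2 / (real d - 1)) = - 2" using d by simp
            then show "2 powr ((real d - 1) * (- 2 / (real d - 1))) = 2 powr (- 2 :: real)" by simp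
          qed
          also have "\<dots> = 1 / 4" by (simp add: powr_minus)
          finally show ?thesis by (simp add: e_def)
        qed
        also have "ereal (A * (real d powr (1 / 2 - 1 / p)
            * real (2 ^ (d - 1)) powr (- 2 / (real d - 1)) / 3136) powr \<alpha>) \<le> g_ada n d (ridge_class d \<alpha> p)"
          unfolding A_def using mid by (intro g_ada_ge_sphere[OF \<alpha> p d]) auto
        finally show ?thesis .
      qed
      then show ?thesis using mid unfolding \<rho>_def L_def e_def by simp
    qed
  qed
qed

section \<open>Taylor expansion and finite differences on the line\<close>

text \<open>Induction on the order: the derivative of the remainder of order \<open>Suc s\<close> is the remainder of order
  \<open>s\<close> of the derivative. The classical factor \<open>1 / fact s\<close> is given away.\<close>

lemma taylor_remainder_le:
  fixes G :: "nat \<Rightarrow> real \<Rightarrow> real"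
  assumes der: "\<And>k x. k < s \<Longrightarrow> x \<in> {-1..1} \<Longrightarrow> (G k has_real_derivative G (Suc k) x) (at x within {-1..1})"
    and top: "\<And>x. x \<in> {-1..1} \<Longrightarrow> \<bar>G s x - G s u\<bar> \<le> C * \<bar>x - u\<bar> powr \<beta>"
    and C: "0 \<le> C" and \<beta>: "0 < \<beta>" and u: "u \<in> {-1..1}" and x: "x \<in> {-1..1}"
  shows "\<bar>G 0 x - (\<Sum>k\<le>s. G k u * (x - u) ^ k / fact k)\<bar> \<le> C * \<bar>x - u\<bar> powr (\<beta> + real s)"
  using der top x
proof (induction s arbitrary: G x)
  case 0
  then show ?case by simp
next
  case (Suc s)
  define R where "R y = G 0 y - (\<Sum>k\<le>Suc s. G k u * (y - u) ^ k / fact k)" for y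
  define R' where "R' y = G 1 y - (\<Sum>k\<le>s. G (Suc k) u * (y - u) ^ k / fact k)" for y
  have IH: "\<bar>R' y\<bar> \<le> C * \<bar>y - u\<bar> powr (\<beta> + real s)" if "y \<in> {-1..1}" for y
    using Suc.IH[of "\<lambda>k. G (Suc k)" y] Suc.prems(1,2) that by (simp add: R'_def)
  have seg: "closed_segment u x \<subseteq> {-1..1}"
    using u Suc.prems(3) by (auto simp: closed_segment_eq_real_ivl)
  have R_eq: "R = (\<lambda>y. G 0 y - (G 0 u + (\<Sum>k\<le>s. G (Suc k) u * (y - u) ^ Suc k / fact (Suc k))))"
    by (rule ext) (simp only: R_def sum.atMost_Suc_shift power_0 fact_0 mult_1_right div_by_1)
  have "norm (R x - R u) \<le> C * \<bar>x - u\<bar> powr (\<beta> + real s) * norm (x - u)"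
  proof (rule field_differentiable_bound)
    show "convex (closed_segment u x)" by simp
    show "x \<in> closed_segment u x" "u \<in> closed_segment u x" by auto
    fix y assume y: "y \<in> closed_segment u x"
    then have yD: "y \<in> {-1..1}" using seg by blast
    have "((\<lambda>y. G (Suc k) u * (y - u) ^ Suc k / fact (Suc k)) has_real_derivative
        G (Suc k) u * (y - u) ^ k / fact k) (at y within closed_segment u x)" for k
    proof -
      have "((\<lambda>y. G (Suc k) u * (y - u) ^ Suc k / fact (Suc k)) has_real_derivative
          G (Suc k) u * (real (Suc k) * (y - u) ^ k) / fact (Suc k)) (at y within closed_segment u x)"
      proof -
        have "((\<lambda>y. y - u) has_real_derivative 1) (at y within closed_segment u x)"
          by (auto intro!: derivative_eq_intros)
        from DERIV_cdivide[OF DERIV_cmult[OF DERIV_power[OF this, of "Suc k"]]]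
        show ?thesis by (simp only: mult_1 diff_Suc_Suc diff_zero)
      qed
      also have "G (Suc k) u * (real (Suc k) * (y - u) ^ k) / fact (Suc k) = G (Suc k) u * (y - u) ^ k / fact k"
        by (simp only: fact_Suc mult.left_commute[of "G (Suc k) u"] mult_divide_mult_cancel_left_if) simp
      finally show ?thesis .
    qed
    then have sumd: "((\<lambda>y. \<Sum>k\<le>s. G (Suc k) u * (y - u) ^ Suc k / fact (Suc k)) has_real_derivative
        (\<Sum>k\<le>s. G (Suc k) u * (y - u) ^ k / fact k)) (at y within closed_segment u x)"
      by (intro DERIV_sum)
    have "(G 0 has_real_derivative G 1 y) (at y within closed_segment u x)"
      using Suc.prems(1)[of 0 y] yD by (auto intro: DERIV_subset[OF _ seg])
    from DERIV_diff[OF this DERIV_add[OF DERIV_const sumd]]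
    show "(R has_real_derivative R' y) (at y within closed_segment u x)"
      unfolding R_eq R'_def by simp
    have "\<bar>y - u\<bar> \<le> \<bar>x - u\<bar>" using y by (auto simp: closed_segment_eq_real_ivl split: if_splits)
    then have "\<bar>y - u\<bar> powr (\<beta> + real s) \<le> \<bar>x - u\<bar> powr (\<beta> + real s)"
      using \<beta> by (intro powr_mono2) auto
    then have "C * \<bar>y - u\<bar> powr (\<beta> + real s) \<le> C * \<bar>x - u\<bar> powr (\<beta> + real s)"
      using C by (rule mult_left_mono)
    then show "norm (R' y) \<le> C * \<bar>x - u\<bar> powr (\<beta> + real s)"
      using IH[OF yD] by simp
  qed
  moreover have "R u = 0" unfolding R_eq by simp
  moreover have "\<bar>x - u\<bar> powr (\<beta> + real s) * \<bar>x - u\<bar> = \<bar>x - u\<bar> powr (\<beta> + real (Suc s))"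
  proof (cases "x = u")
    case False
    then have "\<bar>x - u\<bar> powr (\<beta> + real s) * \<bar>x - u\<bar> powr 1 = \<bar>x - u\<bar> powr (\<beta> + real (Suc s))"
      by (simp only: powr_add[symmetric]) (simp add: algebra_simps)
    then show ?thesis by simp
  qed simp
  ultimately show ?case by (simp add: R_def mult.assoc)
qed

text \<open>The iterated forward difference of \<open>g\<close> at \<open>u\<close> with steps \<open>b\<close> from the list.\<close>

primrec fdiff :: "real list \<Rightarrow> (real \<Rightarrow> real) \<Rightarrow> real \<Rightarrow> real" where
  "fdiff [] g u = g u"
| "fdiff (b # bs) g u = fdiff bs g (u + b) - fdiff bs g u"

lemma has_real_derivative_fdiff:
  assumes "\<And>v. \<bar>v - u\<bar> \<le> (\<Sum>b\<leftarrow>bs. \<bar>b\<bar>) \<Longrightarrow> (g has_real_derivative g' v) (at v)"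
  shows "(fdiff bs g has_real_derivative fdiff bs g' u) (at u)"
  using assms
proof (induction bs arbitrary: u)
  case Nil
  then show ?case by simp
next
  case (Cons b bs)
  have 1: "(fdiff bs g has_real_derivative fdiff bs g' (u + b)) (at (u + b))"
  proof (rule Cons.IH, rule Cons.prems)
    fix v assume "\<bar>v - (u + b)\<bar> \<le> (\<Sum>b\<leftarrow>bs. \<bar>b\<bar>)"
    then show "\<bar>v - u\<bar> \<le> (\<Sum>b\<leftarrow>b # bs. \<bar>b\<bar>)"
      using abs_triangle_ineq[of "v - (u + b)" b] by simp
  qed
  have 2: "(fdiff bs g has_real_derivative fdiff bs g' u) (at u)"
    by (rule Cons.IH, rule Cons.prems) simp
  from DERIV_diff[OF 1[unfolded DERIV_shift] 2] show ?case by simp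
qed

text \<open>An iterated difference is \<open>prod_list bs\<close> times an average of the derivative of order \<open>length bs\<close> near
  \<open>u\<close>. The proof removes one step at a time with the mean value inequality, applied to the
  difference minus its linear main term.\<close>

lemma fdiff_approximates_derivative:
  assumes der: "\<And>k v. k < length bs \<Longrightarrow> \<bar>v\<bar> < 1 \<Longrightarrow> (G k has_real_derivative G (Suc k) v) (at v)"
    and inside: "\<bar>u\<bar> + (\<Sum>b\<leftarrow>bs. \<bar>b\<bar>) < 1"
    and osc: "\<And>v. \<bar>v - u\<bar> \<le> (\<Sum>b\<leftarrow>bs. \<bar>b\<bar>) \<Longrightarrow> \<bar>G (length bs) v - \<gamma>\<bar> \<le> \<omega>"
  shows "\<bar>fdiff bs (G 0) u - prod_list bs * \<gamma>\<bar> \<le> \<bar>prod_list bs\<bar> * \<omega>"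
  using assms
proof (induction bs arbitrary: G u)
  case Nil
  then show ?case by simp
next
  case (Cons b bs)
  define \<Phi> where "\<Phi> v = fdiff bs (G 0) v - v * (prod_list bs * \<gamma>)" for v
  define \<Phi>' where "\<Phi>' v = fdiff bs (G 1) v - prod_list bs * \<gamma>" for v
  have near: "\<bar>v - u\<bar> \<le> \<bar>b\<bar>" if "v \<in> closed_segment u (u + b)" for v
    using that by (auto simp: closed_segment_eq_real_ivl split: if_splits)
  have "norm (\<Phi> (u + b) - \<Phi> u) \<le> \<bar>prod_list bs\<bar> * \<omega> * norm (u + b - u)"
  proof (rule field_differentiable_bound)
    show "convex (closed_segment u (u + b))" by simp
    show "u + b \<in> closed_segment u (u + b)" "u \<in> closed_segment u (u + b)" by auto
    fix v assume "v \<in> closed_segment u (u + b)"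
    then have v: "\<bar>v - u\<bar> \<le> \<bar>b\<bar>" by (rule near)
    have "(fdiff bs (G 0) has_real_derivative fdiff bs (G 1) v) (at v)"
    proof (rule has_real_derivative_fdiff)
      fix w assume "\<bar>w - v\<bar> \<le> (\<Sum>b\<leftarrow>bs. \<bar>b\<bar>)"
      then have "\<bar>w\<bar> < 1" using v Cons.prems(2) by simp
      then show "(G 0 has_real_derivative G 1 w) (at w)" using Cons.prems(1)[of 0 w] by simp
    qed
    then have "(\<Phi> has_real_derivative \<Phi>' v) (at v)"
      unfolding \<Phi>_def \<Phi>'_def by (auto intro!: derivative_eq_intros)
    then show "(\<Phi> has_real_derivative \<Phi>' v) (at v within closed_segment u (u + b))"
      by (rule has_field_derivative_at_within)
    have "\<bar>fdiff bs (G (Suc 0)) v - prod_list bs * \<gamma>\<bar> \<le> \<bar>prod_list bs\<bar> * \<omega>"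
    proof (rule Cons.IH[of "\<lambda>k. G (Suc k)"])
      show "\<bar>v\<bar> + (\<Sum>b\<leftarrow>bs. \<bar>b\<bar>) < 1" using v Cons.prems(2) by simp
      show "(G (Suc k) has_real_derivative G (Suc (Suc k)) w) (at w)"
        if "k < length bs" "\<bar>w\<bar> < 1" for k w using Cons.prems(1)[of "Suc k" w] that by simp
      show "\<bar>G (Suc (length bs)) w - \<gamma>\<bar> \<le> \<omega>" if "\<bar>w - v\<bar> \<le> (\<Sum>b\<leftarrow>bs. \<bar>b\<bar>)" for w
        using Cons.prems(3)[of w] that v by simp
    qed
    then show "norm (\<Phi>' v) \<le> \<bar>prod_list bs\<bar> * \<omega>" by (simp add: \<Phi>'_def)
  qed
  moreover have "\<Phi> (u + b) - \<Phi> u = fdiff (b # bs) (G 0) u - prod_list (b # bs) * \<gamma>"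
    by (simp add: \<Phi>_def algebra_simps)
  ultimately show ?case by (simp add: abs_mult mult_ac)
qed

lemma Lip_ball_derivatives:
  assumes \<alpha>: "0 < \<alpha>" and g: "g \<in> Lip_space {-1..1} \<alpha>" "Lip_norm {-1..1} \<alpha> g \<le> 1"
  defines "s \<equiv> lip_order \<alpha>" and "G \<equiv> \<lambda>k. deriv_within {-1..1} k g"
  shows "\<And>k x. k < s \<Longrightarrow> x \<in> {-1..1} \<Longrightarrow> (G k has_real_derivative G (Suc k) x) (at x within {-1..1})"
    and "\<And>k x. k \<le> s \<Longrightarrow> x \<in> {-1..1} \<Longrightarrow> \<bar>G k x\<bar> \<le> 1"
    and "\<And>x y. x \<in> {-1..1} \<Longrightarrow> y \<in> {-1..1} \<Longrightarrow> \<bar>G s x - G s y\<bar> \<le> 2 * \<bar>x - y\<bar> powr (\<alpha> - real s)"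
    and "continuous_on {-1..1} g"
proof -
  have C: "g \<in> C_space {-1..1} s" using g(1) by (simp add: Lip_space_def s_def)
  have norms: "C_norm {-1..1} s g \<le> 1" "hoelder_const {-1..1} (\<alpha> - real s) (G s) \<le> 1"
    using g(2) by (auto simp: Lip_norm_def Let_def s_def G_def)
  show "(G k has_real_derivative G (Suc k) x) (at x within {-1..1})" if "k < s" "x \<in> {-1..1}" for k x
  proof -
    have "G k differentiable (at x within {-1..1})"
      using C that by (auto simp: C_space_def G_def differentiable_on_def)
    then have "(G k has_vector_derivative G (Suc k) x) (at x within {-1..1})"
      unfolding G_def by (simp add: vector_derivative_works)
    then show ?thesis by (simp add: has_real_derivative_iff_has_vector_derivative)
  qed
  show "\<bar>G k x\<bar> \<le> 1" if "k \<le> s" "x \<in> {-1..1}" for k x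
  proof -
    have "sup_norm {-1..1} (G k) \<le> C_norm {-1..1} s g"
      unfolding C_norm_def G_def using that(1) by (intro Max_ge) auto
    then have "sup_norm {-1..1} (G k) \<le> 1" using norms(1) by (rule order_trans)
    moreover have "ereal \<bar>G k x\<bar> \<le> sup_norm {-1..1} (G k)"
      unfolding sup_norm_def using that(2) by (rule SUP_upper)
    ultimately have "ereal \<bar>G k x\<bar> \<le> 1" by (rule order_trans[rotated])
    then show ?thesis by simp
  qed
  show "\<bar>G s x - G s y\<bar> \<le> 2 * \<bar>x - y\<bar> powr (\<alpha> - real s)" if "x \<in> {-1..1}" "y \<in> {-1..1}" for x y
  proof (cases "x = y")
    case False
    have "ereal (\<bar>G s x - G s y\<bar> / (2 * min 1 \<bar>x - y\<bar> powr (\<alpha> - real s)))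
        \<le> hoelder_const {-1..1} (\<alpha> - real s) (G s)"
      unfolding hoelder_const_def
      by (rule SUP_upper2[of "(x, y)"]) (use that False in auto)
    then have "ereal (\<bar>G s x - G s y\<bar> / (2 * min 1 \<bar>x - y\<bar> powr (\<alpha> - real s))) \<le> 1"
      using norms(2) by (rule order_trans)
    moreover have "0 < min 1 \<bar>x - y\<bar>" using False by simp
    ultimately have "\<bar>G s x - G s y\<bar> \<le> 2 * min 1 \<bar>x - y\<bar> powr (\<alpha> - real s)"
      by (simp add: pos_divide_le_eq)
    also have "\<dots> \<le> 2 * \<bar>x - y\<bar> powr (\<alpha> - real s)"
      using False lip_order_bounds[OF \<alpha>] by (intro mult_left_mono powr_mono2) (auto simp: s_def)
    finally show ?thesis .
  qed (simp)
  show "continuous_on {-1..1} g"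
    using C by (auto simp: C_space_def dest!: spec[of "\<lambda>k. k \<le> s \<longrightarrow> _ k" 0])
qed

section \<open>Linear sampling operators\<close>

lemma measurable_component_ball_measure:
  "i < d \<Longrightarrow> (\<lambda>x. x i) \<in> borel_measurable (ball_measure d)"
  unfolding ball_measure_def
  by (intro measurable_restrict_space1) (auto intro!: measurable_component_singleton)

lemma dotp_in_interval:
  assumes "0 < p" "p \<le> 2" "lp_norm p d a \<le> 1" "L2_set x {..<d} \<le> r"
  shows "\<bar>dotp d a x\<bar> \<le> r"
proof -
  have "L2_set a {..<d} * L2_set x {..<d} \<le> 1 * r"
    using lp_ball_L2[OF assms(1-3)] assms(4) by (intro mult_mono) auto
  then show ?thesis using abs_dotp_le[of d a x] by simp
qed

lemma ridge_function_measurable: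
  assumes \<alpha>: "0 < \<alpha>" and p: "0 < p" "p \<le> 2" and f: "f \<in> ridge_class d \<alpha> p"
  shows "f \<in> borel_measurable (ball_measure d)"
proof -
  obtain g a where f_eq: "f = restrict (\<lambda>x. g (dotp d a x)) (unit_ball2 d)"
    and g: "g \<in> Lip_space {-1..1} \<alpha>" "Lip_norm {-1..1} \<alpha> g \<le> 1" and a: "lp_norm p d a \<le> 1"
    using f unfolding ridge_class_def by blast
  have cont: "continuous_on UNIV (\<lambda>t. g (max (-1) (min 1 t)))"
    by (rule continuous_on_compose2[OF Lip_ball_derivatives(4)[OF \<alpha> g]]) (auto intro!: continuous_intros)
  have "(\<lambda>x. dotp d a x) \<in> borel_measurable (ball_measure d)"
    unfolding dotp_def using measurable_component_ball_measure by (intro borel_measurable_sum borel_measurable_times) auto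
  then have "(\<lambda>x. g (max (-1) (min 1 (dotp d a x)))) \<in> borel_measurable (ball_measure d)"
    using measurable_compose borel_measurable_continuous_onI[OF cont] by blast
  then show ?thesis
  proof (rule measurable_cong[THEN iffD1, rotated])
    fix x assume "x \<in> space (ball_measure d)"
    then have x: "x \<in> unit_ball2 d" by (simp add: space_ball_measure)
    then have "\<bar>dotp d a x\<bar> \<le> 1"
      by (intro dotp_in_interval[OF p a]) (simp add: unit_ball2_def)
    then have "max (-1) (min 1 (dotp d a x)) = dotp d a x" by (auto simp: abs_le_iff)
    then show "g (max (-1) (min 1 (dotp d a x))) = f x" using x by (simp add: f_eq)
  qed
qed

lemma info_constant_points: "info (\<lambda>i y. q i) m f = (\<lambda>i\<in>{..<m}. f (q i))"
proof (induction m)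
  case (Suc m)
  then have "info (\<lambda>i y. q i) (Suc m) f = (\<lambda>i\<in>{..<m}. f (q i))(m := f (q m))"
    by (simp only: info.simps)
  also have "\<dots> = (\<lambda>i\<in>{..<Suc m}. f (q i))" by (simp add: fun_eq_iff)
  finally show ?case .
qed (simp add: fun_eq_iff)

text \<open>An operator that is linear and depends on finitely many function values is a linear sampling
  algorithm: a vector of values is turned into a function by extending it with zero.\<close>

lemma g_lin_le_of_operator:
  fixes T :: "((nat \<Rightarrow> real) \<Rightarrow> real) \<Rightarrow> (nat \<Rightarrow> real) \<Rightarrow> real"
  assumes P: "finite P" "P \<noteq> {}" "P \<subseteq> unit_ball2 d" "card P \<le> n"
    and lin: "\<And>F F' b c x. T (\<lambda>z. b * F z + c * F' z) x = b * T F x + c * T F' x"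
    and loc: "\<And>F F' x. (\<And>z. z \<in> P \<Longrightarrow> F z = F' z) \<Longrightarrow> x \<in> unit_ball2 d \<Longrightarrow> T F x = T F' x"
    and meas: "\<And>F. T F \<in> borel_measurable (ball_measure d)"
    and bdd: "\<And>F. \<exists>K. \<forall>x\<in>unit_ball2 d. \<bar>T F x\<bar> \<le> K"
    and measf: "\<And>f. f \<in> \<F> \<Longrightarrow> f \<in> borel_measurable (ball_measure d)"
    and err: "\<And>f x. f \<in> \<F> \<Longrightarrow> x \<in> unit_ball2 d \<Longrightarrow> \<bar>f x - T f x\<bar> \<le> e"
  shows "g_lin n d \<F> \<le> ereal e"
proof -
  define m where "m = card P"
  obtain idx where idx: "bij_betw idx P {0..<m}" using ex_bij_betw_finite_nat[OF P(1)] m_def by blast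
  define q where "q = inv_into P idx"
  have idx_lt: "idx z < m" if "z \<in> P" for z using bij_betwE[OF idx] that by auto
  have q_idx: "q (idx z) = z" if "z \<in> P" for z
    unfolding q_def using idx that by (intro inv_into_f_f) (auto simp: bij_betw_def)
  have qP: "q i \<in> P" if "i < m" for i
    unfolding q_def using idx that by (intro inv_into_into) (auto simp: bij_betw_def)
  define \<phi> where "\<phi> y = T (\<lambda>z. if z \<in> P then y (idx z) else 0)" for y :: "nat \<Rightarrow> real"
  define S where "S = \<phi> \<circ> info (\<lambda>i y. q i) m"
  have T0: "T (\<lambda>z. 0) x = 0" for x using lin[of 0 _ 0] by simp
  have "\<phi> y \<in> Linf d" for y
  proof -
    obtain K where K: "\<And>x. x \<in> unit_ball2 d \<Longrightarrow> \<bar>\<phi> y x\<bar> \<le> K" using bdd unfolding \<phi>_def by blast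
    have m1: "(\<lambda>x. ereal \<bar>\<phi> y x\<bar>) \<in> borel_measurable (ball_measure d)"
      using meas unfolding \<phi>_def by measurable
    have "Linf_norm d (\<phi> y) \<le> ereal K"
      unfolding Linf_norm_def using m1
      by (rule esssup_I) (auto simp: space_ball_measure intro!: AE_I2 K)
    then show ?thesis using meas by (auto simp: Linf_def \<phi>_def)
  qed
  moreover have "\<phi> (\<lambda>i\<in>{..<m}. 0) = T (\<lambda>z. 0)"
    unfolding \<phi>_def using idx_lt by (intro arg_cong[where f = T]) auto
  ultimately have "sampling_scheme d m (\<lambda>i y. q i) \<phi>"
    unfolding sampling_scheme_def using qP P(3) T0 by auto
  moreover have "non_adaptive m (\<lambda>i y. q i)" by (auto simp: non_adaptive_def constant_on_def)
  moreover have "linear_recovery d m \<phi>"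
    unfolding linear_recovery_def
  proof (intro ballI allI AE_I2)
    fix y z b c x
    have "\<phi> (\<lambda>i\<in>{..<m}. b * y i + c * z i) = T (\<lambda>w. b * (if w \<in> P then y (idx w) else 0) + c * (if w \<in> P then z (idx w) else 0))"
      unfolding \<phi>_def using idx_lt by (intro arg_cong[where f = T]) auto
    then show "\<phi> (\<lambda>i\<in>{..<m}. b * y i + c * z i) x = b * \<phi> y x + c * \<phi> z x"
      by (simp add: lin \<phi>_def)
  qed
  moreover have "1 \<le> m" "m \<le> n" using P by (auto simp: m_def Suc_le_eq card_gt_0_iff)
  ultimately have "S \<in> linear_algorithms n d"
    unfolding linear_algorithms_def S_def by blast
  then have "g_lin n d \<F> \<le> worst_case_error d \<F> S" unfolding g_lin_def by (rule INF_lower)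
  also have "\<dots> \<le> ereal e"
    unfolding worst_case_error_def
  proof (rule SUP_least)
    fix f assume f: "f \<in> \<F>"
    have Sf: "S f x = T f x" if "x \<in> unit_ball2 d" for x
      unfolding S_def comp_def info_constant_points \<phi>_def
      by (rule loc[OF _ that]) (simp add: idx_lt q_idx)
    have ms: "S f \<in> borel_measurable (ball_measure d)"
      unfolding S_def comp_def \<phi>_def by (rule meas)
    have "(\<lambda>x. ereal \<bar>f x - S f x\<bar>) \<in> borel_measurable (ball_measure d)"
      using measf[OF f] ms by measurable
    then show "Linf_norm d (\<lambda>x. f x - S f x) \<le> ereal e"
      unfolding Linf_norm_def
      by (rule esssup_I) (auto simp: space_ball_measure Sf intro!: AE_I2 err[OF f])
  qed
  finally show ?thesis .
qed

text \<open>The zero algorithm.\<close>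

lemma g_lin_ridge_le_one:
  assumes \<alpha>: "0 < \<alpha>" and p: "0 < p" "p \<le> 2" and n: "1 \<le> n"
  shows "g_lin n d (ridge_class d \<alpha> p) \<le> ereal 1"
proof (rule g_lin_le_of_operator[where T = "\<lambda>F x. 0" and P = "{\<lambda>i\<in>{..<d}. 0}"])
  show "{\<lambda>i\<in>{..<d}. 0} \<subseteq> unit_ball2 d"
    by (auto simp: unit_ball2_def vecs_def L2_set_def)
  show "f \<in> borel_measurable (ball_measure d)" if "f \<in> ridge_class d \<alpha> p" for f
    by (rule ridge_function_measurable[OF \<alpha> p that])
  show "\<bar>f x - 0\<bar> \<le> 1" if f: "f \<in> ridge_class d \<alpha> p" and x: "x \<in> unit_ball2 d" for f x
  proof -
    obtain g a where f_eq: "f = restrict (\<lambda>x. g (dotp d a x)) (unit_ball2 d)"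
      and g: "g \<in> Lip_space {-1..1} \<alpha>" "Lip_norm {-1..1} \<alpha> g \<le> 1" and a: "lp_norm p d a \<le> 1"
      using f unfolding ridge_class_def by blast
    have "\<bar>dotp d a x\<bar> \<le> 1" using x by (intro dotp_in_interval[OF p a]) (simp add: unit_ball2_def)
    then have "\<bar>deriv_within {-1..1} 0 g (dotp d a x)\<bar> \<le> 1"
      by (intro Lip_ball_derivatives(2)[OF \<alpha> g]) auto
    then show ?thesis using x by (simp add: f_eq)
  qed
qed (use n in auto)

section \<open>Finite differences in the ball\<close>

text \<open>The iterated forward difference with step \<open>h\<close> in the coordinate directions from the list.\<close>

primrec vdiff :: "nat list \<Rightarrow> real \<Rightarrow> ((nat \<Rightarrow> real) \<Rightarrow> real) \<Rightarrow> (nat \<Rightarrow> real) \<Rightarrow> real" where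
  "vdiff [] h F c = F c"
| "vdiff (i # is) h F c = vdiff is h F (c(i := c i + h)) - vdiff is h F c"

lemma vdiff_linear: "vdiff is h (\<lambda>z. b * F z + c * F' z) x = b * vdiff is h F x + c * vdiff is h F' x"
  by (induction "is" arbitrary: x) (simp_all add: algebra_simps)

text \<open>The sampling points that a difference of order \<open>\<Sum>i<d. \<beta> i\<close> at \<open>c\<close> needs.\<close>

definition node :: "nat \<Rightarrow> (nat \<Rightarrow> real) \<Rightarrow> real \<Rightarrow> (nat \<Rightarrow> nat) \<Rightarrow> nat \<Rightarrow> real" where
  "node d c h \<beta> = (\<lambda>i\<in>{..<d}. c i + h * real (\<beta> i))"

lemma fun_upd_in_vecs: "c \<in> vecs d \<Longrightarrow> i < d \<Longrightarrow> c(i := t) \<in> vecs d"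
  by (auto simp: vecs_def PiE_iff extensional_def)

lemma vdiff_cong:
  assumes "c \<in> vecs d" "set is \<subseteq> {..<d}"
    and "\<And>\<beta>. (\<Sum>i<d. \<beta> i) \<le> length is \<Longrightarrow> F (node d c h \<beta>) = F' (node d c h \<beta>)"
  shows "vdiff is h F c = vdiff is h F' c"
  using assms
proof (induction "is" arbitrary: c)
  case Nil
  have "node d c h (\<lambda>_. 0) = c" using Nil.prems(1) by (auto simp: node_def vecs_def PiE_iff extensional_def)
  then show ?case using Nil.prems(3)[of "\<lambda>_. 0"] by simp
next
  case (Cons i "is")
  have i: "i < d" using Cons.prems(2) by simp
  have "vdiff is h F (c(i := c i + h)) = vdiff is h F' (c(i := c i + h))"
  proof (rule Cons.IH)
    show "c(i := c i + h) \<in> vecs d" using fun_upd_in_vecs Cons.prems(1) i by blast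
    fix \<beta> :: "nat \<Rightarrow> nat" assume \<beta>: "(\<Sum>i<d. \<beta> i) \<le> length is"
    have "node d (c(i := c i + h)) h \<beta> = node d c h (\<beta>(i := Suc (\<beta> i)))"
      by (auto simp: node_def fun_eq_iff algebra_simps)
    moreover have card: "(\<Sum>j<d. (\<beta>(i := Suc (\<beta> i))) j) = Suc (\<Sum>j<d. \<beta> j)"
      using i by (simp add: sum.remove[of "{..<d}" i])
    moreover have "F (node d c h (\<beta>(i := Suc (\<beta> i)))) = F' (node d c h (\<beta>(i := Suc (\<beta> i))))"
      using \<beta> by (intro Cons.prems(3)) (simp only: card list.size add_Suc_right add_0_right Suc_le_mono)
    ultimately show "F (node d (c(i := c i + h)) h \<beta>) = F' (node d (c(i := c i + h)) h \<beta>)"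
      by (simp only:)
  qed (use Cons.prems in auto)
  moreover have "vdiff is h F c = vdiff is h F' c"
    by (rule Cons.IH) (use Cons.prems in auto)
  ultimately show ?case by simp
qed

text \<open>A node is described by the exponents \<open>\<beta> i\<close> together with the slack \<open>s - (\<Sum>i<d. \<beta> i)\<close>, and there
  are \<open>(d + s) choose s\<close> ways to write \<open>s\<close> as a sum of \<open>d + 1\<close> natural numbers.\<close>

lemma card_nodes_le:
  assumes C: "finite C"
  shows "finite {node d c h \<beta> | c \<beta>. c \<in> C \<and> (\<Sum>i<d. \<beta> i) \<le> s}" (is "finite ?P")
    and "card {node d c h \<beta> | c \<beta>. c \<in> C \<and> (\<Sum>i<d. \<beta> i) \<le> s} \<le> card C * ((d + s) choose s)"
proof -
  let ?L = "{l :: nat list. length l = Suc d \<and> sum_list l = s}"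
  let ?f = "\<lambda>(c, l). node d c h ((!) l)"
  have cardL: "card ?L = (d + s) choose s"
    using card_length_sum_list[of "Suc d" s] by (simp add: add.commute)
  then have finL: "finite ?L" by (intro card_ge_0_finite) (simp add: zero_less_binomial)
  have sub: "?P \<subseteq> ?f ` (C \<times> ?L)"
  proof
    fix z assume "z \<in> ?P"
    then obtain c \<beta> where z: "z = node d c h \<beta>" "c \<in> C" "(\<Sum>i<d. \<beta> i) \<le> s" by blast
    define l where "l = map \<beta> [0..<d] @ [s - (\<Sum>i<d. \<beta> i)]"
    have "l ! i = \<beta> i" if "i < d" for i using that by (simp add: l_def nth_append)
    then have "z = node d c h ((!) l)" using z(1) by (auto simp: node_def)
    moreover have "l \<in> ?L"
      using z(3) by (simp add: l_def interv_sum_list_conv_sum_set_nat atLeast0LessThan)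
    ultimately show "z \<in> ?f ` (C \<times> ?L)" using z(2) by force
  qed
  show "finite ?P" by (rule finite_subset[OF sub]) (use C finL in auto)
  have "card ?P \<le> card (C \<times> ?L)"
    using surj_card_le[OF _ sub] C finL by blast
  then show "card ?P \<le> card C * ((d + s) choose s)" by (simp add: card_cartesian_product cardL)
qed

lemma dotp_fun_upd: "i < d \<Longrightarrow> dotp d a (c(i := c i + h)) = dotp d a c + h * a i"
  by (simp add: dotp_def sum.remove[of "{..<d}" i] algebra_simps)

lemma L2_set_fun_upd_le:
  fixes d :: nat
  assumes "0 \<le> h"
  shows "L2_set (c(i := c i + h)) {..<d} \<le> L2_set c {..<d} + h"
proof -
  have "c(i := c i + h) = (\<lambda>j. c j + (if j = i then h else 0))" by auto
  then have "L2_set (c(i := c i + h)) {..<d} \<le> L2_set c {..<d} + L2_set (\<lambda>j. if j = i then h else 0) {..<d}"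
    using L2_set_triangle_ineq[of c "\<lambda>j. if j = i then h else 0" "{..<d}"] by simp
  also have "L2_set (\<lambda>j. if j = i then h else 0) {..<d} \<le> (\<Sum>j<d. if j = i then h else 0)"
    using L2_set_le_sum[of "{..<d}" "\<lambda>j. if j = i then h else 0"] assms by auto
  also have "\<dots> \<le> h" using assms by (simp add: sum.delta')
  finally show ?thesis by simp
qed

text \<open>On a ridge function, a step \<open>h\<close> in the direction of coordinate \<open>i\<close> is a step \<open>h * a i\<close> on the line. The
  condition on \<open>c\<close> keeps all nodes in the ball, where \<open>F\<close> is known.\<close>

lemma vdiff_ridge:
  assumes "\<And>x. x \<in> unit_ball2 d \<Longrightarrow> F x = g (dotp d a x)" and "0 \<le> h"
    and "set is \<subseteq> {..<d}" "c \<in> vecs d" "L2_set c {..<d} + h * real (length is) \<le> 1"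
  shows "vdiff is h F c = fdiff (map (\<lambda>i. h * a i) is) g (dotp d a c)"
  using assms(3-5)
proof (induction "is" arbitrary: c)
  case Nil
  then show ?case using assms(1) by (simp add: unit_ball2_def)
next
  case (Cons i "is")
  have i: "i < d" using Cons.prems(1) by simp
  have L: "L2_set (c(i := c i + h)) {..<d} + h * real (length is) \<le> 1"
    using L2_set_fun_upd_le[OF assms(2), of c i d] Cons.prems(3) by (simp add: algebra_simps)
  have "vdiff is h F (c(i := c i + h)) = fdiff (map (\<lambda>i. h * a i) is) g (dotp d a (c(i := c i + h)))"
    using Cons.prems(1) by (intro Cons.IH[OF _ fun_upd_in_vecs[OF Cons.prems(2) i] L]) simp
  moreover have "vdiff is h F c = fdiff (map (\<lambda>i. h * a i) is) g (dotp d a c)"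
    using Cons.prems assms(2) by (intro Cons.IH) (auto simp: algebra_simps)
  ultimately show ?case using dotp_fun_upd[OF i] by simp
qed

text \<open>Lists instead of multi-indices: partial derivatives are then indexed with repetition, and no
  multinomial coefficients occur.\<close>

definition index_lists :: "nat \<Rightarrow> nat \<Rightarrow> nat list set" where
  "index_lists d k = {is. set is \<subseteq> {..<d} \<and> length is = k}"

lemma sum_prod_index_lists:
  fixes f :: "nat \<Rightarrow> real"
  shows "(\<Sum>is\<in>index_lists d k. prod_list (map f is)) = (\<Sum>i<d. f i) ^ k"
proof (induction k)
  case 0
  have "index_lists d 0 = {[]}" by (auto simp: index_lists_def)
  then show ?case by simp
next
  case (Suc k)
  have "index_lists d (Suc k) = (\<lambda>(is, i). i # is) ` (index_lists d k \<times> {..<d})"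
    unfolding index_lists_def lists_length_Suc_eq ..
  moreover have "inj_on (\<lambda>(is, i). i # is) (index_lists d k \<times> {..<d})" by (auto intro: inj_onI)
  ultimately have "(\<Sum>is\<in>index_lists d (Suc k). prod_list (map f is))
      = (\<Sum>(is, i)\<in>index_lists d k \<times> {..<d}. f i * prod_list (map f is))"
    by (simp add: sum.reindex case_prod_unfold)
  also have "\<dots> = (\<Sum>is\<in>index_lists d k. \<Sum>i<d. f i * prod_list (map f is))"
    by (simp only: sum.cartesian_product)
  also have "\<dots> = (\<Sum>is\<in>index_lists d k. prod_list (map f is)) * (\<Sum>i<d. f i)"
    unfolding sum_product by (simp only: mult.commute)
  finally show ?case using Suc by (simp add: mult.commute)
qed

section \<open>The discretised Taylor polynomial\<close>

text \<open>The Taylor polynomial of order \<open>s\<close> at the centre \<open>ct x\<close>, evaluated at \<open>x\<close>, with each partial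
  derivative replaced by a difference quotient of step \<open>h\<close>.\<close>

definition taylor_op ::
  "nat \<Rightarrow> nat \<Rightarrow> real \<Rightarrow> ((nat \<Rightarrow> real) \<Rightarrow> nat \<Rightarrow> real) \<Rightarrow> ((nat \<Rightarrow> real) \<Rightarrow> real) \<Rightarrow> (nat \<Rightarrow> real) \<Rightarrow> real" where
  "taylor_op d s h ct F x =
     (\<Sum>k\<le>s. (\<Sum>is\<in>index_lists d k. vdiff is h F (ct x) / h ^ k * prod_list (map (\<lambda>i. x i - ct x i) is)) / fact k)"

lemma taylor_op_linear:
  "taylor_op d s h ct (\<lambda>z. b * F z + c * F' z) x = b * taylor_op d s h ct F x + c * taylor_op d s h ct F' x"
  unfolding taylor_op_def vdiff_linear
  by (simp add: sum.distrib sum_distrib_left add_divide_distrib ring_distribs mult.assoc)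

lemma abs_le_L2_set:
  fixes d :: nat
  assumes "i < d"
  shows "\<bar>x i\<bar> \<le> L2_set x {..<d}"
  using member_le_L2_set[of "{..<d}" i "\<lambda>i. \<bar>x i\<bar>"] assms by (simp add: L2_set_def)

lemma prod_list_map_mult:
  fixes f g :: "'a \<Rightarrow> real"
  shows "prod_list (map (\<lambda>i. f i * g i) is) = prod_list (map f is) * prod_list (map g is)"
  by (induction "is") auto

lemma abs_prod_list_map:
  fixes f :: "'a \<Rightarrow> real"
  shows "\<bar>prod_list (map f is)\<bar> = prod_list (map (\<lambda>i. \<bar>f i\<bar>) is)"
  by (induction "is") (auto simp: abs_mult)

lemma prod_list_map_const:
  fixes h :: real
  shows "prod_list (map (\<lambda>i. h) is) = h ^ length is"
  by (induction "is") auto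

text \<open>For the orders below \<open>lip_order \<alpha>\<close> the next derivative is bounded by \<open>1\<close>, and \<open>\<tau> \<le> \<tau> powr \<beta>\<close> on the
  unit interval.\<close>

lemma derivative_oscillation_le:
  assumes \<alpha>: "0 < \<alpha>" and g: "g \<in> Lip_space {-1..1} \<alpha>" "Lip_norm {-1..1} \<alpha> g \<le> 1"
    and k: "k \<le> lip_order \<alpha>" and u: "u \<in> {-1..1}" and v: "v \<in> {-1..1}"
    and \<tau>: "\<bar>v - u\<bar> \<le> \<tau>" "\<tau> \<le> 1"
  shows "\<bar>deriv_within {-1..1} k g v - deriv_within {-1..1} k g u\<bar> \<le> 2 * \<tau> powr (\<alpha> - real (lip_order \<alpha>))"
proof -
  let ?\<beta> = "\<alpha> - real (lip_order \<alpha>)"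
  have \<beta>: "0 < ?\<beta>" "?\<beta> \<le> 1" using lip_order_bounds[OF \<alpha>] by auto
  show ?thesis
  proof (cases "k = lip_order \<alpha>")
    case True
    have "\<bar>deriv_within {-1..1} k g v - deriv_within {-1..1} k g u\<bar> \<le> 2 * \<bar>v - u\<bar> powr ?\<beta>"
      unfolding True by (rule Lip_ball_derivatives(3)[OF \<alpha> g v u])
    also have "\<dots> \<le> 2 * \<tau> powr ?\<beta>" using \<tau> \<beta> by (intro mult_left_mono powr_mono2) auto
    finally show ?thesis .
  next
    case False
    then have k: "k < lip_order \<alpha>" using k by simp
    have "norm (deriv_within {-1..1} k g v - deriv_within {-1..1} k g u) \<le> 1 * norm (v - u)"
    proof (rule field_differentiable_bound)
      show "convex {-1..1::real}" by simp
      show "(deriv_within {-1..1} k g has_real_derivative deriv_within {-1..1} (Suc k) g x) (at x within {-1..1})"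
        if "x \<in> {-1..1}" for x by (rule Lip_ball_derivatives(1)[OF \<alpha> g k that])
      show "norm (deriv_within {-1..1} (Suc k) g x) \<le> 1" if "x \<in> {-1..1}" for x
        using Lip_ball_derivatives(2)[OF \<alpha> g _ that, of "Suc k"] k
        by (simp only: real_norm_def Suc_le_eq)
    qed (use u v in auto)
    also have "\<dots> \<le> \<tau> powr 1" using \<tau> by (cases "\<tau> = 0") auto
    also have "\<dots> \<le> \<tau> powr ?\<beta>" using \<tau> \<beta> by (intro powr_mono') auto
    also have "\<dots> \<le> 2 * \<tau> powr ?\<beta>" by simp
    finally show ?thesis by simp
  qed
qed

text \<open>The partial derivatives of \<open>g (a \<cdot> x)\<close> of order \<open>k\<close> are \<open>\<Prod>i\<leftarrow>is. a i\<close> times the derivative of \<open>g\<close>. The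
  error is uniform over the class, so it can be made arbitrarily small by the choice of \<open>h\<close>.\<close>

lemma vdiff_ridge_approximates:
  assumes \<alpha>: "0 < \<alpha>" and p: "0 < p" "p \<le> 2" and a: "lp_norm p d a \<le> 1"
    and g: "g \<in> Lip_space {-1..1} \<alpha>" "Lip_norm {-1..1} \<alpha> g \<le> 1"
    and F: "\<And>x. x \<in> unit_ball2 d \<Longrightarrow> F x = g (dotp d a x)"
    and c: "c \<in> vecs d" "L2_set c {..<d} \<le> 1 - \<eta>" and h: "0 < h" "h * real (lip_order \<alpha>) \<le> \<tau>"
    and \<tau>: "\<tau> < \<eta>" "\<tau> \<le> 1"
    and "is": "is \<in> index_lists d k" and k: "k \<le> lip_order \<alpha>"
  shows "\<bar>vdiff is h F c / h ^ k - prod_list (map a is) * deriv_within {-1..1} k g (dotp d a c)\<bar>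
    \<le> \<bar>prod_list (map a is)\<bar> * (2 * \<tau> powr (\<alpha> - real (lip_order \<alpha>)))"
proof -
  define u where "u = dotp d a c"
  define bs where "bs = map (\<lambda>i. h * a i) is"
  define G where "G k = deriv_within {-1..1} k g" for k
  let ?\<omega> = "2 * \<tau> powr (\<alpha> - real (lip_order \<alpha>))"
  have is': "set is \<subseteq> {..<d}" "length is = k" using "is" by (auto simp: index_lists_def)
  have u: "\<bar>u\<bar> \<le> 1 - \<eta>" unfolding u_def using dotp_in_interval[OF p a c(2)] .
  have "h * real k \<le> h * real (lip_order \<alpha>)" using k h by (intro mult_left_mono) auto
  then have hk: "h * real k \<le> \<tau>" using h by linarith
  have a1: "\<bar>a i\<bar> \<le> 1" if "i < d" for i
    using abs_le_L2_set[OF that, of a] lp_ball_L2[OF p a] by linarith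
  have "(\<Sum>b\<leftarrow>bs. \<bar>b\<bar>) \<le> (\<Sum>i\<leftarrow>is. h)"
    unfolding bs_def map_map comp_def
    using a1 is'(1) h by (intro sum_list_mono) (auto simp: abs_mult subset_iff)
  also have "\<dots> = h * real k" using is'(2) by (simp add: sum_list_triv mult.commute)
  finally have sb: "(\<Sum>b\<leftarrow>bs. \<bar>b\<bar>) \<le> \<tau>" using hk by linarith
  let ?D = "vdiff is h F c - h ^ k * (prod_list (map a is) * G k u)"
  have "\<bar>fdiff bs (G 0) u - prod_list bs * G k u\<bar> \<le> \<bar>prod_list bs\<bar> * ?\<omega>"
  proof (rule fdiff_approximates_derivative)
    show "\<bar>u\<bar> + (\<Sum>b\<leftarrow>bs. \<bar>b\<bar>) < 1" using u sb \<tau> by linarith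
    fix j v assume j: "j < length bs" and v: "\<bar>v\<bar> < (1::real)"
    have "(G j has_real_derivative G (Suc j) v) (at v within {-1..1})"
      unfolding G_def using j k is'(2) v by (intro Lip_ball_derivatives(1)[OF \<alpha> g]) (auto simp: bs_def)
    then show "(G j has_real_derivative G (Suc j) v) (at v)"
      using v by (subst (asm) at_within_interior) auto
  next
    fix v assume v: "\<bar>v - u\<bar> \<le> (\<Sum>b\<leftarrow>bs. \<bar>b\<bar>)"
    have "length bs = k" using is'(2) by (simp add: bs_def)
    then show "\<bar>G (length bs) v - G k u\<bar> \<le> ?\<omega>"
      unfolding G_def using k v sb u \<tau> by (simp only:) (intro derivative_oscillation_le[OF \<alpha> g], auto)
  qed
  moreover have "prod_list bs = h ^ k * prod_list (map a is)"
    unfolding bs_def prod_list_map_mult prod_list_map_const is'(2) ..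
  moreover have "vdiff is h F c = fdiff bs (G 0) u"
  proof -
    have "L2_set c {..<d} + h * real (length is) \<le> 1" using c(2) hk \<tau> is'(2) by simp
    then show ?thesis
      unfolding bs_def u_def G_def using F h is'(1) c(1) by (subst vdiff_ridge[where a = a and g = g]) auto
  qed
  ultimately have "\<bar>?D\<bar> \<le> h ^ k * (\<bar>prod_list (map a is)\<bar> * ?\<omega>)"
    using h by (simp add: abs_mult mult.assoc)
  then have "\<bar>?D\<bar> / h ^ k \<le> \<bar>prod_list (map a is)\<bar> * ?\<omega>"
    using h by (simp add: pos_divide_le_eq mult.commute)
  moreover have "\<bar>?D\<bar> / h ^ k
      = \<bar>?D / h ^ k\<bar>"
    using h by simp
  ultimately show ?thesis using h by (simp add: diff_divide_distrib G_def u_def)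
qed

text \<open>The first term is the Taylor remainder along the line, which has no factor that depends on \<open>d\<close>. The
  second one comes from the difference quotients. Its factor \<open>(2 * d) ^ s\<close> is harmless, since
  \<open>\<tau>\<close> can be chosen after \<open>d\<close>.\<close>

lemma taylor_op_error_le:
  assumes \<alpha>: "0 < \<alpha>" and p: "0 < p" "p \<le> 2" and d: "0 < d" and a: "lp_norm p d a \<le> 1"
    and g: "g \<in> Lip_space {-1..1} \<alpha>" "Lip_norm {-1..1} \<alpha> g \<le> 1"
    and F: "\<And>x. x \<in> unit_ball2 d \<Longrightarrow> F x = g (dotp d a x)"
    and c: "ct x \<in> vecs d" "L2_set (ct x) {..<d} \<le> 1 - \<eta>"
    and s: "s = lip_order \<alpha>" and h: "0 < h" "h * real s \<le> \<tau>" and \<tau>: "\<tau> < \<eta>" "\<tau> \<le> 1"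
    and x: "x \<in> unit_ball2 d" and E: "\<bar>dotp d a (\<lambda>i. x i - ct x i)\<bar> \<le> E"
  shows "\<bar>F x - taylor_op d s h ct F x\<bar>
    \<le> 2 * E powr \<alpha> + 2 * \<tau> powr (\<alpha> - real s) * ((real s + 1) * (2 * real d) ^ s)"
proof -
  define u where "u = dotp d a (ct x)"
  define v where "v i = x i - ct x i" for i
  define w where "w = dotp d a v"
  define G where "G k = deriv_within {-1..1} k g" for k
  define \<omega> where "\<omega> = 2 * \<tau> powr (\<alpha> - real s)"
  have \<omega>0: "0 \<le> \<omega>" by (simp add: \<omega>_def)
  have "0 \<le> h * real s" using h by simp
  then have \<tau>0: "0 \<le> \<tau>" using h by linarith
  have xw: "dotp d a x = u + w"
    unfolding u_def w_def v_def dotp_add_right[symmetric] by simp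
  have u1: "u \<in> {-1..1}" using dotp_in_interval[OF p a c(2)] \<tau> \<tau>0 by (auto simp: u_def abs_le_iff)
  have x1: "L2_set x {..<d} \<le> 1" using x by (simp add: unit_ball2_def)
  then have uw1: "u + w \<in> {-1..1}" using dotp_in_interval[OF p a x1] xw by (auto simp: abs_le_iff)
  have "\<bar>G 0 (u + w) - (\<Sum>k\<le>s. G k u * (u + w - u) ^ k / fact k)\<bar> \<le> 2 * \<bar>u + w - u\<bar> powr (\<alpha> - real s + real s)"
  proof (rule taylor_remainder_le)
    show "(G k has_real_derivative G (Suc k) y) (at y within {-1..1})" if "k < s" "y \<in> {-1..1}" for k y
      using Lip_ball_derivatives(1)[OF \<alpha> g] that unfolding G_def s by blast
    show "\<bar>G s y - G s u\<bar> \<le> 2 * \<bar>y - u\<bar> powr (\<alpha> - real s)" if "y \<in> {-1..1}" for y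
      using Lip_ball_derivatives(3)[OF \<alpha> g that u1] unfolding G_def s .
  qed (use u1 uw1 lip_order_bounds[OF \<alpha>] s in auto)
  also have "\<dots> \<le> 2 * E powr \<alpha>"
    using E \<alpha> by (simp add: w_def v_def[abs_def] powr_mono2)
  finally have taylor: "\<bar>F x - (\<Sum>k\<le>s. G k u * w ^ k / fact k)\<bar> \<le> 2 * E powr \<alpha>"
    by (simp add: F[OF x] xw G_def)
  have v2: "\<bar>v i\<bar> \<le> 2" if "i < d" for i
  proof -
    have "\<bar>x i\<bar> \<le> 1" "\<bar>ct x i\<bar> \<le> 1"
      using abs_le_L2_set[OF that, of x] abs_le_L2_set[OF that, of "ct x"] x1 c(2) \<tau> \<tau>0 by linarith+
    then show ?thesis by (simp add: v_def)
  qed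
  have a1: "\<bar>a i\<bar> \<le> 1" if "i < d" for i
    using abs_le_L2_set[OF that, of a] lp_ball_L2[OF p a] by linarith
  let ?S = "\<lambda>k. \<Sum>is\<in>index_lists d k. vdiff is h F (ct x) / h ^ k * prod_list (map v is)"
  have term_le: "\<bar>?S k / fact k
      - G k u * w ^ k / fact k\<bar> \<le> \<omega> * (2 * real d) ^ s" if k: "k \<le> s" for k
  proof -
    have wk: "w ^ k = (\<Sum>is\<in>index_lists d k. prod_list (map a is) * prod_list (map v is))"
      unfolding w_def dotp_def sum_prod_index_lists[symmetric] prod_list_map_mult ..
    have "\<bar>?S k - G k u * w ^ k\<bar>
        = \<bar>\<Sum>is\<in>index_lists d k. (vdiff is h F (ct x) / h ^ k - prod_list (map a is) * G k u) * prod_list (map v is)\<bar>"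
      unfolding wk sum_distrib_left sum_subtractf[symmetric]
      by (intro arg_cong[where f = abs] sum.cong refl) (simp only: left_diff_distrib right_diff_distrib mult_ac)
    also have "\<dots> \<le> (\<Sum>is\<in>index_lists d k. \<bar>prod_list (map a is)\<bar> * \<omega> * \<bar>prod_list (map v is)\<bar>)"
    proof (rule order_trans[OF sum_abs sum_mono])
      fix "is" assume "is": "is \<in> index_lists d k"
      show "\<bar>(vdiff is h F (ct x) / h ^ k - prod_list (map a is) * G k u) * prod_list (map v is)\<bar>
          \<le> \<bar>prod_list (map a is)\<bar> * \<omega> * \<bar>prod_list (map v is)\<bar>"
        unfolding abs_mult G_def u_def \<omega>_def s
        using vdiff_ridge_approximates[OF \<alpha> p a g F c h(1) h(2)[unfolded s] \<tau> "is" k[unfolded s]]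
        by (intro mult_right_mono) (simp_all only: abs_mult abs_ge_zero)
    qed
    also have "\<dots> = \<omega> * (\<Sum>is\<in>index_lists d k. prod_list (map (\<lambda>i. \<bar>a i\<bar> * \<bar>v i\<bar>) is))"
      unfolding prod_list_map_mult abs_prod_list_map sum_distrib_left by (simp add: mult_ac)
    also have "\<dots> = \<omega> * (\<Sum>i<d. \<bar>a i\<bar> * \<bar>v i\<bar>) ^ k" by (simp only: sum_prod_index_lists)
    also have "\<dots> \<le> \<omega> * (2 * real d) ^ k"
    proof (intro mult_left_mono power_mono)
      have "(\<Sum>i<d. \<bar>a i\<bar> * \<bar>v i\<bar>) \<le> (\<Sum>i<d. 1 * 2)"
        using a1 v2 by (intro sum_mono mult_mono) auto
      then show "(\<Sum>i<d. \<bar>a i\<bar> * \<bar>v i\<bar>) \<le> 2 * real d" by simp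
    qed (auto simp: \<omega>0 intro: sum_nonneg)
    also have "\<dots> \<le> \<omega> * (2 * real d) ^ s"
      using d k \<omega>0 by (intro mult_left_mono power_increasing) auto
    finally have main: "\<bar>?S k - G k u * w ^ k\<bar>
        \<le> \<omega> * (2 * real d) ^ s" .
    have "\<bar>?S k / fact k - G k u * w ^ k / fact k\<bar>
        = \<bar>?S k - G k u * w ^ k\<bar> / fact k"
      by (simp add: diff_divide_distrib[symmetric])
    also have "\<dots> \<le> \<bar>?S k - G k u * w ^ k\<bar> / 1"
      by (intro divide_left_mono) (auto simp: fact_ge_1)
    finally show ?thesis using main by simp
  qed
  have "\<bar>(\<Sum>k\<le>s. G k u * w ^ k / fact k) - taylor_op d s h ct F x\<bar> \<le> (\<Sum>k\<le>s. \<omega> * (2 * real d) ^ s)"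
    unfolding taylor_op_def sum_subtractf[symmetric]
    by (rule order_trans[OF sum_abs sum_mono])
      (use term_le in \<open>simp add: v_def[abs_def] abs_minus_commute\<close>)
  also have "\<dots> = \<omega> * ((real s + 1) * (2 * real d) ^ s)" by (simp add: algebra_simps)
  finally show ?thesis using taylor unfolding \<omega>_def by linarith
qed

section \<open>Centres on a cubic grid\<close>

text \<open>Rounding towards zero, unlike rounding to the nearest integer, never increases the absolute value, so
  it maps the ball into itself.\<close>

definition round_to_zero :: "real \<Rightarrow> int" where
  "round_to_zero t = (if 0 \<le> t then \<lfloor>t\<rfloor> else \<lceil>t\<rceil>)"

lemma round_to_zero_bounds:
  "\<bar>real_of_int (round_to_zero t)\<bar> \<le> \<bar>t\<bar>"
  "\<bar>t - real_of_int (round_to_zero t)\<bar> \<le> \<bar>t\<bar>"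
  "\<bar>t - real_of_int (round_to_zero t)\<bar> \<le> 1"
proof -
  have "\<bar>real_of_int (round_to_zero t)\<bar> \<le> \<bar>t\<bar> \<and> \<bar>t - real_of_int (round_to_zero t)\<bar> \<le> \<bar>t\<bar> \<and>
      \<bar>t - real_of_int (round_to_zero t)\<bar> \<le> 1"
  proof (cases "0 \<le> t")
    case True
    then have "0 \<le> real_of_int \<lfloor>t\<rfloor>" by simp
    moreover have "real_of_int \<lfloor>t\<rfloor> \<le> t" "t - real_of_int \<lfloor>t\<rfloor> \<le> 1" by linarith+
    ultimately show ?thesis using True by (simp add: round_to_zero_def)
  next
    case False
    then have "real_of_int \<lceil>t\<rceil> \<le> 0" by simp
    moreover have "t \<le> real_of_int \<lceil>t\<rceil>" "real_of_int \<lceil>t\<rceil> - t \<le> 1" by linarith+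
    ultimately show ?thesis using False by (simp add: round_to_zero_def)
  qed
  then show "\<bar>real_of_int (round_to_zero t)\<bar> \<le> \<bar>t\<bar>"
    "\<bar>t - real_of_int (round_to_zero t)\<bar> \<le> \<bar>t\<bar>"
    "\<bar>t - real_of_int (round_to_zero t)\<bar> \<le> 1" by blast+
qed

definition grid_point :: "nat \<Rightarrow> real \<Rightarrow> (nat \<Rightarrow> real) \<Rightarrow> nat \<Rightarrow> int" where
  "grid_point d \<epsilon> x = (\<lambda>i\<in>{..<d}. round_to_zero (x i / \<epsilon>))"

definition grid_ball :: "nat \<Rightarrow> real \<Rightarrow> (nat \<Rightarrow> int) set" where
  "grid_ball d R = {z \<in> {..<d} \<rightarrow>\<^sub>E UNIV. (\<Sum>i<d. (real_of_int (z i))\<^sup>2) \<le> R}"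

lemma finite_grid_ball: "finite (grid_ball d R)"
  and grid_ball_subset: "grid_ball d R \<subseteq> int_vecs d R"
proof -
  show "grid_ball d R \<subseteq> int_vecs d R"
  proof
    fix z assume z: "z \<in> grid_ball d R"
    have "(\<Sum>i<d. \<bar>real_of_int (z i)\<bar>) \<le> (\<Sum>i<d. (real_of_int (z i))\<^sup>2)"
      by (intro sum_mono abs_of_int_le_square)
    then show "z \<in> int_vecs d R" using z by (auto simp: grid_ball_def int_vecs_def)
  qed
  then show "finite (grid_ball d R)" using finite_int_vecs by (rule finite_subset)
qed

lemma grid_point_in_grid_ball:
  assumes e: "0 < \<epsilon>" and x: "x \<in> unit_ball2 d"
  shows "grid_point d \<epsilon> x \<in> grid_ball d (1 / \<epsilon>\<^sup>2)"
proof -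
  have "(\<Sum>i<d. (real_of_int (grid_point d \<epsilon> x i))\<^sup>2) \<le> (\<Sum>i<d. (x i / \<epsilon>)\<^sup>2)"
  proof (rule sum_mono)
    fix i assume "i \<in> {..<d}"
    then show "(real_of_int (grid_point d \<epsilon> x i))\<^sup>2 \<le> (x i / \<epsilon>)\<^sup>2"
      using abs_le_square_iff[THEN iffD1, OF round_to_zero_bounds(1)] by (simp add: grid_point_def)
  qed
  also have "\<dots> = (L2_set x {..<d})\<^sup>2 / \<epsilon>\<^sup>2"
    by (simp add: L2_set_def sum_nonneg power_divide sum_divide_distrib)
  also have "\<dots> \<le> 1 / \<epsilon>\<^sup>2"
    using x by (intro divide_right_mono power_le_one) (auto simp: unit_ball2_def)
  finally show ?thesis
    by (auto simp: grid_ball_def grid_point_def restrict_PiE_iff)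
qed

text \<open>Only finitely many grid points occur. Hence every function of the grid point of \<open>x\<close>, however
  irregular, depends measurably on \<open>x\<close>.\<close>

lemma grid_point_measurable:
  assumes "0 < \<epsilon>"
  shows "grid_point d \<epsilon> \<in> ball_measure d \<rightarrow>\<^sub>M count_space (grid_ball d (1 / \<epsilon>\<^sup>2))"
proof -
  have comp: "(\<lambda>x. round_to_zero (x i / \<epsilon>)) \<in> ball_measure d \<rightarrow>\<^sub>M count_space UNIV" if "i < d" for i
    using measurable_component_ball_measure[OF that] unfolding round_to_zero_def by measurable
  have "{x \<in> space (ball_measure d). grid_point d \<epsilon> x = z} \<in> sets (ball_measure d)"
    if z: "z \<in> grid_ball d (1 / \<epsilon>\<^sup>2)" for z
  proof -
    have "{x \<in> space (ball_measure d). grid_point d \<epsilon> x = z}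
        = {x \<in> space (ball_measure d). \<forall>i\<in>{..<d}. round_to_zero (x i / \<epsilon>) = z i}"
      using z by (auto simp: grid_point_def grid_ball_def PiE_iff extensional_def fun_eq_iff)
    also have "\<dots> \<in> sets (ball_measure d)"
    proof (rule sets.sets_Collect_finite_All)
      fix i assume "i \<in> {..<d}"
      then show "{x \<in> space (ball_measure d). round_to_zero (x i / \<epsilon>) = z i} \<in> sets (ball_measure d)"
        using measurable_sets[OF comp, of i "{z i}"] by (simp add: vimage_def Int_def conj_commute)
    qed auto
    finally show ?thesis .
  qed
  then show ?thesis
    using grid_point_in_grid_ball[OF assms]
    by (subst measurable_count_space_eq2[OF finite_grid_ball])
      (auto simp: space_ball_measure vimage_def Int_def conj_commute)
qed

text \<open>The scaling \<open>t\<close> is taken slightly smaller than the mesh, which moves the centres into the interior of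
  the ball and makes room for the nodes.\<close>

definition grid_center :: "nat \<Rightarrow> real \<Rightarrow> (nat \<Rightarrow> int) \<Rightarrow> nat \<Rightarrow> real" where
  "grid_center d t z = (\<lambda>i\<in>{..<d}. t * real_of_int (z i))"

lemma taylor_op_grid_measurable:
  fixes d :: nat and t \<epsilon> :: real
  assumes e: "0 < \<epsilon>"
  defines "ct \<equiv> \<lambda>x. grid_center d t (grid_point d \<epsilon> x)"
  shows "taylor_op d s h ct F \<in> borel_measurable (ball_measure d)"
proof -
  have Q: "(\<lambda>x. Q (ct x)) \<in> borel_measurable (ball_measure d)" for Q :: "(nat \<Rightarrow> real) \<Rightarrow> real"
    unfolding ct_def
    by (rule measurable_compose[OF grid_point_measurable[OF e], of "\<lambda>z. Q (grid_center d t z)"]) simp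
  have prod: "(\<lambda>x. prod_list (map (\<lambda>i. x i - ct x i) is)) \<in> borel_measurable (ball_measure d)"
    if "set is \<subseteq> {..<d}" for "is"
    using that
  proof (induction "is")
    case (Cons i "is")
    have "(\<lambda>x. x i - ct x i) \<in> borel_measurable (ball_measure d)"
      using Cons.prems measurable_component_ball_measure[of i d] Q[of "\<lambda>c. c i"]
      by (intro borel_measurable_diff) auto
    then show ?case using Cons by (auto intro!: borel_measurable_times)
  qed simp
  show ?thesis
    unfolding taylor_op_def
    by (intro borel_measurable_sum borel_measurable_divide borel_measurable_times borel_measurable_const
        Q[of "\<lambda>c. vdiff _ h F c"] prod) (auto simp: index_lists_def)
qed

text \<open>The differences take finitely many values, and the coordinates of \<open>x - ct x\<close> are at most \<open>2\<close>.\<close>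

lemma taylor_op_grid_bounded:
  fixes d :: nat and t \<epsilon> :: real
  assumes e: "0 < \<epsilon>" and t: "0 \<le> t" "t \<le> \<epsilon>"
  defines "ct \<equiv> \<lambda>x. grid_center d t (grid_point d \<epsilon> x)"
  shows "\<exists>K. \<forall>x\<in>unit_ball2 d. \<bar>taylor_op d s h ct F x\<bar> \<le> K"
proof -
  define Z where "Z = grid_ball d (1 / \<epsilon>\<^sup>2)"
  define V where "V is = (\<Sum>z\<in>Z. \<bar>vdiff is h F (grid_center d t z)\<bar>)" for "is"
  have v: "\<bar>x i - ct x i\<bar> \<le> 2" if x: "x \<in> unit_ball2 d" and i: "i < d" for x i
  proof -
    have x1: "\<bar>x i\<bar> \<le> 1" using abs_le_L2_set[OF i, of x] x by (simp add: unit_ball2_def)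
    have "\<bar>ct x i\<bar> = t * \<bar>real_of_int (round_to_zero (x i / \<epsilon>))\<bar>"
      using i t by (simp add: ct_def grid_center_def grid_point_def abs_mult)
    also have "\<dots> \<le> \<epsilon> * \<bar>x i / \<epsilon>\<bar>"
      using t e round_to_zero_bounds(1)[of "x i / \<epsilon>"] by (intro mult_mono) auto
    also have "\<dots> = \<bar>x i\<bar>" using e by (simp add: abs_divide)
    finally show ?thesis using x1 by linarith
  qed
  have prod: "\<bar>prod_list (map (\<lambda>i. x i - ct x i) is)\<bar> \<le> 2 ^ length is"
    if x: "x \<in> unit_ball2 d" and "set is \<subseteq> {..<d}" for x "is"
    using that(2)
  proof (induction "is")
    case (Cons i "is")
    then have "\<bar>x i - ct x i\<bar> * \<bar>prod_list (map (\<lambda>i. x i - ct x i) is)\<bar> \<le> 2 * 2 ^ length is"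
      using v[OF x] by (intro mult_mono) auto
    then show ?case by (simp add: abs_mult)
  qed simp
  have "\<bar>taylor_op d s h ct F x\<bar>
      \<le> (\<Sum>k\<le>s. (\<Sum>is\<in>index_lists d k. V is / \<bar>h ^ k\<bar> * 2 ^ k) / fact k)" if x: "x \<in> unit_ball2 d" for x
    unfolding taylor_op_def
  proof (intro order_trans[OF sum_abs sum_mono])
    fix k
    let ?S = "\<Sum>is\<in>index_lists d k. vdiff is h F (ct x) / h ^ k * prod_list (map (\<lambda>i. x i - ct x i) is)"
    let ?B = "\<Sum>is\<in>index_lists d k. V is / \<bar>h ^ k\<bar> * 2 ^ k"
    have "\<bar>?S\<bar>
        \<le> ?B"
    proof (intro order_trans[OF sum_abs sum_mono])
      fix "is" assume "is": "is \<in> index_lists d k"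
      have "\<bar>vdiff is h F (ct x)\<bar> \<le> V is"
        unfolding V_def ct_def using grid_point_in_grid_ball[OF e x] finite_grid_ball
        by (intro member_le_sum[where f = "\<lambda>z. \<bar>vdiff is h F (grid_center d t z)\<bar>"]) (auto simp: Z_def)
      moreover have "\<bar>prod_list (map (\<lambda>i. x i - ct x i) is)\<bar> \<le> 2 ^ k"
        using prod[OF x, of "is"] "is" by (auto simp: index_lists_def)
      ultimately show "\<bar>vdiff is h F (ct x) / h ^ k * prod_list (map (\<lambda>i. x i - ct x i) is)\<bar>
          \<le> V is / \<bar>h ^ k\<bar> * 2 ^ k"
        unfolding abs_mult abs_divide by (intro mult_mono divide_right_mono) (auto simp: V_def intro!: sum_nonneg divide_nonneg_nonneg)
    qed
    then show "\<bar>?S / fact k\<bar>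
        \<le> ?B / fact k"
      by (simp add: divide_right_mono)
  qed
  then show ?thesis by blast
qed

lemma L2_set_grid_center_le:
  assumes e: "0 < \<epsilon>" and t: "0 \<le> t" and z: "z \<in> grid_ball d (1 / \<epsilon>\<^sup>2)"
  shows "L2_set (grid_center d t z) {..<d} \<le> t / \<epsilon>"
proof -
  have "L2_set (grid_center d t z) {..<d} = L2_set (\<lambda>i. t * real_of_int (z i)) {..<d}"
    by (simp add: grid_center_def cong: L2_set_cong_simp)
  also have "\<dots> = t * L2_set (\<lambda>i. real_of_int (z i)) {..<d}"
    using t by (simp add: L2_set_right_distrib)
  also have "L2_set (\<lambda>i. real_of_int (z i)) {..<d} \<le> sqrt (1 / \<epsilon>\<^sup>2)"
    using z unfolding L2_set_def by (intro real_sqrt_le_mono) (simp add: grid_ball_def)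
  also have "\<dots> = 1 / \<epsilon>" using e by (simp add: real_sqrt_divide)
  finally show ?thesis using t by (simp add: mult_left_mono)
qed

lemma node_in_unit_ball2:
  assumes "0 \<le> h" "L2_set c {..<d} + h * real s \<le> 1" "(\<Sum>i<d. \<beta> i) \<le> s"
  shows "node d c h \<beta> \<in> unit_ball2 d"
proof -
  have "L2_set (node d c h \<beta>) {..<d} = L2_set (\<lambda>i. c i + h * real (\<beta> i)) {..<d}"
    by (simp add: node_def cong: L2_set_cong_simp)
  also have "\<dots> \<le> L2_set c {..<d} + L2_set (\<lambda>i. h * real (\<beta> i)) {..<d}" by (rule L2_set_triangle_ineq)
  also have "L2_set (\<lambda>i. h * real (\<beta> i)) {..<d} \<le> (\<Sum>i<d. h * real (\<beta> i))"
    using assms(1) by (intro L2_set_le_sum) auto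
  also have "\<dots> = h * real (\<Sum>i<d. \<beta> i)" by (simp add: sum_distrib_left)
  also have "\<dots> \<le> h * real s" using assms by (intro mult_left_mono) (simp_all only: of_nat_le_iff)
  finally have "L2_set (node d c h \<beta>) {..<d} \<le> 1" using assms(2) by linarith
  moreover have "node d c h \<beta> \<in> vecs d" by (simp add: vecs_def node_def restrict_PiE_iff)
  ultimately show ?thesis by (simp add: unit_ball2_def)
qed

lemma small_step_exists:
  fixes \<delta> K \<beta> \<eta> :: real
  assumes "0 < \<delta>" "0 < K" "0 < \<beta>" "0 < \<eta>"
  shows "\<exists>\<tau>>0. \<tau> < \<eta> \<and> 2 * \<tau> powr \<beta> * K \<le> \<delta>"
proof -
  define \<tau> where "\<tau> = min (\<eta> / 2) ((\<delta> / (2 * K)) powr (1 / \<beta>))"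
  have \<tau>: "0 < \<tau>" "\<tau> < \<eta>" using assms by (auto simp: \<tau>_def)
  have "\<tau> powr \<beta> \<le> ((\<delta> / (2 * K)) powr (1 / \<beta>)) powr \<beta>"
    using assms \<tau> by (intro powr_mono2) (auto simp: \<tau>_def)
  also have "\<dots> = \<delta> / (2 * K)" using assms by (simp add: powr_powr)
  finally have "2 * \<tau> powr \<beta> * K \<le> \<delta>" using assms by (simp add: field_simps)
  then show ?thesis using \<tau> by blast
qed

text \<open>This separates the approximation from the geometry: a grid of mesh \<open>\<epsilon>\<close> that has few points in the ball
  and for which the remainders of rounding are nearly orthogonal to all directions \<open>a\<close> yields a good
  algorithm, with a constant that depends on neither \<open>d\<close> nor \<open>n\<close>.\<close>

lemma g_lin_ridge_le_grid:
  assumes \<alpha>: "0 < \<alpha>" and p: "0 < p" "p \<le> 2" and d: "0 < d" and e: "0 < \<epsilon>" and E: "0 < E"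
    and s: "s = lip_order \<alpha>"
    and geo: "\<And>a v. lp_norm p d a \<le> 1 \<Longrightarrow> (\<And>i. i < d \<Longrightarrow> \<bar>v i\<bar> \<le> \<epsilon>) \<Longrightarrow> (\<Sum>i<d. (v i)\<^sup>2) \<le> 1 \<Longrightarrow>
      \<bar>dotp d a v\<bar> \<le> E"
    and count: "card (grid_ball d (1 / \<epsilon>\<^sup>2)) * ((d + s) choose s) \<le> n"
  shows "g_lin n d (ridge_class d \<alpha> p) \<le> ereal (3 * (2 * E) powr \<alpha>)"
proof -
  define \<beta> where "\<beta> = \<alpha> - real s"
  have \<beta>: "0 < \<beta>" using lip_order_bounds[OF \<alpha>] by (simp add: \<beta>_def s)
  \<comment> \<open>shrinking the centres by \<open>1 - \<eta>\<close> changes \<open>a \<cdot> (x - c)\<close> by at most \<open>\<eta>\<close>, which \<open>E\<close> absorbs\<close>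
  define \<eta> where "\<eta> = min E (1 / 2)"
  have \<eta>: "0 < \<eta>" "\<eta> \<le> E" "\<eta> \<le> 1 / 2" using E by (auto simp: \<eta>_def)
  define K where "K = (real s + 1) * (2 * real d) ^ s"
  have K: "0 < K" using d by (simp add: K_def)
  obtain \<tau> where \<tau>: "0 < \<tau>" "\<tau> < \<eta>" "2 * \<tau> powr \<beta> * K \<le> (2 * E) powr \<alpha>"
    using small_step_exists[of "(2 * E) powr \<alpha>" K \<beta> \<eta>] K \<beta> \<eta> E by auto
  define h where "h = \<tau> / (real s + 1)"
  have h: "0 < h" using \<tau> by (simp add: h_def)
  have "h * real s \<le> h * (real s + 1)" using h by (intro mult_left_mono) auto
  also have "\<dots> = \<tau>" by (simp add: h_def)
  finally have hs: "h * real s \<le> \<tau>" .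
  define t where "t = (1 - \<eta>) * \<epsilon>"
  have t: "0 \<le> t" "t \<le> \<epsilon>" "t / \<epsilon> = 1 - \<eta>" using \<eta> e by (auto simp: t_def mult_le_cancel_right1)
  define Z where "Z = grid_ball d (1 / \<epsilon>\<^sup>2)"
  define ct where "ct x = grid_center d t (grid_point d \<epsilon> x)" for x
  define C where "C = grid_center d t ` Z"
  have finC: "finite C" unfolding C_def Z_def using finite_grid_ball by (intro finite_imageI)
  have Cv: "c \<in> vecs d" "L2_set c {..<d} \<le> 1 - \<eta>" if c: "c \<in> C" for c
  proof -
    obtain z where z: "z \<in> Z" "c = grid_center d t z" using c unfolding C_def by blast
    show "c \<in> vecs d" unfolding z(2) by (simp add: grid_center_def vecs_def restrict_PiE_iff)
    show "L2_set c {..<d} \<le> 1 - \<eta>"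
      using L2_set_grid_center_le[OF e t(1), of z d] z t(3) by (simp add: Z_def)
  qed
  have ctC: "ct x \<in> C" if "x \<in> unit_ball2 d" for x
    unfolding ct_def C_def Z_def using grid_point_in_grid_ball[OF e that] by blast
  define P where "P = {node d c h \<beta> | c \<beta>. c \<in> C \<and> (\<Sum>i<d. \<beta> i) \<le> s}"
  show ?thesis
  proof (rule g_lin_le_of_operator[where T = "taylor_op d s h ct" and P = P])
    show "finite P" unfolding P_def by (rule card_nodes_le(1)[OF finC])
    have "card P \<le> card C * ((d + s) choose s)" unfolding P_def by (rule card_nodes_le(2)[OF finC])
    also have "\<dots> \<le> card Z * ((d + s) choose s)"
      unfolding C_def Z_def using card_image_le[OF finite_grid_ball] by (intro mult_right_mono) auto
    also have "\<dots> \<le> n" using count by (simp add: Z_def)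
    finally show "card P \<le> n" .
    show "P \<subseteq> unit_ball2 d"
    proof
      fix z assume "z \<in> P"
      then obtain c \<beta> where z: "z = node d c h \<beta>" "c \<in> C" "(\<Sum>i<d. \<beta> i) \<le> s" unfolding P_def by blast
      show "z \<in> unit_ball2 d"
        unfolding z(1) using Cv(2)[OF z(2)] h hs \<tau> z(3) by (intro node_in_unit_ball2[where s = s]) auto
    qed
    have zero: "(\<lambda>i\<in>{..<d}. 0) \<in> unit_ball2 d"
      by (auto simp: unit_ball2_def vecs_def L2_set_def)
    have "node d (ct (\<lambda>i\<in>{..<d}. 0)) h (\<lambda>i. 0) \<in> P"
      unfolding P_def using ctC[OF zero] by force
    then show "P \<noteq> {}" by blast
    show "taylor_op d s h ct (\<lambda>z. b * F z + c * F' z) x = b * taylor_op d s h ct F x + c * taylor_op d s h ct F' x"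
      for F F' b c x by (rule taylor_op_linear)
    show "taylor_op d s h ct F x = taylor_op d s h ct F' x"
      if eq: "\<And>z. z \<in> P \<Longrightarrow> F z = F' z" and x: "x \<in> unit_ball2 d" for F F' x
    proof -
      have "vdiff is h F (ct x) = vdiff is h F' (ct x)" if k: "k \<le> s" and "is": "is \<in> index_lists d k" for k "is"
      proof (rule vdiff_cong)
        show "ct x \<in> vecs d" by (rule Cv(1)[OF ctC[OF x]])
        show "set is \<subseteq> {..<d}" using "is" by (simp add: index_lists_def)
        fix \<beta> :: "nat \<Rightarrow> nat" assume "(\<Sum>i<d. \<beta> i) \<le> length is"
        then have "(\<Sum>i<d. \<beta> i) \<le> s" using k "is" by (simp add: index_lists_def)
        then show "F (node d (ct x) h \<beta>) = F' (node d (ct x) h \<beta>)"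
          using ctC[OF x] by (intro eq) (auto simp: P_def)
      qed
      then show ?thesis unfolding taylor_op_def by (intro sum.cong refl arg_cong2[where f = "(/)"]) auto
    qed
    show "taylor_op d s h ct F \<in> borel_measurable (ball_measure d)" for F
      unfolding ct_def by (rule taylor_op_grid_measurable[OF e])
    show "\<exists>K. \<forall>x\<in>unit_ball2 d. \<bar>taylor_op d s h ct F x\<bar> \<le> K" for F
      unfolding ct_def by (rule taylor_op_grid_bounded[OF e t(1,2)])
    show "f \<in> borel_measurable (ball_measure d)" if "f \<in> ridge_class d \<alpha> p" for f
      by (rule ridge_function_measurable[OF \<alpha> p that])
    fix f x assume f: "f \<in> ridge_class d \<alpha> p" and x: "x \<in> unit_ball2 d"
    obtain g a where f_eq: "f = restrict (\<lambda>x. g (dotp d a x)) (unit_ball2 d)"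
      and g: "g \<in> Lip_space {-1..1} \<alpha>" "Lip_norm {-1..1} \<alpha> g \<le> 1" and a: "lp_norm p d a \<le> 1"
      using f unfolding ridge_class_def by blast
    define r where "r i = \<epsilon> * real_of_int (grid_point d \<epsilon> x i)" for i
    have coord: "r i = \<epsilon> * real_of_int (round_to_zero (x i / \<epsilon>))" if "i < d" for i
      using that by (simp add: r_def grid_point_def)
    have xr: "x i - r i = \<epsilon> * (x i / \<epsilon> - real_of_int (round_to_zero (x i / \<epsilon>)))" if "i < d" for i
      using that e by (simp add: coord right_diff_distrib)
    have x1: "(\<Sum>i<d. (x i)\<^sup>2) \<le> 1" using x by (simp add: unit_ball2_def L2_set_def)
    have le1: "\<bar>x i - r i\<bar> \<le> \<epsilon>" if "i < d" for i
      using mult_left_mono[OF round_to_zero_bounds(3)[of "x i / \<epsilon>"], of \<epsilon>] e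
      unfolding xr[OF that] by (simp add: abs_mult)
    have le2: "\<bar>x i - r i\<bar> \<le> \<bar>x i\<bar>" if "i < d" for i
    proof -
      have "\<bar>x i - r i\<bar> \<le> \<epsilon> * \<bar>x i / \<epsilon>\<bar>"
        using mult_left_mono[OF round_to_zero_bounds(2)[of "x i / \<epsilon>"], of \<epsilon>] e
        unfolding xr[OF that] by (simp add: abs_mult)
      also have "\<dots> = \<bar>x i\<bar>" using e by (simp add: abs_divide)
      finally show ?thesis .
    qed
    have "(\<Sum>i<d. (x i - r i)\<^sup>2) \<le> (\<Sum>i<d. (x i)\<^sup>2)"
      using le2 by (intro sum_mono) (auto simp: abs_le_square_iff[symmetric])
    then have "(\<Sum>i<d. (x i - r i)\<^sup>2) \<le> 1" using x1 by linarith
    then have far: "\<bar>dotp d a (\<lambda>i. x i - r i)\<bar> \<le> E" using le1 by (intro geo[OF a]) auto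
    have "L2_set r {..<d} = L2_set (grid_center d \<epsilon> (grid_point d \<epsilon> x)) {..<d}"
      by (simp add: r_def grid_center_def cong: L2_set_cong_simp)
    also have "\<dots> \<le> \<epsilon> / \<epsilon>"
      using e by (intro L2_set_grid_center_le grid_point_in_grid_ball x) auto
    finally have "L2_set r {..<d} \<le> 1" using e by simp
    then have "\<bar>dotp d a r\<bar> \<le> 1" by (rule dotp_in_interval[OF p a])
    then have "\<eta> * \<bar>dotp d a r\<bar> \<le> \<eta> * 1" using \<eta> by (intro mult_left_mono) auto
    then have "\<eta> * \<bar>dotp d a r\<bar> \<le> E" using \<eta>(2) by linarith
    then have shrink: "\<bar>\<eta> * dotp d a r\<bar> \<le> E" using \<eta>(1) by (simp add: abs_mult)
    have "dotp d a (\<lambda>i. x i - ct x i) = dotp d a (\<lambda>i. (x i - r i) + \<eta> * r i)"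
      unfolding dotp_def
      by (intro sum.cong) (auto simp: ct_def grid_center_def r_def t_def algebra_simps)
    also have "\<dots> = dotp d a (\<lambda>i. x i - r i) + \<eta> * dotp d a r"
      by (simp only: dotp_add_right dotp_scale_right)
    finally have dist: "\<bar>dotp d a (\<lambda>i. x i - ct x i)\<bar> \<le> 2 * E" using far shrink by linarith
    have "\<bar>f x - taylor_op d s h ct f x\<bar>
        \<le> 2 * (2 * E) powr \<alpha> + 2 * \<tau> powr (\<alpha> - real s) * ((real s + 1) * (2 * real d) ^ s)"
    proof (rule taylor_op_error_le[OF \<alpha> p d a g])
      show "f x = g (dotp d a x)" if "x \<in> unit_ball2 d" for x using that by (simp add: f_eq)
    qed (use Cv[OF ctC[OF x]] s h hs \<tau> \<eta> x dist in auto)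
    also have "\<dots> \<le> 3 * (2 * E) powr \<alpha>" using \<tau>(3) by (simp add: \<beta>_def K_def)
    finally show "\<bar>f x - taylor_op d s h ct f x\<bar> \<le> 3 * (2 * E) powr \<alpha>" .
  qed
qed

section \<open>The rates of the linear upper bound\<close>

lemma sum_abs_le_sqrt_sum_squares:
  fixes d :: nat
  shows
  "(\<Sum>i<d. \<bar>real_of_int (z i)\<bar>) \<le> sqrt d * sqrt (\<Sum>i<d. (real_of_int (z i))\<^sup>2)"
  using L2_set_mult_ineq[of "\<lambda>_. 1" "\<lambda>i. real_of_int (z i)" "{..<d}"] by (simp add: L2_set_def)

text \<open>Here the squared radius \<open>M\<close> is smaller than \<open>d\<close>, and most coordinates of a grid point vanish. With
  \<open>y = d / k\<close>, the logarithm of the bound from \<open>card_int_vecs_le\<close> is at most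
  \<open>M * log 2 (1 + d / M) + 4 * M\<close>, and the first logarithm is at most \<open>5 + 2 * log 2 (1 + y)\<close>.\<close>

lemma card_grid_ball_le_exp:
  assumes d: "0 < d" and k: "0 < k" "k \<le> real d"
  shows "real (card (grid_ball d (k / (16 * log 2 (1 + d / k))))) \<le> 2 powr k"
proof -
  define y where "y = d / k"
  define lg where "lg = log 2 (1 + y)"
  define M where "M = k / (16 * lg)"
  have y1: "1 \<le> y" using k by (simp add: y_def)
  have lg1: "1 \<le> lg" unfolding lg_def using y1 by (subst le_log_iff) auto
  have lgy: "lg \<le> 2 * y" unfolding lg_def using y1 by (intro log2_one_plus_le) auto
  have M: "0 < M" using k lg1 by (simp add: M_def)
  have Mlg: "16 * (M * lg) = k" using lg1 by (simp add: M_def)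
  have "d / M = 16 * (y * lg)" using k lg1 by (simp add: M_def y_def)
  also have "\<dots> \<le> 16 * (y * (2 * y))" using lgy y1 by (intro mult_left_mono) auto
  finally have "1 + d / M \<le> 32 * (1 + y)\<^sup>2" using y1 by (simp add: power2_eq_square algebra_simps)
  also have "\<dots> = 2 powr 5 * (2 powr lg)\<^sup>2" using y1 by (simp add: lg_def)
  also have "\<dots> = 2 powr (5 + 2 * lg)" 
    by (simp only: power2_eq_square powr_add[symmetric]) simp
  finally have "(1 + d / M) powr M \<le> (2 powr (5 + 2 * lg)) powr M"
    using M by (intro powr_mono2) auto
  then have 1: "(1 + d / M) powr M \<le> 2 powr ((5 + 2 * lg) * M)" by (simp only: powr_powr)
  have "(1 + 2 * M / d) ^ d \<le> exp (2 * M)"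
    using d M by (intro exp_ge_one_plus_x_over_n_power_n) auto
  also have "\<dots> = (exp 1 * exp 1) powr M" by (simp add: powr_def flip: exp_add)
  also have "\<dots> \<le> (3 * 3) powr M" using exp_le M by (intro powr_mono2 mult_mono) auto
  also have "\<dots> \<le> (2 powr 4) powr M" using M by (intro powr_mono2) auto
  finally have 2: "(1 + 2 * M / d) ^ d \<le> 2 powr (4 * M)" by (simp only: powr_powr)
  have "card (grid_ball d M) \<le> card (int_vecs d M)"
    by (rule card_mono[OF finite_int_vecs grid_ball_subset])
  then have "real (card (grid_ball d M)) \<le> real (card (int_vecs d M))" by (simp only: of_nat_le_iff)
  also have "\<dots> \<le> (1 + d / M) powr M * (1 + 2 * M / d) ^ d" by (rule card_int_vecs_le[OF M d])
  also have "\<dots> \<le> 2 powr ((5 + 2 * lg) * M) * 2 powr (4 * M)" using M by (intro mult_mono 1 2) auto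
  also have "\<dots> = 2 powr (9 * M + 2 * (M * lg))" by (simp add: algebra_simps flip: powr_add)
  also have "\<dots> \<le> 2 powr k"
  proof (rule powr_mono)
    have "M * 1 \<le> M * lg" using M lg1 by (intro mult_left_mono) auto
    then show "9 * M + 2 * (M * lg) \<le> k" using Mlg M lg1 by linarith
  qed simp
  finally show ?thesis unfolding M_def lg_def y_def .
qed

text \<open>For large radii the \<open>\<ell>\<^sub>1\<close> norm is bounded with the Cauchy--Schwarz inequality, which is sharp up to a
  constant for the typical grid points.\<close>

lemma card_grid_ball_le_volume:
  assumes d: "0 < d" and \<nu>: "6 \<le> \<nu>"
  shows "real (card (grid_ball d ((\<nu> / 12)\<^sup>2 * d))) \<le> \<nu> ^ d"
proof -
  \<comment> \<open>chosen such that \<open>3 * (1 + 2 * \<mu>) = 3 + \<nu> / 2\<close>, which is at most \<open>\<nu>\<close>\<close>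
  define \<mu> where "\<mu> = \<nu> / 12"
  have \<mu>: "0 < \<mu>" using \<nu> by (simp add: \<mu>_def)
  have "grid_ball d (\<mu>\<^sup>2 * d) \<subseteq> int_vecs d (\<mu> * d)"
  proof
    fix z assume z: "z \<in> grid_ball d (\<mu>\<^sup>2 * d)"
    have z2: "(\<Sum>i<d. (real_of_int (z i))\<^sup>2) \<le> \<mu>\<^sup>2 * d" and zE: "z \<in> {..<d} \<rightarrow>\<^sub>E UNIV"
      using z unfolding grid_ball_def by blast+
    have "(\<Sum>i<d. \<bar>real_of_int (z i)\<bar>) \<le> sqrt d * sqrt (\<Sum>i<d. (real_of_int (z i))\<^sup>2)"
      by (rule sum_abs_le_sqrt_sum_squares)
    also have "\<dots> \<le> sqrt d * sqrt (\<mu>\<^sup>2 * d)"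
      by (intro mult_left_mono real_sqrt_le_mono z2) simp
    also have "\<dots> = \<mu> * d" using \<mu> by (simp add: real_sqrt_mult)
    finally show "z \<in> int_vecs d (\<mu> * d)" using zE unfolding int_vecs_def by blast
  qed
  then have "card (grid_ball d (\<mu>\<^sup>2 * d)) \<le> card (int_vecs d (\<mu> * d))"
    by (rule card_mono[OF finite_int_vecs])
  then have "real (card (grid_ball d (\<mu>\<^sup>2 * d))) \<le> real (card (int_vecs d (\<mu> * d)))"
    by (simp only: of_nat_le_iff)
  also have "\<dots> \<le> (1 + d / (\<mu> * d)) powr (\<mu> * d) * (1 + 2 * (\<mu> * d) / d) ^ d"
    using \<mu> d by (intro card_int_vecs_le) auto
  also have "(1 + d / (\<mu> * d)) powr (\<mu> * d) \<le> 3 ^ d"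
  proof -
    have "1 + d / (\<mu> * d) \<le> exp (1 / \<mu>)" using d exp_ge_add_one_self[of "1 / \<mu>"] by simp
    then have "(1 + d / (\<mu> * d)) powr (\<mu> * d) \<le> exp (1 / \<mu>) powr (\<mu> * d)"
      using \<mu> by (intro powr_mono2) auto
    also have "\<dots> = exp 1 ^ d" using \<mu> by (simp add: powr_def flip: exp_of_nat_mult)
    also have "\<dots> \<le> 3 ^ d" using exp_le by (intro power_mono) auto
    finally show ?thesis .
  qed
  also have "3 ^ d * (1 + 2 * (\<mu> * d) / d) ^ d = (3 * (1 + 2 * \<mu>)) ^ d"
  proof -
    have "1 + 2 * (\<mu> * d) / d = 1 + 2 * \<mu>" using d by simp
    then show ?thesis by (simp only: power_mult_distrib)
  qed
  also have "\<dots> \<le> \<nu> ^ d" using \<nu> by (intro power_mono) (auto simp: \<mu>_def)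
  finally show ?thesis using \<mu> by (simp add: \<mu>_def mult_right_mono)
qed

lemma lp_ball_subset_max:
  assumes "0 < p" "lp_norm p d a \<le> 1"
  shows "(\<Sum>i<d. \<bar>a i\<bar> powr max 1 p) \<le> 1"
proof (rule lp_ball_mono[of p])
  show "(\<Sum>i<d. \<bar>a i\<bar> powr p) \<le> 1" using assms lp_norm_le_one_iff by blast
qed (use assms in auto)

text \<open>The mesh is chosen such that the number of grid points in the ball is at most \<open>n1\<close>. The remainder of
  rounding then contributes \<open>\<epsilon> powr (2 / max 1 p - 1)\<close>.\<close>

lemma g_lin_ridge_le_middle:
  assumes \<alpha>: "0 < \<alpha>" and p: "0 < p" "p \<le> 2" and s: "s = lip_order \<alpha>"
    and B: "B = (d + s) choose s" and n1: "n1 = real n / (2 * real B)"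
    and d: "1 \<le> d" and lo: "2 * d * B < n" and hi: "n \<le> 2 ^ (d + 1) * B"
  shows "g_lin n d (ridge_class d \<alpha> p) \<le> ereal (3 * (2 powr \<alpha> * 16 powr (\<alpha> * (1 / max 1 p - 1 / 2))) *
    (log 2 (1 + real d / log 2 n1) / log 2 n1) powr (\<alpha> * (1 / max 1 p - 1 / 2)))"
proof -
  define e where "e = 1 / max 1 p - 1 / 2"
  have B0: "0 < B" by (simp add: B zero_less_binomial)
  have "real (2 * d * B) < real n" using lo by (simp only: of_nat_less_iff)
  then have dn1: "real d < n1" using B0 by (simp add: n1 pos_less_divide_eq mult_ac)
  have "real n \<le> real (2 ^ (d + 1) * B)" using hi by (simp only: of_nat_le_iff)
  then have n1d: "n1 \<le> 2 ^ d" using B0 by (simp add: n1 pos_divide_le_eq mult_ac)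
  define k where "k = log 2 n1"
  have n1_1: "1 < n1" using dn1 d by linarith
  have k0: "0 < k" using n1_1 by (simp add: k_def)
  have kd: "k \<le> d" unfolding k_def using n1d n1_1 by (subst log_le_iff) (auto simp: powr_realpow)
  have n1k: "2 powr k = n1" using n1_1 by (simp add: k_def)
  define lg where "lg = log 2 (1 + real d / k)"
  have "0 < real d / k" using k0 d by simp
  then have lg0: "0 < lg" unfolding lg_def by (subst zero_less_log_cancel_iff) auto
  define M where "M = k / (16 * lg)"
  have M0: "0 < M" using k0 lg0 by (simp add: M_def)
  define \<epsilon> where "\<epsilon> = M powr (- (1 / 2))"
  have \<epsilon>0: "0 < \<epsilon>" using M0 by (simp add: \<epsilon>_def)
  have "\<epsilon> = 1 / sqrt M"
    using M0 by (simp add: \<epsilon>_def powr_minus powr_half_sqrt inverse_eq_divide)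
  then have \<epsilon>2: "1 / \<epsilon>\<^sup>2 = M" using M0 by (simp add: power_divide)
  define E where "E = \<epsilon> powr (2 / max 1 p - 1)"
  have E0: "0 < E" using \<epsilon>0 by (simp add: E_def)
  have "g_lin n d (ridge_class d \<alpha> p) \<le> ereal (3 * (2 * E) powr \<alpha>)"
  proof (rule g_lin_ridge_le_grid[OF \<alpha> p _ \<epsilon>0 E0 s])
    show "0 < d" using d by simp
    show "\<bar>dotp d a v\<bar> \<le> E" if "lp_norm p d a \<le> 1" "\<And>i. i < d \<Longrightarrow> \<bar>v i\<bar> \<le> \<epsilon>" "(\<Sum>i<d. (v i)\<^sup>2) \<le> 1" for a v
      unfolding E_def using p that \<epsilon>0
      by (intro abs_dotp_le_interpolated lp_ball_subset_max) auto
    have "real (card (grid_ball d M)) \<le> n1"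
      using card_grid_ball_le_exp[OF _ k0 kd] d unfolding M_def lg_def n1k by simp
    then have "real (card (grid_ball d M)) * B \<le> n1 * B" by (intro mult_right_mono) auto
    also have "\<dots> \<le> n" using B0 by (simp add: n1)
    finally have "real (card (grid_ball d M) * B) \<le> real n" by simp
    then show "card (grid_ball d (1 / \<epsilon>\<^sup>2)) * ((d + s) choose s) \<le> n"
      unfolding \<epsilon>2 B[symmetric] by (simp only: of_nat_le_iff)
  qed
  also have "3 * (2 * E) powr \<alpha> = 3 * (2 powr \<alpha> * 16 powr (\<alpha> * e)) * (lg / k) powr (\<alpha> * e)"
  proof -
    have "- (1 / 2) * (2 / max 1 p - 1) = - e" by (simp add: e_def right_diff_distrib)
    then have "E = M powr (- e)" by (simp only: E_def \<epsilon>_def powr_powr)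
    also have "\<dots> = (1 / M) powr e" using M0 by (simp add: powr_minus powr_divide inverse_eq_divide)
    also have "1 / M = 16 * (lg / k)" by (simp add: M_def)
    finally have "E powr \<alpha> = (16 * (lg / k)) powr (e * \<alpha>)" by (simp only: powr_powr)
    also have "\<dots> = 16 powr (e * \<alpha>) * (lg / k) powr (e * \<alpha>)"
      by (rule powr_mult)
    finally have "E powr \<alpha> = 16 powr (\<alpha> * e) * (lg / k) powr (\<alpha> * e)"
      by (simp only: mult.commute[of e \<alpha>])
    moreover have "(2 * E) powr \<alpha> = 2 powr \<alpha> * E powr \<alpha>" by (rule powr_mult)
    ultimately show ?thesis by (simp only: mult.assoc)
  qed
  finally show ?thesis unfolding e_def lg_def k_def .
qed

text \<open>The mesh is a multiple of \<open>1 / (\<nu> * sqrt d)\<close> with \<open>\<nu> ^ d = n1\<close>. Since \<open>\<nu> > 2\<close> only, the volume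
  estimate, which loses a constant factor in the radius, is not available for \<open>\<nu> < 6\<close>; there the
  sparse estimate at \<open>k = d\<close> is used, at the price of another constant.\<close>

lemma g_lin_ridge_le_large:
  assumes \<alpha>: "0 < \<alpha>" and p: "0 < p" "p \<le> 2" and s: "s = lip_order \<alpha>"
    and B: "B = (d + s) choose s"
    and d: "1 \<le> d" and lo: "2 ^ (d + 1) * B < n"
  shows "g_lin n d (ridge_class d \<alpha> p) \<le> ereal (3 * (48 powr \<alpha> * 2 powr (\<alpha> * (2 + real s))) *
    (real n powr (- \<alpha> / real d) * real d powr (- \<alpha> * (1 / max p 1 - 1 / 2))))"
proof -
  define P where "P = max 1 p"
  have P: "1 \<le> P" by (simp add: P_def)
  have B0: "0 < B" by (simp add: B zero_less_binomial)
  define n1 where "n1 = real n / (2 * real B)"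
  have "real (2 ^ (d + 1) * B) < real n" using lo by (simp only: of_nat_less_iff)
  then have n1d: "2 ^ d < n1" using B0 by (simp add: n1_def pos_less_divide_eq mult_ac)
  then have n1_0: "0 < n1" by (rule less_trans[rotated]) simp
  define \<nu> where "\<nu> = n1 powr (1 / d)"
  have \<nu>0: "0 < \<nu>" using n1_0 by (simp add: \<nu>_def)
  have "\<nu> ^ d = \<nu> powr d" by (rule powr_realpow[OF \<nu>0, symmetric])
  also have "\<dots> = n1" using n1_0 d by (simp add: \<nu>_def powr_powr)
  finally have \<nu>d: "\<nu> ^ d = n1" .
  define E where "E = 24 * (1 / \<nu> * real d powr (1 / 2 - 1 / P))"
  have E0: "0 < E" using \<nu>0 d by (simp add: E_def)
  have d_half: "real d powr (1 - 1 / P) / sqrt d = real d powr (1 / 2 - 1 / P)"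
    by (simp only: powr_half_sqrt[OF of_nat_0_le_iff, symmetric] powr_diff[symmetric]) simp
  have "\<exists>\<epsilon>>0. \<epsilon> * real d powr (1 - 1 / P) \<le> E \<and> real (card (grid_ball d (1 / \<epsilon>\<^sup>2))) \<le> n1"
  proof (cases "6 \<le> \<nu>")
    case True
    define \<epsilon> where "\<epsilon> = 12 / \<nu> / sqrt d"
    have "1 / \<epsilon>\<^sup>2 = (\<nu> / 12)\<^sup>2 * d"
      using \<nu>0 d by (simp add: \<epsilon>_def power_divide power_mult_distrib)
    then have "real (card (grid_ball d (1 / \<epsilon>\<^sup>2))) \<le> n1"
      using card_grid_ball_le_volume[OF _ True, of d] d \<nu>d by simp
    moreover have "\<epsilon> * real d powr (1 - 1 / P) = 12 * (1 / \<nu> * real d powr (1 / 2 - 1 / P))"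
      unfolding d_half[symmetric] \<epsilon>_def by simp
    moreover have "12 * (1 / \<nu> * real d powr (1 / 2 - 1 / P)) \<le> E"
      unfolding E_def using \<nu>0 by (intro mult_right_mono) auto
    moreover have "0 < \<epsilon>" using \<nu>0 d by (simp add: \<epsilon>_def)
    ultimately show ?thesis by (intro exI[of _ \<epsilon>]) simp
  next
    case False
    define \<epsilon> where "\<epsilon> = 4 / sqrt d"
    have "1 / \<epsilon>\<^sup>2 = d / (16 * log 2 (1 + real d / real d))"
      using d by (simp add: \<epsilon>_def power_divide)
    moreover have "real (card (grid_ball d (d / (16 * log 2 (1 + real d / real d))))) \<le> 2 powr d"
      by (rule card_grid_ball_le_exp) (use d in auto)
    ultimately have "real (card (grid_ball d (1 / \<epsilon>\<^sup>2))) \<le> 2 powr d" by (simp only:)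
    also have "\<dots> \<le> n1" using n1d by (simp add: powr_realpow)
    finally have "real (card (grid_ball d (1 / \<epsilon>\<^sup>2))) \<le> n1" .
    moreover have "\<epsilon> * real d powr (1 - 1 / P) = 4 * real d powr (1 / 2 - 1 / P)"
      unfolding d_half[symmetric] \<epsilon>_def by simp
    moreover have "4 * real d powr (1 / 2 - 1 / P) \<le> 24 / \<nu> * real d powr (1 / 2 - 1 / P)"
      using False \<nu>0 by (intro mult_right_mono) (auto simp: pos_le_divide_eq)
    moreover have "24 / \<nu> * real d powr (1 / 2 - 1 / P) = E" by (simp add: E_def)
    moreover have "0 < \<epsilon>" using d by (simp add: \<epsilon>_def)
    ultimately show ?thesis by (intro exI[of _ \<epsilon>]) simp
  qed
  then obtain \<epsilon> where \<epsilon>: "0 < \<epsilon>" "\<epsilon> * real d powr (1 - 1 / P) \<le> E" "real (card (grid_ball d (1 / \<epsilon>\<^sup>2))) \<le> n1"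
    by (elim exE conjE)
  have "g_lin n d (ridge_class d \<alpha> p) \<le> ereal (3 * (2 * E) powr \<alpha>)"
  proof (rule g_lin_ridge_le_grid[OF \<alpha> p _ \<epsilon>(1) E0 s])
    show "0 < d" using d by simp
    show "\<bar>dotp d a v\<bar> \<le> E" if "lp_norm p d a \<le> 1" "\<And>i. i < d \<Longrightarrow> \<bar>v i\<bar> \<le> \<epsilon>" for a v
    proof -
      have "\<bar>dotp d a v\<bar> \<le> \<epsilon> * real d powr (1 - 1 / P)"
        by (rule abs_dotp_le_cube[OF P _ lp_ball_subset_max[OF p(1) that(1), folded P_def] _ \<epsilon>(1)])
          (use d that(2) in auto)
      then show ?thesis using \<epsilon>(2) by linarith
    qed
    have "real (card (grid_ball d (1 / \<epsilon>\<^sup>2))) * B \<le> n1 * B" using \<epsilon>(3) by (intro mult_right_mono) auto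
    also have "\<dots> \<le> n" using B0 by (simp add: n1_def)
    finally have "real (card (grid_ball d (1 / \<epsilon>\<^sup>2)) * B) \<le> real n" by simp
    then show "card (grid_ball d (1 / \<epsilon>\<^sup>2)) * ((d + s) choose s) \<le> n"
      unfolding B[symmetric] by (simp only: of_nat_le_iff)
  qed
  also have "3 * (2 * E) powr \<alpha> \<le> 3 * (48 powr \<alpha> * 2 powr (\<alpha> * (2 + real s))) *
      (real n powr (- \<alpha> / real d) * real d powr (- \<alpha> * (1 / P - 1 / 2)))"
  proof -
    have "B \<le> 2 ^ (d + s)" unfolding B by (rule binomial_le_pow2)
    then have "real B \<le> real (2 ^ (d + s))" by (simp only: of_nat_le_iff)
    then have "2 * real B \<le> 2 ^ (1 + d + s)" by simp
    also have "\<dots> \<le> (2::real) ^ (d * (2 + s))"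
    proof (rule power_increasing)
      have "s \<le> d * s" using d by simp
      then show "1 + d + s \<le> d * (2 + s)" unfolding distrib_left using d by linarith
    qed simp
    finally have "(2 * real B) powr (\<alpha> / d) \<le> (2 ^ (d * (2 + s))) powr (\<alpha> / d)"
      using \<alpha> by (intro powr_mono2) auto
    also have "\<dots> = (2 powr (real d * (2 + real s))) powr (\<alpha> / d)"
    proof -
      have "(2 :: real) ^ (d * (2 + s)) = 2 powr real (d * (2 + s))"
        by (rule powr_realpow[symmetric]) simp
      also have "real (d * (2 + s)) = real d * (2 + real s)" by (simp add: distrib_left)
      finally show ?thesis by (simp only:)
    qed
    also have "\<dots> = 2 powr (\<alpha> * (2 + real s))" using d by (simp add: powr_powr mult.commute)
    finally have Bd: "(2 * real B) powr (\<alpha> / d) \<le> 2 powr (\<alpha> * (2 + real s))" .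
    have "1 / \<nu> = n1 powr (- (1 / d))" by (simp add: \<nu>_def powr_minus_divide)
    then have "(1 / \<nu>) powr \<alpha> = n1 powr (- (1 / d) * \<alpha>)" by (simp only: powr_powr)
    also have "- (1 / d) * \<alpha> = - \<alpha> / d" by simp
    also have "n1 powr (- \<alpha> / d) = real n powr (- \<alpha> / d) / (2 * real B) powr (- \<alpha> / d)"
      unfolding n1_def by (rule powr_divide)
    also have "(2 * real B) powr (- \<alpha> / d) = inverse ((2 * real B) powr (\<alpha> / d))"
      using powr_minus[of "2 * real B" "\<alpha> / d"] by simp
    also have "real n powr (- \<alpha> / d) / inverse ((2 * real B) powr (\<alpha> / d))
        = real n powr (- \<alpha> / d) * (2 * real B) powr (\<alpha> / d)" by (simp only: divide_inverse inverse_inverse_eq)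
    also have "\<dots> \<le> real n powr (- \<alpha> / d) * 2 powr (\<alpha> * (2 + real s))"
      using Bd by (intro mult_left_mono) auto
    finally have \<nu>\<alpha>: "(1 / \<nu>) powr \<alpha> \<le> real n powr (- \<alpha> / d) * 2 powr (\<alpha> * (2 + real s))" .
    have "(2 * E) powr \<alpha> = 48 powr \<alpha> * ((1 / \<nu>) powr \<alpha> * real d powr (- \<alpha> * (1 / P - 1 / 2)))"
    proof -
      have "2 * E = 48 * (1 / \<nu> * real d powr (1 / 2 - 1 / P))" by (simp add: E_def)
      then have "(2 * E) powr \<alpha> = (48 * (1 / \<nu> * real d powr (1 / 2 - 1 / P))) powr \<alpha>" by (simp only:)
      also have "\<dots> = 48 powr \<alpha> * (1 / \<nu> * real d powr (1 / 2 - 1 / P)) powr \<alpha>"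
        by (rule powr_mult)
      also have "(1 / \<nu> * real d powr (1 / 2 - 1 / P)) powr \<alpha>
          = (1 / \<nu>) powr \<alpha> * (real d powr (1 / 2 - 1 / P)) powr \<alpha>"
        by (rule powr_mult)
      also have "(real d powr (1 / 2 - 1 / P)) powr \<alpha> = real d powr ((1 / 2 - 1 / P) * \<alpha>)"
        by (rule powr_powr)
      also have "(1 / 2 - 1 / P) * \<alpha> = - \<alpha> * (1 / P - 1 / 2)" by (simp add: algebra_simps)
      finally show ?thesis .
    qed
    also have "\<dots> \<le> 48 powr \<alpha> * (real n powr (- \<alpha> / d) * 2 powr (\<alpha> * (2 + real s)) * real d powr (- \<alpha> * (1 / P - 1 / 2)))"
      using \<nu>\<alpha> by (intro mult_left_mono mult_right_mono) auto
    finally show ?thesis by (simp add: mult_ac)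
  qed
  finally show ?thesis by (simp add: P_def max.commute)
qed

lemma g_lin_upper_bound:
  fixes \<alpha> p :: real
  assumes \<alpha>: "0 < \<alpha>" and s: "s = lip_order \<alpha>" and p: "0 < p" "p \<le> 2"
  shows "\<exists>C>0. \<forall>n\<ge>1. \<forall>d\<ge>1. let B = (d + s) choose s; n1 = real n / (2 * real B)
       in g_lin n d (ridge_class d \<alpha> p) \<le> ereal (C *
            (if n \<le> 2 * d * B then 1
             else if n \<le> 2 ^ (d + 1) * B then
               (log 2 (1 + real d / log 2 n1) / log 2 n1) powr (\<alpha> * (1 / max 1 p - 1 / 2))
             else
               real n powr (- \<alpha> / real d)
                 * real d powr (- \<alpha> * (1 / max p 1 - 1 / 2))))"
proof -
  define C1 where "C1 = 3 * (2 powr \<alpha> * 16 powr (\<alpha> * (1 / max 1 p - 1 / 2)))"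
  define C2 where "C2 = 3 * (48 powr \<alpha> * 2 powr (\<alpha> * (2 + real s)))"
  define C where "C = 1 + C1 + C2"
  have pos: "0 < C1" "0 < C2" by (auto simp: C1_def C2_def)
  show ?thesis
  proof (intro exI[of _ C] conjI allI impI, unfold Let_def)
    show "0 < C" using pos by (simp add: C_def)
    fix n d :: nat assume n: "1 \<le> n" and d: "1 \<le> d"
    let ?B = "(d + s) choose s"
    let ?n1 = "real n / (2 * real ?B)"
    let ?mid = "(log 2 (1 + real d / log 2 ?n1) / log 2 ?n1) powr (\<alpha> * (1 / max 1 p - 1 / 2))"
    let ?large = "real n powr (- \<alpha> / real d) * real d powr (- \<alpha> * (1 / max p 1 - 1 / 2))"
    have weaken: "ereal (c * x) \<le> ereal (C * x)" if "c = 1 \<or> c = C1 \<or> c = C2" "0 \<le> x" for c x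
      using that pos by (auto simp: C_def intro!: mult_right_mono)
    show "g_lin n d (ridge_class d \<alpha> p) \<le> ereal (C *
            (if n \<le> 2 * d * ?B then 1
             else if n \<le> 2 ^ (d + 1) * ?B then
               ?mid
             else
               ?large))"
    proof (cases "n \<le> 2 * d * ?B")
      case True
      have "g_lin n d (ridge_class d \<alpha> p) \<le> ereal (1 * 1)" using g_lin_ridge_le_one[OF \<alpha> p n] by simp
      also have "\<dots> \<le> ereal (C * 1)" by (rule weaken) auto
      finally show ?thesis by (simp only: True if_True)
    next
      case small: False
      show ?thesis
      proof (cases "n \<le> 2 ^ (d + 1) * ?B")
        case True
        have "g_lin n d (ridge_class d \<alpha> p) \<le> ereal (C1 *
            ?mid)"
          unfolding C1_def using small True
          by (intro g_lin_ridge_le_middle[OF \<alpha> p s refl refl d]) (simp_all only: not_le)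
        also have "\<dots> \<le> ereal (C * ?mid)"
          by (rule weaken) auto
        finally show ?thesis by (simp only: small True if_True if_False)
      next
        case False
        have "g_lin n d (ridge_class d \<alpha> p) \<le> ereal (C2 *
            ?large)"
          unfolding C2_def using False
          by (intro g_lin_ridge_le_large[OF \<alpha> p s refl d]) (simp only: not_le)
        also have "\<dots> \<le> ereal (C * ?large)"
          by (rule weaken) auto
        finally show ?thesis by (simp only: small False if_False)
      qed
    qed
  qed
qed

section \<open>Sampling numbers of ridge functions\<close>

theorem theorem4p3:
  fixes \<alpha> p :: real and s :: nat
  assumes "0 < \<alpha>" and "s = lip_order \<alpha>" and "0 < p" and "p \<le> 2"
  shows "\<exists>C c :: real. 0 < C \<and> 0 < c \<and> (\<forall>n::nat. 1 \<le> n \<longrightarrow>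
    (\<forall>d::nat. 1 \<le> d \<longrightarrow>
      (let B = (d + s) choose s;
           n1 = real n / (2 * real B)
       in g_lin n d (ridge_class d \<alpha> p) \<le> ereal (C *
            (if n \<le> 2 * d * B then 1
             else if n \<le> 2 ^ (d + 1) * B then
               (log 2 (1 + real d / log 2 n1) / log 2 n1) powr (\<alpha> * (1 / max 1 p - 1 / 2))
             else
               real n powr (- \<alpha> / real d)
                 * real d powr (- \<alpha> * (1 / max p 1 - 1 / 2)))))) \<and>
    (\<forall>d::nat. 2 \<le> d \<longrightarrow>
      g_ada n d (ridge_class d \<alpha> p) \<ge> ereal (c *
        (if n < d then 1
         else if n < 2 ^ (d - 1) then
           (log 2 (1 + real d / (2 + log 2 (real n))) / (2 + log 2 (real n)))
             powr (\<alpha> * (1 / p - 1 / 2))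
         else
           real n powr (- 2 * \<alpha> / (real d - 1))
             * real d powr (- \<alpha> * (1 / p - 1 / 2))))))"
proof -
  let "\<exists>C c. 0 < C \<and> 0 < c \<and> (\<forall>n. 1 \<le> n \<longrightarrow> (\<forall>d. 1 \<le> d \<longrightarrow> ?U C n d) \<and> (\<forall>d. 2 \<le> d \<longrightarrow> ?L c n d))"
    = ?thesis
  from g_lin_upper_bound[OF assms] obtain C where "0 < C" and C: "\<forall>n\<ge>1. \<forall>d\<ge>1. ?U C n d"
    by (elim exE conjE)
  from g_ada_lower_bound[OF assms(1,3,4)] obtain c where "0 < c" and c: "\<forall>n\<ge>1. \<forall>d\<ge>2. ?L c n d"
    by (elim exE conjE)
  show ?thesis
    by (intro exI[of _ C] exI[of _ c] conjI allI impI)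
      (fact \<open>0 < C\<close>, fact \<open>0 < c\<close>, (rule C[rule_format] c[rule_format], assumption+)+)
qed

end
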